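(* Let $R_j^\epsilon$, $R_j^{*\epsilon}$ ($1\le j\le n$, $\epsilon>0$) be the truncated Riesz transforms associated to the Grushin operator $G=-\Delta_\xi-|\xi|^2\partial_\eta^2$ on $\mathbb{R}^n\times\mathbb{R}$, and let $p_1$ be the time-one heat kernel of the sub-Laplacian on the Heisenberg group $\mathbb{H}^n=\mathbb{C}^n\times\mathbb{R}$. Then, for functions $f$ on $\mathbb{R}^n\times\mathbb{R}$, $$R_j^{\epsilon}f(\xi,\eta)=\frac1{\sqrt\pi}\int_{\mathbb{H}^n}T_\epsilon^{(z,t)}f(\xi,\eta)\,\tilde Z_jp_1(z,t)\,dz\,dt$$ and $$R_j^{*\epsilon}f(\xi,\eta)=\frac1{\sqrt\pi}\int_{\mathbb{H}^n}T_\epsilon^{(z,t)}f(\xi,\eta)\,\tilde Z_j^*p_1(z,t)\,dz\,dt,$$ where, for $z=x+iy$ with $x,y\in\mathbb{R}^n$ and $t\in\mathbb{R}$, $$T_\epsilon^{(z,t)}f(\xi,\eta)=\int_{\epsilon<|r|<1/\epsilon}f\left(\xi+ry,\ \eta+r\,x\cdot\xi+r^2\left(t+\frac{x\cdot y}{2}\right)\right)\frac{dr}{r}.$$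
   Context: For a function $f$ on $\mathbb{R}^n\times\mathbb{R}$, $f^\lambda(\xi)=\int_{\mathbb{R}}f(\xi,\eta)e^{i\lambda\eta}\,d\eta$ is the inverse Fourier transform of $f$ in the $\eta$ variable. For $\lambda\in\mathbb{R}\setminus\{0\}$, $H(\lambda)=-\Delta+\lambda^2|\xi|^2$ is the scaled Hermite operator on $\mathbb{R}^n$ with semigroup $e^{-rH(\lambda)}$, and $$A_j(\lambda)=-\frac{\partial}{\partial\xi_j}+\lambda\xi_j,\qquad A_j(\lambda)^*=\frac{\partial}{\partial\xi_j}+\lambda\xi_j.$$ For $\epsilon>0$, $$R_j^\epsilon(\lambda)=\frac{A_j(\lambda)}{\sqrt\pi}\int_{\epsilon^2}^{1/\epsilon^2}e^{-rH(\lambda)}r^{-1/2}\,dr,\qquad R_j^{*\epsilon}(\lambda)=\frac{A_j(\lambda)^*}{\sqrt\pi}\int_{\epsilon^2}^{1/\epsilon^2}e^{-rH(\lambda)}r^{-1/2}\,dr,$$ and the truncated Riesz transforms for the Grushin operator are $$R_j^\epsilon f(\xi,\eta)=\frac1{2\pi}\int_{-\infty}^{\infty}e^{-i\lambda\eta}R_j^\epsilon(\lambda)f^\lambda(\xi)\,d\lambda,\qquad R_j^{*\epsilon}f(\xi,\eta)=\frac1{2\pi}\int_{-\infty}^{\infty}e^{-i\lambda\eta}R_j^{*\epsilon}(\lambda)f^\lambda(\xi)\,d\lambda .$$ On $\mathbb{H}^n=\mathbb{C}^n\times\mathbb{R}$, with coordinates $(z,t)$, $z=x+iy$, and Lebesgue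 measure $dz\,dt$, the sub-Laplacian is $\mathcal{L}=\sum_{j=1}^n(X_j^2+Y_j^2)$ with $X_j=\frac{\partial}{\partial x_j}+\frac12y_j\frac{\partial}{\partial t}$, $Y_j=\frac{\partial}{\partial y_j}-\frac12x_j\frac{\partial}{\partial t}$. Its heat kernel $p_s(z,t)$ $(s>0)$ satisfies $$\int_{\mathbb{R}}p_s(z,t)e^{i\lambda t}\,dt=(4\pi)^{-n}\left(\frac{\lambda}{\sinh\lambda s}\right)^ne^{-\frac14\lambda\coth(s\lambda)|z|^2}.$$ The differential operators in the claim are $$\tilde Z_j=i\tilde X_j+\tilde Y_j,\quad \tilde Z_j^*=i\tilde X_j-\tilde Y_j,\quad \tilde X_j=\frac{\partial}{\partial x_j}-\frac{y_j}{2}\frac{\partial}{\partial t},\quad \tilde Y_j=\frac{\partial}{\partial y_j}+\frac{x_j}{2}\frac{\partial}{\partial t}.$$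
   Formalization: In T_ε the second argument of f is η − (r x·ξ + r²(t + x·y/2)) instead of η + …; with the printed plus sign and the stated Fourier convention the right sides equal −R_j^{*ε}f and −R_j^εf, so the claim fails. "Functions f" means integrable complex-valued f. *)

theory Defs
  imports "HOL-Analysis.Analysis"
begin

subsection \<open>The scaled Hermite operator and its semigroup\<close>

definition partial_at :: "'n::finite \<Rightarrow> (real^'n \<Rightarrow> 'b::real_normed_vector) \<Rightarrow> real^'n \<Rightarrow> 'b" where
  "partial_at j g \<xi> = vector_derivative (\<lambda>s. g (\<xi> + s *\<^sub>R axis j 1)) (at 0)"

definition hermite_op :: "real \<Rightarrow> (real^'n::finite \<Rightarrow> real) \<Rightarrow> real^'n \<Rightarrow> real" where
  "hermite_op lam g \<xi> = - (\<Sum>j\<in>UNIV. partial_at j (partial_at j g) \<xi>) + lam\<^sup>2 * (norm \<xi>)\<^sup>2 * g \<xi>"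

fun hermite_poly :: "nat \<Rightarrow> real \<Rightarrow> real" where
  "hermite_poly 0 x = 1"
| "hermite_poly (Suc 0) x = 2 * x"
| "hermite_poly (Suc (Suc k)) x =
     2 * x * hermite_poly (Suc k) x - 2 * real (Suc k) * hermite_poly k x"

definition hermite_fun1 :: "nat \<Rightarrow> real \<Rightarrow> real" where
  "hermite_fun1 k x = hermite_poly k x * exp (- x\<^sup>2 / 2) / sqrt (2 ^ k * fact k * sqrt pi)"

text \<open>The orthonormal basis of eigenfunctions of the scaled Hermite operator in
  \<open>L\<^sup>2\<close>, indexed by multi-indices; see \<open>hermite_op_hermite_fun\<close> below for the eigenvalues.\<close>

definition hermite_fun :: "real \<Rightarrow> ('n::finite \<Rightarrow> nat) \<Rightarrow> real^'n \<Rightarrow> real" where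
  "hermite_fun lam \<alpha> \<xi> =
     \<bar>lam\<bar> powr (real CARD('n) / 4) * (\<Prod>i\<in>UNIV. hermite_fun1 (\<alpha> i) (sqrt \<bar>lam\<bar> * \<xi> $ i))"

definition hermite_eigenvalue :: "real \<Rightarrow> ('n::finite \<Rightarrow> nat) \<Rightarrow> real" where
  "hermite_eigenvalue lam \<alpha> = real (2 * (\<Sum>i\<in>UNIV. \<alpha> i) + CARD('n)) * \<bar>lam\<bar>"

text \<open>The semigroup \<open>exp (- r H(lam))\<close> for \<open>r > 0\<close>, through the spectral decomposition of \<open>H(lam)\<close>.
  For \<open>g\<close> in \<open>L\<^sup>1\<close> or \<open>L\<^sup>2\<close> the series converges absolutely at every point, so this picks
  the smooth representative of the \<open>L\<^sup>2\<close> class.\<close>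

definition hermite_semigroup :: "real \<Rightarrow> real \<Rightarrow> (real^'n::finite \<Rightarrow> complex) \<Rightarrow> real^'n \<Rightarrow> complex" where
  "hermite_semigroup lam r g \<xi> =
     (\<Sum>\<^sub>\<infinity>\<alpha>\<in>UNIV. of_real (exp (- r * hermite_eigenvalue lam \<alpha>))
        * (LINT \<xi>'|lborel. g \<xi>' * of_real (hermite_fun lam \<alpha> \<xi>'))
        * of_real (hermite_fun lam \<alpha> \<xi>))"

lemma hermite_poly_deriv:
  "(hermite_poly k has_real_derivative 2 * real k * hermite_poly (k - 1) x) (at x)"
proof (induction k rule: less_induct)
  case (less k)
  consider "k = 0" | "k = 1" | m where "k = Suc (Suc m)"
    by (metis One_nat_def not0_implies_Suc)
  then show ?case
  proof cases
    case 1
    have "hermite_poly 0 = (\<lambda>x. 1)" by auto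
    then show ?thesis using 1 by simp
  next
    case 2
    have "hermite_poly (Suc 0) = (\<lambda>x. 2 * x)" by auto
    then show ?thesis using 2 by (auto intro!: derivative_eq_intros)
  next
    case (3 m)
    have e: "hermite_poly k = (\<lambda>x. 2 * x * hermite_poly (Suc m) x - 2 * real (Suc m) * hermite_poly m x)"
      using 3 by (intro ext) simp
    have d1: "(hermite_poly (Suc m) has_real_derivative 2 * real (Suc m) * hermite_poly m x) (at x)"
      using less.IH[of "Suc m"] 3 by simp
    have d0: "(hermite_poly m has_real_derivative 2 * real m * hermite_poly (m - 1) x) (at x)"
      using less.IH[of m] 3 by simp
    have rec: "2 * x * hermite_poly m x - 2 * real m * hermite_poly (m - 1) x = hermite_poly (Suc m) x"
      by (cases m) auto
    have "(hermite_poly k has_real_derivative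
        2 * hermite_poly (Suc m) x + 2 * x * (2 * real (Suc m) * hermite_poly m x)
        - 2 * real (Suc m) * (2 * real m * hermite_poly (m - 1) x)) (at x)"
      unfolding e by (rule derivative_eq_intros d1 d0 refl)+ simp
    also have "2 * hermite_poly (Suc m) x + 2 * x * (2 * real (Suc m) * hermite_poly m x)
        - 2 * real (Suc m) * (2 * real m * hermite_poly (m - 1) x)
      = 2 * hermite_poly (Suc m) x + 2 * real (Suc m) * (2 * x * hermite_poly m x - 2 * real m * hermite_poly (m - 1) x)"
      by (simp add: algebra_simps)
    also have "\<dots> = 2 * real k * hermite_poly (k - 1) x"
      unfolding rec using 3 by (simp add: algebra_simps)
    finally show ?thesis .
  qed
qed

lemma hermite_fun1_deriv:
  "\<exists>h'. (\<forall>x. (hermite_fun1 k has_real_derivative h' x) (at x))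
      \<and> (\<forall>x. (h' has_real_derivative (x\<^sup>2 - real (2 * k + 1)) * hermite_fun1 k x) (at x))"
proof -
  define c where "c = sqrt (2 ^ k * fact k * sqrt pi)"
  have c: "c \<noteq> 0" by (simp add: c_def)
  have f: "hermite_fun1 k = (\<lambda>x. hermite_poly k x * exp (- x\<^sup>2 / 2) / c)"
    by (intro ext) (simp add: hermite_fun1_def c_def)
  define h' where "h' x = (2 * real k * hermite_poly (k - 1) x - x * hermite_poly k x) * exp (- x\<^sup>2 / 2) / c" for x
  have ex: "((\<lambda>x. exp (- x\<^sup>2 / 2)) has_real_derivative - x * exp (- x\<^sup>2 / 2)) (at x)" for x :: real
    by (auto intro!: derivative_eq_intros)
  have prod: "((\<lambda>x. F x * exp (- x\<^sup>2 / 2) / c) has_real_derivative (D - x * F x) * exp (- x\<^sup>2 / 2) / c) (at x)"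
    if "(F has_real_derivative D) (at x)" for F D x
    using DERIV_cdivide[OF DERIV_mult[OF that ex], of c] by (simp add: algebra_simps)
  have 1: "(hermite_fun1 k has_real_derivative h' x) (at x)" for x
    unfolding f h'_def by (rule prod[OF hermite_poly_deriv])
  have rec: "2 * real k * (2 * real (k - 1) * hermite_poly (k - 1 - 1) x)
      = 2 * real k * (2 * x * hermite_poly (k - 1) x - hermite_poly k x)" for x
  proof (cases k)
    case (Suc m)
    then show ?thesis by (cases m) auto
  qed simp
  have 2: "(h' has_real_derivative (x\<^sup>2 - real (2 * k + 1)) * hermite_fun1 k x) (at x)" for x
  proof -
    have "(h' has_real_derivative
        ((2 * real k * (2 * real (k - 1) * hermite_poly (k - 1 - 1) x)
          - (hermite_poly k x + x * (2 * real k * hermite_poly (k - 1) x)))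
         - x * (2 * real k * hermite_poly (k - 1) x - x * hermite_poly k x)) * exp (- x\<^sup>2 / 2) / c) (at x)"
      unfolding h'_def
      by (rule prod, (rule derivative_eq_intros hermite_poly_deriv refl)+) simp
    also have "((2 * real k * (2 * real (k - 1) * hermite_poly (k - 1 - 1) x)
          - (hermite_poly k x + x * (2 * real k * hermite_poly (k - 1) x)))
         - x * (2 * real k * hermite_poly (k - 1) x - x * hermite_poly k x)) * exp (- x\<^sup>2 / 2) / c
        = (x\<^sup>2 - real (2 * k + 1)) * hermite_fun1 k x"
      unfolding rec f by (simp add: c field_simps power2_eq_square)
    finally show ?thesis .
  qed
  show ?thesis using 1 2 by blast
qed

lemma hermite_op_hermite_fun:
  "hermite_op lam (hermite_fun lam \<alpha>) \<xi> = hermite_eigenvalue lam \<alpha> * hermite_fun lam \<alpha> (\<xi> :: real^'n::finite)"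
proof -
  define c where "c = sqrt \<bar>lam\<bar>"
  define a where "a = \<bar>lam\<bar> powr (real CARD('n) / 4)"
  have c2: "c * c = \<bar>lam\<bar>" by (simp add: c_def)
  have "\<forall>k. \<exists>h'. (\<forall>x. (hermite_fun1 k has_real_derivative h' x) (at x))
      \<and> (\<forall>x. (h' has_real_derivative (x\<^sup>2 - real (2 * k + 1)) * hermite_fun1 k x) (at x))"
    using hermite_fun1_deriv by blast
  then obtain h' where h1: "\<And>k x. (hermite_fun1 k has_real_derivative h' k x) (at x)"
    and h2: "\<And>k x. (h' k has_real_derivative (x\<^sup>2 - real (2 * k + 1)) * hermite_fun1 k x) (at x)"
    by metis
  define rest where "rest j \<xi> = a * (\<Prod>i\<in>UNIV - {j}. hermite_fun1 (\<alpha> i) (c * \<xi> $ i))" for j and \<xi> :: "real^'n"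
  have split: "hermite_fun lam \<alpha> \<xi> = rest j \<xi> * hermite_fun1 (\<alpha> j) (c * \<xi> $ j)" for j \<xi>
    unfolding hermite_fun_def rest_def a_def c_def
    by (subst prod.remove[of UNIV j]) auto
  have rest_shift: "rest j (\<xi> + s *\<^sub>R axis j 1) = rest j \<xi>" for j s \<xi>
    unfolding rest_def
    by (intro arg_cong2[where f = "(*)"] refl prod.cong) (auto simp: axis_def)
  have comp: "c * (\<xi> + s *\<^sub>R axis j 1) $ j = c * \<xi> $ j + c * s" for j s and \<xi> :: "real^'n"
    by (simp add: algebra_simps)
  have aff: "((\<lambda>s. F (b + c * s)) has_real_derivative c * D) (at 0)"
    if "(F has_real_derivative D) (at b)" for F D b
  proof -
    have "((\<lambda>s. F (b + c * s)) has_real_derivative D * c) (at 0)"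
      by (rule DERIV_chain2[where f = F and g = "\<lambda>s. b + c * s"])
        (use that in \<open>auto intro!: derivative_eq_intros\<close>)
    then show ?thesis by (simp add: mult.commute)
  qed
  have p1: "partial_at j (hermite_fun lam \<alpha>) = (\<lambda>\<xi>. rest j \<xi> * (c * h' (\<alpha> j) (c * \<xi> $ j)))" for j
  proof
    fix \<xi> :: "real^'n"
    have "((\<lambda>s. hermite_fun lam \<alpha> (\<xi> + s *\<^sub>R axis j 1)) has_real_derivative
        rest j \<xi> * (c * h' (\<alpha> j) (c * \<xi> $ j))) (at 0)"
      unfolding split[of _ j] rest_shift comp by (intro DERIV_cmult aff h1)
    then show "partial_at j (hermite_fun lam \<alpha>) \<xi> = rest j \<xi> * (c * h' (\<alpha> j) (c * \<xi> $ j))"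
      unfolding partial_at_def
      by (simp add: has_real_derivative_iff_has_vector_derivative vector_derivative_at)
  qed
  have p2: "partial_at j (partial_at j (hermite_fun lam \<alpha>)) \<xi>
      = \<bar>lam\<bar> * ((c * \<xi> $ j)\<^sup>2 - real (2 * \<alpha> j + 1)) * hermite_fun lam \<alpha> \<xi>" for j
  proof -
    have "((\<lambda>s. partial_at j (hermite_fun lam \<alpha>) (\<xi> + s *\<^sub>R axis j 1)) has_real_derivative
        rest j \<xi> * (c * (c * (((c * \<xi> $ j)\<^sup>2 - real (2 * \<alpha> j + 1)) * hermite_fun1 (\<alpha> j) (c * \<xi> $ j))))) (at 0)"
      unfolding p1 rest_shift comp by (intro DERIV_cmult aff h2)
    then have "partial_at j (partial_at j (hermite_fun lam \<alpha>)) \<xi>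
      = rest j \<xi> * (c * (c * (((c * \<xi> $ j)\<^sup>2 - real (2 * \<alpha> j + 1)) * hermite_fun1 (\<alpha> j) (c * \<xi> $ j))))"
      unfolding partial_at_def[of j "partial_at j (hermite_fun lam \<alpha>)"]
      by (simp add: has_real_derivative_iff_has_vector_derivative vector_derivative_at)
    also have "\<dots> = (c * c) * ((c * \<xi> $ j)\<^sup>2 - real (2 * \<alpha> j + 1)) * hermite_fun lam \<alpha> \<xi>"
      unfolding split[of _ j] by (simp only: mult_ac)
    finally show ?thesis unfolding c2 .
  qed
  have n: "(\<Sum>j\<in>UNIV. (c * \<xi> $ j)\<^sup>2) = \<bar>lam\<bar> * (norm \<xi>)\<^sup>2"
    unfolding power2_norm_eq_inner inner_vec_def sum_distrib_left
    by (simp add: power2_eq_square c2[symmetric] mult_ac)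
  have "(\<Sum>j\<in>UNIV. partial_at j (partial_at j (hermite_fun lam \<alpha>)) \<xi>)
      = \<bar>lam\<bar> * ((\<Sum>j\<in>UNIV. (c * \<xi> $ j)\<^sup>2) - (\<Sum>j\<in>UNIV. real (2 * \<alpha> j + 1))) * hermite_fun lam \<alpha> \<xi>"
    unfolding p2 sum_distrib_right[symmetric] sum_distrib_left[symmetric] sum_subtractf by simp
  also have "(\<Sum>j\<in>UNIV. real (2 * \<alpha> j + 1)) = real (2 * (\<Sum>i\<in>UNIV. \<alpha> i) + CARD('n))"
    by (simp add: sum.distrib sum_distrib_left)
  finally have "(\<Sum>j\<in>UNIV. partial_at j (partial_at j (hermite_fun lam \<alpha>)) \<xi>)
    = lam\<^sup>2 * (norm \<xi>)\<^sup>2 * hermite_fun lam \<alpha> \<xi> - hermite_eigenvalue lam \<alpha> * hermite_fun lam \<alpha> \<xi>"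
    unfolding n hermite_eigenvalue_def
    by (simp add: algebra_simps power2_eq_square)
  then show ?thesis unfolding hermite_op_def by simp
qed

subsection \<open>Truncated Riesz transforms for the Grushin operator\<close>

definition A_op :: "real \<Rightarrow> 'n::finite \<Rightarrow> (real^'n \<Rightarrow> complex) \<Rightarrow> real^'n \<Rightarrow> complex" where
  "A_op lam j g \<xi> = - partial_at j g \<xi> + of_real (lam * \<xi> $ j) * g \<xi>"

definition A_star_op :: "real \<Rightarrow> 'n::finite \<Rightarrow> (real^'n \<Rightarrow> complex) \<Rightarrow> real^'n \<Rightarrow> complex" where
  "A_star_op lam j g \<xi> = partial_at j g \<xi> + of_real (lam * \<xi> $ j) * g \<xi>"

text \<open>The \<open>r\<close>-integral is a set integral, hence \<open>0\<close> when \<open>\<epsilon> > 1\<close>.\<close>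

definition hermite_truncated_integral ::
  "real \<Rightarrow> real \<Rightarrow> (real^'n::finite \<Rightarrow> complex) \<Rightarrow> real^'n \<Rightarrow> complex" where
  "hermite_truncated_integral \<epsilon> lam g \<xi> =
     (LINT r:{\<epsilon>\<^sup>2..1 / \<epsilon>\<^sup>2}|lborel. hermite_semigroup lam r g \<xi> * of_real (r powr (-1/2)))"

definition hermite_riesz :: "real \<Rightarrow> real \<Rightarrow> 'n::finite \<Rightarrow> (real^'n \<Rightarrow> complex) \<Rightarrow> real^'n \<Rightarrow> complex" where
  "hermite_riesz \<epsilon> lam j g \<xi> =
     of_real (1 / sqrt pi) * A_op lam j (hermite_truncated_integral \<epsilon> lam g) \<xi>"

definition hermite_riesz_star :: "real \<Rightarrow> real \<Rightarrow> 'n::finite \<Rightarrow> (real^'n \<Rightarrow> complex) \<Rightarrow> real^'n \<Rightarrow> complex" where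
  "hermite_riesz_star \<epsilon> lam j g \<xi> =
     of_real (1 / sqrt pi) * A_star_op lam j (hermite_truncated_integral \<epsilon> lam g) \<xi>"

definition fourier_eta :: "real \<Rightarrow> ((real^'n::finite) \<times> real \<Rightarrow> complex) \<Rightarrow> real^'n \<Rightarrow> complex" where
  "fourier_eta lam f \<xi> = (LINT \<eta>|lborel. f (\<xi>, \<eta>) * cis (lam * \<eta>))"

definition grushin_riesz ::
  "real \<Rightarrow> 'n::finite \<Rightarrow> ((real^'n) \<times> real \<Rightarrow> complex) \<Rightarrow> real^'n \<Rightarrow> real \<Rightarrow> complex" where
  "grushin_riesz \<epsilon> j f \<xi> \<eta> = of_real (1 / (2 * pi)) *
     (LINT lam|lborel. cis (- (lam * \<eta>)) * hermite_riesz \<epsilon> lam j (fourier_eta lam f) \<xi>)"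

definition grushin_riesz_star ::
  "real \<Rightarrow> 'n::finite \<Rightarrow> ((real^'n) \<times> real \<Rightarrow> complex) \<Rightarrow> real^'n \<Rightarrow> real \<Rightarrow> complex" where
  "grushin_riesz_star \<epsilon> j f \<xi> \<eta> = of_real (1 / (2 * pi)) *
     (LINT lam|lborel. cis (- (lam * \<eta>)) * hermite_riesz_star \<epsilon> lam j (fourier_eta lam f) \<xi>)"

subsection \<open>The Heisenberg group\<close>

type_synonym 'n heis = "(complex^'n) \<times> real"

definition Re_vec :: "complex^'n::finite \<Rightarrow> real^'n" where
  "Re_vec z = (\<chi> i. Re (z $ i))"

definition Im_vec :: "complex^'n::finite \<Rightarrow> real^'n" where
  "Im_vec z = (\<chi> i. Im (z $ i))"

definition dx :: "'n::finite \<Rightarrow> ('n heis \<Rightarrow> 'b::real_normed_vector) \<Rightarrow> 'n heis \<Rightarrow> 'b" where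
  "dx j F w = vector_derivative (\<lambda>s. F (fst w + axis j (of_real s), snd w)) (at 0)"

definition dy :: "'n::finite \<Rightarrow> ('n heis \<Rightarrow> 'b::real_normed_vector) \<Rightarrow> 'n heis \<Rightarrow> 'b" where
  "dy j F w = vector_derivative (\<lambda>s. F (fst w + axis j (\<i> * of_real s), snd w)) (at 0)"

definition dt :: "('n::finite heis \<Rightarrow> 'b::real_normed_vector) \<Rightarrow> 'n heis \<Rightarrow> 'b" where
  "dt F w = vector_derivative (\<lambda>s. F (fst w, snd w + s)) (at 0)"

definition X_op :: "'n::finite \<Rightarrow> ('n heis \<Rightarrow> 'b::real_normed_vector) \<Rightarrow> 'n heis \<Rightarrow> 'b" where
  "X_op j F w = dx j F w + (Im (fst w $ j) / 2) *\<^sub>R dt F w"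

definition Y_op :: "'n::finite \<Rightarrow> ('n heis \<Rightarrow> 'b::real_normed_vector) \<Rightarrow> 'n heis \<Rightarrow> 'b" where
  "Y_op j F w = dy j F w - (Re (fst w $ j) / 2) *\<^sub>R dt F w"

definition sublaplacian :: "('n::finite heis \<Rightarrow> 'b::real_normed_vector) \<Rightarrow> 'n heis \<Rightarrow> 'b" where
  "sublaplacian F w = (\<Sum>j\<in>UNIV. X_op j (X_op j F) w + Y_op j (Y_op j F) w)"

definition X_tilde :: "'n::finite \<Rightarrow> ('n heis \<Rightarrow> 'b::real_normed_vector) \<Rightarrow> 'n heis \<Rightarrow> 'b" where
  "X_tilde j F w = dx j F w - (Im (fst w $ j) / 2) *\<^sub>R dt F w"

definition Y_tilde :: "'n::finite \<Rightarrow> ('n heis \<Rightarrow> 'b::real_normed_vector) \<Rightarrow> 'n heis \<Rightarrow> 'b" where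
  "Y_tilde j F w = dy j F w + (Re (fst w $ j) / 2) *\<^sub>R dt F w"

definition Z_tilde :: "'n::finite \<Rightarrow> ('n heis \<Rightarrow> complex) \<Rightarrow> 'n heis \<Rightarrow> complex" where
  "Z_tilde j F w = \<i> * X_tilde j F w + Y_tilde j F w"

definition Z_tilde_star :: "'n::finite \<Rightarrow> ('n heis \<Rightarrow> complex) \<Rightarrow> 'n heis \<Rightarrow> complex" where
  "Z_tilde_star j F w = \<i> * X_tilde j F w - Y_tilde j F w"

coinductive smooth :: "('a::euclidean_space \<Rightarrow> real) \<Rightarrow> bool" where
  "\<lbrakk>\<And>x. F differentiable (at x); \<And>v. smooth (\<lambda>x. frechet_derivative F (at x) v)\<rbrakk> \<Longrightarrow> smooth F"

text \<open>The heat kernel of the sub-Laplacian, as a fundamental solution of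
  \<open>\<partial>\<^sub>s p = \<L> p\<close>, with its partial Fourier transform in the central variable. The transform
  determines \<open>p s\<close> for \<open>s > 0\<close>, since \<open>p s\<close> is continuous. At \<open>lam = 0\<close> the right-hand side
  is to be read as a limit, so that value is left out.\<close>

definition heisenberg_heat_kernel :: "(real \<Rightarrow> 'n::finite heis \<Rightarrow> real) \<Rightarrow> bool" where
  "heisenberg_heat_kernel p \<longleftrightarrow>
     (\<forall>s>0. smooth (p s) \<and> (\<forall>w. p s w \<ge> 0) \<and> integrable lborel (p s)) \<and>
     (\<forall>s>0. \<forall>w. ((\<lambda>r. p r w) has_real_derivative sublaplacian (p s) w) (at s)) \<and>
     (\<forall>\<phi> :: 'n heis \<Rightarrow> real. continuous_on UNIV \<phi> \<and> bounded (range \<phi>) \<longrightarrow>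
        ((\<lambda>s. LINT w|lborel. p s w * \<phi> w) \<longlongrightarrow> \<phi> 0) (at_right 0)) \<and>
     (\<forall>s>0. \<forall>z. integrable lborel (\<lambda>t. p s (z, t))) \<and>
     (\<forall>s>0. \<forall>z lam. lam \<noteq> 0 \<longrightarrow>
        (LINT t|lborel. of_real (p s (z, t)) * cis (lam * t)) =
        complex_of_real ((lam / sinh (lam * s)) ^ CARD('n) / (4 * pi) ^ CARD('n)
          * exp (- (1/4) * lam * (cosh (s * lam) / sinh (s * lam)) * (norm z)\<^sup>2)))"

text \<open>The shift in \<open>\<eta>\<close> carries the sign that matches \<open>fourier_eta\<close>: writing
  \<open>\<pi>\<^bsub>lam\<^esub>(z,t) g(\<xi>) = exp (i lam (t + x \<bullet> \<xi> + x \<bullet> y / 2)) g(\<xi> + y)\<close> for the Schroedinger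
  representation, translating \<open>\<eta>\<close> by \<open>-a\<close> multiplies \<open>\<integral> f(\<xi>,\<eta>) exp (i lam \<eta>) d\<eta>\<close> by
  \<open>exp (i lam a)\<close>, so at frequency \<open>lam\<close> this operator is the truncated integral of
  \<open>\<pi>\<^bsub>lam\<^esub>(r z, r\<^sup>2 t)\<close>. With the opposite sign of the shift it would be that of \<open>\<pi>\<^bsub>-lam\<^esub>\<close>, and
  \<open>A\<^sub>j(-lam) = - A\<^sub>j(lam)\<^sup>*\<close>.\<close>

definition T_op ::
  "real \<Rightarrow> 'n::finite heis \<Rightarrow> ((real^'n) \<times> real \<Rightarrow> complex) \<Rightarrow> real^'n \<Rightarrow> real \<Rightarrow> complex" where
  "T_op \<epsilon> w f \<xi> \<eta> = (let x = Re_vec (fst w); y = Im_vec (fst w); t = snd w in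
     (LINT r:{r. \<epsilon> < \<bar>r\<bar> \<and> \<bar>r\<bar> < 1 / \<epsilon>}|lborel.
        f (\<xi> + r *\<^sub>R y, \<eta> - (r * (x \<bullet> \<xi>) + r\<^sup>2 * (t + (x \<bullet> y) / 2))) / of_real r))"

end

theory Submission
  imports Defs "HOL-Probability.Probability" "HOL-Real_Asymp.Real_Asymp"
begin

text \<open>Both sides are integrals of \<open>f\<close> against an explicit kernel, over the annulus \<open>\<epsilon> < \<bar>r\<bar> < 1 / \<epsilon>\<close>.

  On the Grushin side, Mehler's formula turns \<open>exp (- s H(lam))\<close> into an integral operator with
  Gaussian kernel, the substitution \<open>s = r\<^sup>2\<close> absorbs the weight \<open>s powr (-1/2)\<close>, and \<open>A\<^sub>j\<close> is applied
  under the integral. On the Heisenberg side, Fourier inversion in \<open>t\<close> writes \<open>p 1\<close> as an integral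
  of Gaussians in \<open>z\<close>, on which the fields act by explicit multipliers; the
  substitution \<open>\<xi>' = \<xi> + r y\<close>, \<open>\<eta>' = \<eta> - r x \<bullet> \<xi> - r\<^sup>2 (t + x \<bullet> y / 2)\<close> followed by the Gaussian integral in
  \<open>x\<close> leaves, at frequency \<open>lam r\<^sup>2\<close>, exactly the derivative of the Mehler kernel at time \<open>r\<^sup>2\<close>.

  The two statements differ by a sign \<open>sg = \<plusminus>1\<close>: \<open>A\<^sub>j\<close> and \<open>A\<^sub>j\<^sup>*\<close> are \<open>- sg \<partial>\<^sub>j + lam \<xi>\<^sub>j\<close>, and the fields are
  \<open>\<i> X + sg Y\<close>.\<close>

subsection \<open>Differentiation under the integral sign\<close>

text \<open>\<open>f\<close> is merely integrable, so \<open>fourier_eta lam f\<close> need not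
  decay in \<open>lam\<close> and absolute convergence must come from the kernels. The truncation
  supplies it: for \<open>s \<ge> \<epsilon>\<^sup>2\<close> the n-th power of the Mehler factor,
  even multiplied by \<open>1 + \<bar>lam\<bar>\<close> to pay for one derivative, is at most a
  multiple of \<open>1 / (1 + lam\<^sup>2)\<close>. On the Heisenberg side only Gaussian decay in x
  is kept from the kernel; integrability in y and t is taken from \<open>f\<close> after the change
  of variables, whose Jacobian is controlled because r stays away from 0. Parity in r matters: half
  of the measure 2 dr obtained from s = r^2 is moved to negative r, while the odd weight 1/r in
  \<open>T_op\<close> is cancelled by an odd factor r that the x-integral produces. At
  \<open>lam = 0\<close> the quotients by \<open>sinh\<close> have the conventional value 0 instead
  of their limits. Identities in \<open>lam\<close> are therefore proved off 0 and passed to the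
  integrals because a point is a null set. Both sides meet in \<open>ladder_kernel\<close>.\<close>

lemma integrable_dominated:
  fixes f :: "'a \<Rightarrow> 'b::{banach,second_countable_topology}" and g :: "'a \<Rightarrow> real"
  assumes "integrable M g" "f \<in> borel_measurable M" "\<And>x. x \<in> space M \<Longrightarrow> norm (f x) \<le> g x"
  shows "integrable M f"
  using assms(1,2) by (rule Bochner_Integration.integrable_bound)
    (unfold real_norm_def, rule AE_I2, rule order_trans[OF assms(3) abs_ge_self])

text \<open>The first-order remainder divided by \<open>h\<close> is at most \<open>2 * B\<close> by
  the mean value inequality and tends to 0 pointwise, so dominated convergence applies.
  Differentiating at 0 with radius 1 fits the uses, which all shift a parameter by
  \<open>s\<close>.\<close>

lemma has_vector_derivative_lebesgue_integral:
  fixes F F' :: "real \<Rightarrow> 'a \<Rightarrow> 'b::{banach,second_countable_topology}"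
  assumes int: "\<And>s. \<bar>s\<bar> < 1 \<Longrightarrow> integrable M (F s)"
    and der: "\<And>s x. x \<in> space M \<Longrightarrow> \<bar>s\<bar> < 1 \<Longrightarrow> ((\<lambda>s. F s x) has_vector_derivative F' s x) (at s)"
    and bd: "\<And>s x. x \<in> space M \<Longrightarrow> \<bar>s\<bar> < 1 \<Longrightarrow> norm (F' s x) \<le> B x"
    and B: "integrable M B"
    and meas: "F' 0 \<in> borel_measurable M"
  shows "((\<lambda>s. \<integral>x. F s x \<partial>M) has_vector_derivative (\<integral>x. F' 0 x \<partial>M)) (at 0)"
proof -
  have F'int: "integrable M (F' 0)"
    by (rule integrable_dominated[OF B meas bd]) auto
  define R where "R h x = (F h x - F 0 x - h *\<^sub>R F' 0 x) /\<^sub>R h" for h x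
  have R_le: "norm (R h x) \<le> 2 * B x" if x: "x \<in> space M" and h: "\<bar>h\<bar> < 1" "h \<noteq> 0" for h x
  proof -
    have "norm (F h x - F 0 x) \<le> B x * norm (h - 0)"
    proof (rule differentiable_bound[where S = "{-\<bar>h\<bar>..\<bar>h\<bar>}" and f = "\<lambda>s. F s x" and f' = "\<lambda>s y. y *\<^sub>R F' s x"])
      fix s assume s: "s \<in> {-\<bar>h\<bar>..\<bar>h\<bar>}"
      then have s1: "\<bar>s\<bar> < 1" using h by auto
      show "((\<lambda>s. F s x) has_derivative (\<lambda>y. y *\<^sub>R F' s x)) (at s within {-\<bar>h\<bar>..\<bar>h\<bar>})"
        using der[OF x s1] unfolding has_vector_derivative_def by (rule has_derivative_at_withinI)
      show "onorm (\<lambda>y. y *\<^sub>R F' s x) \<le> B x"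
        using mult_right_mono[OF bd[OF x s1] abs_ge_zero] by (intro onorm_le) (simp add: mult.commute)
    qed auto
    moreover have "norm (h *\<^sub>R F' 0 x) \<le> B x * \<bar>h\<bar>"
      using mult_right_mono[OF bd[OF x, of 0] abs_ge_zero] by (simp add: mult.commute)
    ultimately have "norm (F h x - F 0 x - h *\<^sub>R F' 0 x) \<le> 2 * B x * \<bar>h\<bar>"
      using norm_triangle_ineq4[of "F h x - F 0 x" "h *\<^sub>R F' 0 x"] by simp
    then show ?thesis using h by (simp add: R_def divide_inverse_commute[symmetric] divide_le_eq)
  qed
  have "((\<lambda>h. \<integral>x. R h x \<partial>M) \<longlongrightarrow> 0) (at 0)"
  proof (rule tendsto_at_iff_sequentially[THEN iffD2], intro allI impI)
    fix X :: "nat \<Rightarrow> real" assume X0: "\<forall>i. X i \<in> UNIV - {0}" and X: "X \<longlonglongrightarrow> 0"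
    have "eventually (\<lambda>i. \<bar>X i\<bar> < 1) sequentially"
      using X by (auto simp: tendsto_iff dist_real_def)
    \<comment> \<open>Dominated convergence asks for the bound at every index, so the sequence is
      shifted past the point where its terms drop below 1.\<close>
    then obtain N where N: "\<And>i. i \<ge> N \<Longrightarrow> \<bar>X i\<bar> < 1" by (auto simp: eventually_sequentially)
    have "(\<lambda>i. \<integral>x. R (X (i + N)) x \<partial>M) \<longlonglongrightarrow> (\<integral>x. 0 \<partial>M)"
    proof (rule integral_dominated_convergence[where w = "\<lambda>x. 2 * B x"])
      show "AE x in M. norm (R (X (i + N)) x) \<le> 2 * B x" for i
        using N[of "i + N"] X0 by (intro AE_I2 R_le) auto
      show "AE x in M. (\<lambda>i. R (X (i + N)) x) \<longlonglongrightarrow> 0"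
      proof (rule AE_I2)
        fix x assume "x \<in> space M"
        then have "((\<lambda>h. norm (F h x - F 0 x - h *\<^sub>R F' 0 x) / norm h) \<longlongrightarrow> 0) (at 0)"
          using der[of x 0] by (simp add: has_vector_derivative_def has_derivative_at)
        then have "((\<lambda>h. R h x) \<longlongrightarrow> 0) (at 0)"
          by (subst tendsto_norm_zero_iff[symmetric]) (simp add: R_def divide_inverse_commute)
        moreover have "filterlim (\<lambda>i. X (i + N)) (at 0) sequentially"
          using X X0 by (auto simp: filterlim_at intro: LIMSEQ_ignore_initial_segment)
        ultimately show "(\<lambda>i. R (X (i + N)) x) \<longlonglongrightarrow> 0" by (rule filterlim_compose)
      qed
      show "R (X (i + N)) \<in> borel_measurable M" for i
        unfolding R_def using int[of "X (i + N)"] int[of 0] N[of "i + N"] meas by measurable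
    qed (use B in auto)
    then show "((\<lambda>h. \<integral>x. R h x \<partial>M) \<circ> X) \<longlonglongrightarrow> 0"
      unfolding o_def by (simp only: integral_zero) (rule LIMSEQ_offset)
  qed
  then have "((\<lambda>h. norm (\<integral>x. R h x \<partial>M)) \<longlongrightarrow> 0) (at 0)"
    by (rule tendsto_norm_zero)
  moreover have "eventually (\<lambda>h. norm (\<integral>x. R h x \<partial>M) =
      norm ((\<integral>x. F h x \<partial>M) - (\<integral>x. F 0 x \<partial>M) - h *\<^sub>R (\<integral>x. F' 0 x \<partial>M)) / norm h) (at (0::real))"
  proof (rule eventually_at[THEN iffD2], intro exI[of _ 1] conjI ballI impI)
    fix h :: real assume "h \<noteq> 0 \<and> dist h 0 < 1"
    then have "(\<integral>x. R h x \<partial>M) = ((\<integral>x. F h x \<partial>M) - (\<integral>x. F 0 x \<partial>M) - h *\<^sub>R (\<integral>x. F' 0 x \<partial>M)) /\<^sub>R h"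
      unfolding R_def using int[of h] int[of 0] F'int by simp
    then show "norm (\<integral>x. R h x \<partial>M) =
        norm ((\<integral>x. F h x \<partial>M) - (\<integral>x. F 0 x \<partial>M) - h *\<^sub>R (\<integral>x. F' 0 x \<partial>M)) / norm h"
      by (simp add: divide_inverse_commute)
  qed simp
  ultimately show ?thesis
    unfolding has_vector_derivative_def has_derivative_at
    by (auto intro: bounded_linear_scaleR_left Lim_transform_eventually)
qed

subsection \<open>Gaussian integrals\<close>

lemma borel_measurable_cis [measurable]:
  "f \<in> borel_measurable M \<Longrightarrow> (\<lambda>x. cis (f x)) \<in> borel_measurable M"
  by (rule borel_measurable_continuous_on[where f = cis]) (intro continuous_intros)

lemma integrable_abs_power_gaussian:
  assumes "0 < a"
  shows "integrable lborel (\<lambda>x::real. \<bar>x\<bar> ^ k * exp (- a * x\<^sup>2))"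
proof -
  \<comment> \<open>With this scaling the exponent \<open>- (c * x)\<^sup>2 / 2\<close> of the
    standard normal density becomes \<open>- a * x\<^sup>2\<close>.\<close>
  define c where "c = sqrt (2 * a)"
  have c: "c > 0" "c\<^sup>2 = 2 * a" using assms by (auto simp: c_def)
  have "integrable lborel (\<lambda>x. std_normal_density (0 + c * x) * \<bar>0 + c * x\<bar> ^ k)"
    using c by (intro lborel_integrable_real_affine integrable_std_normal_moment_abs) auto
  then have "integrable lborel (\<lambda>x. (sqrt (2 * pi) / c ^ k) * (std_normal_density (0 + c * x) * \<bar>0 + c * x\<bar> ^ k))"
    by (rule integrable_mult_right)
  also have "(\<lambda>x. (sqrt (2 * pi) / c ^ k) * (std_normal_density (0 + c * x) * \<bar>0 + c * x\<bar> ^ k))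
      = (\<lambda>x. \<bar>x\<bar> ^ k * exp (- a * x\<^sup>2))"
    using c by (auto simp: fun_eq_iff std_normal_density_def power_mult_distrib abs_mult)
  finally show ?thesis .
qed

lemma integrable_gaussian: "0 < a \<Longrightarrow> integrable lborel (\<lambda>x::real. exp (- a * x\<^sup>2))"
  using integrable_abs_power_gaussian[of a 0] by simp

text \<open>The characteristic function of the standard normal law, rescaled by
  \<open>sqrt (2 * a)\<close>.\<close>

lemma gaussian_fourier:
  fixes a k :: real
  assumes "0 < a"
  shows "(LBINT x. cis (k * x) * of_real (exp (- a * x\<^sup>2))) = of_real (sqrt (pi / a) * exp (- k\<^sup>2 / (4 * a)))"
proof -
  define c where "c = sqrt (2 * a)"
  have c: "c > 0" "c\<^sup>2 = 2 * a" using assms by (auto simp: c_def)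
  have "of_real (exp (- (k / c)\<^sup>2 / 2)) = char std_normal_distribution (k / c)"
    by (simp add: char_std_normal_distribution)
  also have "\<dots> = (LBINT x. std_normal_density x *\<^sub>R iexp (k / c * x))"
    unfolding char_def
    by (subst integral_density) auto
  also have "\<dots> = \<bar>c\<bar> *\<^sub>R (LBINT x. std_normal_density (0 + c * x) *\<^sub>R iexp (k / c * (0 + c * x)))"
    using c by (intro lborel_integral_real_affine) auto
  also have "(\<lambda>x. std_normal_density (0 + c * x) *\<^sub>R iexp (k / c * (0 + c * x)))
     = (\<lambda>x. of_real (1 / sqrt (2 * pi)) * (cis (k * x) * of_real (exp (- a * x\<^sup>2))))"
    using c by (auto simp: fun_eq_iff std_normal_density_def scaleR_conv_of_real power_mult_distrib cis_conv_exp mult_ac)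
  finally have *: "of_real (exp (- (k / c)\<^sup>2 / 2)) =
      of_real (c / sqrt (2 * pi)) * (LBINT x. cis (k * x) * of_real (exp (- a * x\<^sup>2)))"
    using c by (simp add: scaleR_conv_of_real)
  have "sqrt (pi / a) * (c / sqrt (2 * pi)) = 1"
    using c assms by (simp add: c_def real_sqrt_divide real_sqrt_mult)
  then have "(LBINT x. cis (k * x) * of_real (exp (- a * x\<^sup>2)))
     = of_real (sqrt (pi / a)) * (of_real (c / sqrt (2 * pi)) * (LBINT x. cis (k * x) * of_real (exp (- a * x\<^sup>2))))"
    by (metis (no_types, lifting) mult.assoc mult_1 of_real_1 of_real_mult)
  also have "\<dots> = of_real (sqrt (pi / a) * exp (- (k / c)\<^sup>2 / 2))"
    unfolding *[symmetric] by simp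
  also have "- (k / c)\<^sup>2 / 2 = - k\<^sup>2 / (4 * a)"
    using c by (simp add: power_divide)
  finally show ?thesis .
qed

text \<open>Completing the square is done for the real part of \<open>c\<close> only, as a
  translation along the real line. The imaginary part stays behind as a frequency for
  \<open>gaussian_fourier\<close>, so no contour has to be moved.\<close>

lemma integral_complex_gaussian:
  fixes a :: real and c :: complex
  assumes "0 < a"
  shows "(LBINT v. exp (c * of_real v - of_real (a * v\<^sup>2)))
       = of_real (sqrt (pi / a)) * exp (c\<^sup>2 / of_real (4 * a))"
proof -
  define p q where "p = Re c" and "q = Im c"
  have c: "c = of_real p + \<i> * of_real q" by (simp add: p_def q_def complex_eq_iff)
  have shift: "exp (c * of_real (p / (2 * a) + 1 * v) - of_real (a * (p / (2 * a) + 1 * v)\<^sup>2))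
     = exp (of_real (p\<^sup>2 / (4 * a)) + \<i> * of_real (q * p / (2 * a))) * (cis (q * v) * of_real (exp (- a * v\<^sup>2)))" for v
  proof -
    have "c * of_real (p / (2 * a) + 1 * v) - of_real (a * (p / (2 * a) + 1 * v)\<^sup>2)
      = (of_real (p\<^sup>2 / (4 * a)) + \<i> * of_real (q * p / (2 * a))) + (\<i> * of_real (q * v) + of_real (- a * v\<^sup>2))"
      unfolding c using assms by (simp add: complex_eq_iff field_simps power2_eq_square)
    then show ?thesis by (simp only: exp_add cis_conv_exp exp_of_real mult.assoc)
  qed
  have "(LBINT v. exp (c * of_real v - of_real (a * v\<^sup>2)))
    = (LBINT v. exp (c * of_real (p / (2 * a) + 1 * v) - of_real (a * (p / (2 * a) + 1 * v)\<^sup>2)))"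
    by (subst lborel_integral_real_affine[where c = 1 and t = "p / (2 * a)"]) auto
  also have "\<dots> = exp (of_real (p\<^sup>2 / (4 * a)) + \<i> * of_real (q * p / (2 * a))) *
     of_real (sqrt (pi / a) * exp (- q\<^sup>2 / (4 * a)))"
    unfolding shift using gaussian_fourier[OF assms, of q] by simp
  also have "\<dots> = of_real (sqrt (pi / a)) * exp (of_real (p\<^sup>2 / (4 * a)) + \<i> * of_real (q * p / (2 * a)) + of_real (- q\<^sup>2 / (4 * a)))"
    by (simp only: exp_add exp_of_real[symmetric] of_real_mult mult_ac)
  also have "of_real (p\<^sup>2 / (4 * a)) + \<i> * of_real (q * p / (2 * a)) + of_real (- q\<^sup>2 / (4 * a)) = c\<^sup>2 / of_real (4 * a)"
    unfolding c using assms by (simp add: complex_eq_iff field_simps power2_eq_square)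
  finally show ?thesis .
qed

text \<open>Differentiating \<open>gaussian_fourier\<close> in \<open>k\<close> brings down the
  factor \<open>\<i> * x\<close>.\<close>

lemma gaussian_fourier_first_moment:
  fixes a k :: real
  assumes "0 < a"
  shows "(LBINT x. of_real x * (cis (k * x) * of_real (exp (- a * x\<^sup>2))))
    = \<i> * of_real (k / (2 * a) * sqrt (pi / a) * exp (- k\<^sup>2 / (4 * a)))"
proof -
  let ?F = "\<lambda>s x. cis ((k + s) * x) * complex_of_real (exp (- a * x\<^sup>2))"
  let ?F' = "\<lambda>s x. \<i> * of_real x * (cis ((k + s) * x) * complex_of_real (exp (- a * x\<^sup>2)))"
  have "((\<lambda>s. LBINT x. ?F s x) has_vector_derivative (LBINT x. ?F' 0 x)) (at 0)"
  proof (rule has_vector_derivative_lebesgue_integral[where B = "\<lambda>x. \<bar>x\<bar> ^ 1 * exp (- a * x\<^sup>2)"])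
    show "integrable lborel (?F s)" for s
      by (rule integrable_dominated[OF integrable_gaussian[OF assms]])
        (auto simp: norm_mult)
    show "((\<lambda>s. ?F s x) has_vector_derivative ?F' s x) (at s)" for s x
      unfolding cis_conv_exp
      by (auto intro!: derivative_eq_intros has_vector_derivative_real_field simp: algebra_simps)
    show "integrable lborel (\<lambda>x. \<bar>x\<bar> ^ 1 * exp (- a * x\<^sup>2))"
      by (rule integrable_abs_power_gaussian[OF assms])
  qed (auto simp: norm_mult)
  moreover have "(\<lambda>s. LBINT x. ?F s x) = (\<lambda>s. of_real (sqrt (pi / a) * exp (- (k + s)\<^sup>2 / (4 * a))))"
    using gaussian_fourier[OF assms] by (intro ext) simp
  moreover have "((\<lambda>s. complex_of_real (sqrt (pi / a) * exp (- (k + s)\<^sup>2 / (4 * a)))) has_vector_derivative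
      of_real (- (k / (2 * a)) * sqrt (pi / a) * exp (- k\<^sup>2 / (4 * a)))) (at 0)"
    by (intro has_vector_derivative_of_real has_real_derivative_iff_has_vector_derivative[THEN iffD1])
      (use assms in \<open>auto intro!: derivative_eq_intros simp: field_simps\<close>)
  ultimately have "(LBINT x. ?F' 0 x) = of_real (- (k / (2 * a)) * sqrt (pi / a) * exp (- k\<^sup>2 / (4 * a)))"
    by (simp only:) (rule vector_derivative_unique_at)
  then have "\<i> * (LBINT x. of_real x * (cis (k * x) * of_real (exp (- a * x\<^sup>2)))) =
      of_real (- (k / (2 * a)) * sqrt (pi / a) * exp (- k\<^sup>2 / (4 * a)))"
    by (simp add: mult.assoc)
  then have "- \<i> * (\<i> * (LBINT x. of_real x * (cis (k * x) * of_real (exp (- a * x\<^sup>2))))) =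
      - \<i> * of_real (- (k / (2 * a)) * sqrt (pi / a) * exp (- k\<^sup>2 / (4 * a)))"
    by simp
  then show ?thesis by simp
qed

section \<open>Hermite polynomials as complex Gaussian moments\<close>

lemma integral_derivative_eq_0:
  fixes F f :: "real \<Rightarrow> 'a::euclidean_space"
  assumes "\<And>x. (F has_vector_derivative f x) (at x)" "\<And>x. isCont f x" "integrable lborel f"
    and "(F \<longlongrightarrow> 0) at_top" "(F \<longlongrightarrow> 0) at_bot"
  shows "(LBINT x. f x) = 0"
proof -
  have "(LBINT x=-\<infinity>..\<infinity>. f x) = 0 - 0"
    by (rule interval_integral_FTC_integrable[where F = F])
      (use assms in \<open>auto simp: ereal_tendsto_simps set_integrable_def\<close>)
  then show ?thesis
    by (simp add: interval_lebesgue_integral_def set_lebesgue_integral_def)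
qed

text \<open>One term of the exponential series gives \<open>v ^ m \<le> fact m * exp v\<close> for
  \<open>v = \<bar>x\<bar> + \<bar>u\<bar>\<close>; then
  \<open>\<bar>u\<bar> \<le> 1/2 + u\<^sup>2 / 2\<close> spends half of the Gaussian.\<close>

lemma norm_power_gaussian_le:
  "norm ((of_real x + \<i> * of_real u) ^ m * complex_of_real (exp (- u\<^sup>2)))
     \<le> fact m * exp (\<bar>x\<bar> + 1/2) * exp (- (1/2) * u\<^sup>2)"
proof -
  have "norm (of_real x + \<i> * complex_of_real u) \<le> \<bar>x\<bar> + \<bar>u\<bar>"
    by (rule order_trans[OF norm_triangle_ineq]) (simp add: norm_mult)
  then have "norm (of_real x + \<i> * complex_of_real u) ^ m \<le> (\<bar>x\<bar> + \<bar>u\<bar>) ^ m"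
    by (intro power_mono) auto
  also have "\<dots> \<le> fact m * exp (\<bar>x\<bar> + \<bar>u\<bar>)"
  proof -
    have "(\<lambda>n. (\<bar>x\<bar> + \<bar>u\<bar>) ^ n /\<^sub>R fact n) sums exp (\<bar>x\<bar> + \<bar>u\<bar>)" by (rule exp_converges)
    then have "(\<Sum>n\<in>{m}. (\<bar>x\<bar> + \<bar>u\<bar>) ^ n /\<^sub>R fact n) \<le> exp (\<bar>x\<bar> + \<bar>u\<bar>)"
      by (intro sum_le_suminf[THEN order_trans]) (auto simp: sums_iff)
    then show ?thesis by (simp add: field_simps)
  qed
  also have "exp (\<bar>x\<bar> + \<bar>u\<bar>) \<le> exp (\<bar>x\<bar> + 1/2 + u\<^sup>2 / 2)"
    using zero_le_power2[of "\<bar>u\<bar> - 1"] by (simp add: power2_eq_square algebra_simps abs_if split: if_splits)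
  finally have "norm (of_real x + \<i> * complex_of_real u) ^ m * exp (- u\<^sup>2) \<le>
     (fact m * exp (\<bar>x\<bar> + 1/2 + u\<^sup>2 / 2)) * exp (- u\<^sup>2)"
    by (intro mult_right_mono) auto
  also have "\<dots> = fact m * exp (\<bar>x\<bar> + 1/2) * exp (- (1/2) * u\<^sup>2)"
    by (simp add: exp_add[symmetric] exp_diff[symmetric] mult.assoc)
  finally show ?thesis by (simp add: norm_mult norm_power)
qed

lemma integrable_power_gaussian:
  "integrable lborel (\<lambda>u. (of_real x + \<i> * of_real u) ^ m * complex_of_real (exp (- u\<^sup>2)))"
proof -
  have "integrable lborel (\<lambda>u. fact m * exp (\<bar>x\<bar> + 1/2) * exp (- (1/2) * u\<^sup>2))"
    by (intro integrable_mult_right integrable_gaussian) auto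
  then show ?thesis
    by (rule Bochner_Integration.integrable_bound)
      (auto intro!: order_trans[OF norm_power_gaussian_le])
qed

text \<open>Integration by parts: with \<open>z = x + \<i> * u\<close>, the derivative of
  \<open>z ^ Suc k * exp (- u\<^sup>2)\<close> integrates to 0. Expressing the factor
  \<open>u\<close> through \<open>z\<close> leaves a recurrence that, after scaling by powers of 2,
  is that of the Hermite polynomials.\<close>

lemma power_gaussian_recurrence:
  fixes x :: real
  defines "I \<equiv> \<lambda>m. LBINT u. (of_real x + \<i> * of_real u) ^ m * complex_of_real (exp (- u\<^sup>2))"
  shows "I (Suc (Suc k)) = of_real x * I (Suc k) - of_real (real (Suc k) / 2) * I k"
proof -
  let ?z = "\<lambda>u. of_real x + \<i> * complex_of_real u"
  let ?e = "\<lambda>u. complex_of_real (exp (- u\<^sup>2))"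
  let ?f = "\<lambda>u. \<i> * of_real (real (Suc k)) * (?z u ^ k * ?e u) - 2 * of_real u * (?z u ^ Suc k * ?e u)"
  have eq: "?f u = \<i> * (of_real (real (Suc k)) * (?z u ^ k * ?e u) - 2 * of_real x * (?z u ^ Suc k * ?e u)
       + 2 * (?z u ^ Suc (Suc k) * ?e u))" for u
  proof -
    have "complex_of_real u = - \<i> * (?z u - of_real x)" by (simp add: algebra_simps)
    then have "2 * of_real u * (?z u ^ Suc k * ?e u) = - \<i> * (2 * (?z u ^ Suc (Suc k) * ?e u) - 2 * of_real x * (?z u ^ Suc k * ?e u))"
      by (simp only: power_Suc) (simp add: algebra_simps)
    then show ?thesis by (simp only:) (simp add: algebra_simps)
  qed
  have "(LBINT u. ?f u) = 0"
  proof (rule integral_derivative_eq_0[where F = "\<lambda>u. ?z u ^ Suc k * ?e u"])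
    show "((\<lambda>u. ?z u ^ Suc k * ?e u) has_vector_derivative ?f u) (at u)" for u
    proof -
      \<comment> \<open>Differentiated in a complex variable \<open>w\<close> and then restricted to
        the real line.\<close>
      have "((\<lambda>w. (of_real x + \<i> * w) ^ Suc k * exp (- w\<^sup>2)) has_field_derivative
         (of_nat (Suc k) * (of_real x + \<i> * w) ^ k * \<i>) * exp (- w\<^sup>2) +
         exp (- w\<^sup>2) * (- (2 * w)) * (of_real x + \<i> * w) ^ Suc k) (at w)" for w
      proof (rule DERIV_mult)
        have "((\<lambda>w. of_real x + \<i> * w) has_field_derivative \<i>) (at w)"
          by (auto intro!: derivative_eq_intros)
        from DERIV_power[OF this, of "Suc k"]
        show "((\<lambda>w. (of_real x + \<i> * w) ^ Suc k) has_field_derivative of_nat (Suc k) * (of_real x + \<i> * w) ^ k * \<i>) (at w)"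
          by (simp add: mult_ac)
        show "((\<lambda>w. exp (- w\<^sup>2)) has_field_derivative exp (- w\<^sup>2) * (- (2 * w))) (at w)"
          by (auto intro!: derivative_eq_intros)
      qed
      from has_vector_derivative_real_field[OF this, of u]
      show ?thesis
        unfolding exp_of_real[symmetric] by (simp add: mult_ac)
    qed
    show "isCont ?f u" for u by (intro continuous_intros)
    show "integrable lborel ?f"
      unfolding eq by (intro integrable_mult_right Bochner_Integration.integrable_add
        Bochner_Integration.integrable_diff integrable_power_gaussian)
    have *: "norm (?z u ^ Suc k * ?e u) \<le> fact (Suc k) * exp (\<bar>x\<bar> + 1/2) * exp (- (1/2) * u\<^sup>2)" for u
      by (rule norm_power_gaussian_le)
    have "((\<lambda>u. fact (Suc k) * exp (\<bar>x\<bar> + 1/2) * exp (- (1/2) * u\<^sup>2)) \<longlongrightarrow> 0) at_top"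
      by (intro tendsto_mult_right_zero) real_asymp
    then show "((\<lambda>u. ?z u ^ Suc k * ?e u) \<longlongrightarrow> 0) at_top"
      by (rule Lim_null_comparison[OF always_eventually, rotated]) (use * in blast)
    have "((\<lambda>u. fact (Suc k) * exp (\<bar>x\<bar> + 1/2) * exp (- (1/2) * u\<^sup>2)) \<longlongrightarrow> 0) at_bot"
      by (intro tendsto_mult_right_zero) real_asymp
    then show "((\<lambda>u. ?z u ^ Suc k * ?e u) \<longlongrightarrow> 0) at_bot"
      by (rule Lim_null_comparison[OF always_eventually, rotated]) (use * in blast)
  qed
  moreover have "(LBINT u. ?f u) = \<i> * (of_real (real (Suc k)) * I k - 2 * of_real x * I (Suc k) + 2 * I (Suc (Suc k)))"
    unfolding eq I_def
    by (simp only: integral_mult_right_zero Bochner_Integration.integral_add Bochner_Integration.integral_diff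
        integrable_mult_right Bochner_Integration.integrable_add Bochner_Integration.integrable_diff integrable_power_gaussian)
  ultimately have "of_real (real (Suc k)) * I k - 2 * of_real x * I (Suc k) + 2 * I (Suc (Suc k)) = 0" by simp
  then show ?thesis by (simp add: field_simps)
qed

text \<open>Both sides obey one recurrence with the same two initial values. The gain is that the
  degree becomes an exponent, so that the series over \<open>k\<close> in Mehler's formula turns
  into an exponential series.\<close>

lemma hermite_poly_integral:
  "complex_of_real (hermite_poly k x) =
     2 ^ k / of_real (sqrt pi) * (LBINT u. (of_real x + \<i> * of_real u) ^ k * complex_of_real (exp (- u\<^sup>2)))"
proof (induction k x rule: hermite_poly.induct)
  case (1 x)
  have "(LBINT u. complex_of_real (exp (- u\<^sup>2))) = of_real (sqrt pi)"
    using gaussian_fourier[of 1 0] by simp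
  then show ?case by simp
next
  case (2 x)
  have m: "(LBINT u. complex_of_real (exp (- u\<^sup>2))) = of_real (sqrt pi)"
    using gaussian_fourier[of 1 0] by simp
  have "(LBINT u. of_real x * complex_of_real (exp (- u\<^sup>2)) + \<i> * (of_real u * complex_of_real (exp (- u\<^sup>2))))
     = of_real x * of_real (sqrt pi) + \<i> * 0"
  proof (subst Bochner_Integration.integral_add)
    have i0: "integrable lborel (\<lambda>u. complex_of_real (exp (- u\<^sup>2)))"
      using integrable_gaussian[of 1] by simp
    then show "integrable lborel (\<lambda>u. complex_of_real x * complex_of_real (exp (- u\<^sup>2)))" by (rule integrable_mult_right)
    have "integrable lborel (\<lambda>u. complex_of_real (u * exp (- u\<^sup>2)))"
      unfolding complex_of_real_integrable_eq
      by (rule integrable_dominated[OF integrable_abs_power_gaussian[of 1 1]]) (auto simp: abs_mult)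
    then show "integrable lborel (\<lambda>u. \<i> * (complex_of_real u * complex_of_real (exp (- u\<^sup>2))))"
      by (intro integrable_mult_right) simp
    show "(LBINT u. complex_of_real x * complex_of_real (exp (- u\<^sup>2))) +
      (LBINT u. \<i> * (complex_of_real u * complex_of_real (exp (- u\<^sup>2)))) =
      complex_of_real x * of_real (sqrt pi) + \<i> * 0"
      using gaussian_fourier_first_moment[of 1 0] m by simp
  qed
  then show ?case by (simp add: algebra_simps)
next
  case (3 k x)
  define I where "I m = (LBINT u. (of_real x + \<i> * of_real u) ^ m * complex_of_real (exp (- u\<^sup>2)))" for m
  have r: "I (Suc (Suc k)) = of_real x * I (Suc k) - of_real (real (Suc k) / 2) * I k"
    unfolding I_def by (rule power_gaussian_recurrence)
  have "complex_of_real (hermite_poly (Suc (Suc k)) x) =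
     2 * of_real x * of_real (hermite_poly (Suc k) x) - 2 * of_real (real (Suc k)) * of_real (hermite_poly k x)"
    by simp
  also have "\<dots> = 2 * of_real x * (2 ^ Suc k / of_real (sqrt pi) * I (Suc k)) - 2 * of_real (real (Suc k)) * (2 ^ k / of_real (sqrt pi) * I k)"
    unfolding I_def 3 ..
  also have "\<dots> = 2 ^ Suc (Suc k) / of_real (sqrt pi) * I (Suc (Suc k))"
    proof -
    define c :: complex where "c = 2 ^ k / of_real (sqrt pi)"
    have c: "2 ^ Suc k / of_real (sqrt pi) = 2 * c" "2 ^ Suc (Suc k) / of_real (sqrt pi) = 4 * c" "2 ^ k / of_real (sqrt pi) = c"
      by (simp_all add: c_def)
    show ?thesis unfolding r c by (simp add: algebra_simps)
  qed
  finally show ?case unfolding I_def .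
qed

subsection \<open>Mehler's formula\<close>

lemma
  fixes f :: "'a \<Rightarrow> 'c::{real_normed_field,banach,second_countable_topology}" and g :: "'b \<Rightarrow> 'c"
  assumes "pair_sigma_finite M N" and f: "integrable M f" and g: "integrable N g"
  shows integrable_pair_mult: "integrable (M \<Otimes>\<^sub>M N) (\<lambda>z. f (fst z) * g (snd z))" (is ?int)
    and integral_pair_mult: "(LINT z|(M \<Otimes>\<^sub>M N). f (fst z) * g (snd z)) = (LINT x|M. f x) * (LINT y|N. g y)" (is ?eq)
proof -
  interpret pair_sigma_finite M N by fact
  have [measurable]: "f \<in> borel_measurable M" "g \<in> borel_measurable N" using f g by auto
  show i: ?int
  proof (rule Fubini_integrable)
    show "integrable M (\<lambda>x. LINT y|N. norm (f (fst (x, y)) * g (snd (x, y))))"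
      using f by (simp add: norm_mult)
    show "AE x in M. integrable N (\<lambda>y. f (fst (x, y)) * g (snd (x, y)))"
      using g by simp
  qed measurable
  show ?eq
    by (subst integral_fst'[OF i, symmetric]) simp
qed

lemma integrable_pair_dominated:
  fixes W :: "'a::euclidean_space \<Rightarrow> 'b::euclidean_space \<Rightarrow> 'c::{banach,second_countable_topology}"
    and f g :: "_ \<Rightarrow> real"
  assumes "integrable lborel f" "integrable lborel g" "case_prod W \<in> borel_measurable (lborel \<Otimes>\<^sub>M lborel)"
    and "\<And>x y. norm (W x y) \<le> f x * g y"
  shows "integrable (lborel \<Otimes>\<^sub>M lborel) (case_prod W)"
  by (rule integrable_dominated[OF integrable_pair_mult[OF _ assms(1,2)] assms(3)])
    (auto simp: assms(4) intro: lborel_pair.pair_sigma_finite_axioms)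

lemma pair_sigma_finite_lborel: "pair_sigma_finite (lborel :: 'a::euclidean_space measure) (lborel :: 'b::euclidean_space measure)"
  by unfold_locales

context
  fixes w :: real
  assumes w: "0 < w" "w < 1"
begin

text \<open>The double integral is two successive Gaussian integrals: for fixed \<open>u\<close> the
  exponent in \<open>v\<close> has quadratic coefficient 1 and a complex linear coefficient, and its
  value is again a Gaussian in \<open>u\<close>.\<close>

lemma mehler_kernel_integral:
  fixes x y :: real
  defines "G \<equiv> \<lambda>z. exp (2 * of_real w * ((of_real x + \<i> * of_real (fst z)) * (of_real y + \<i> * of_real (snd z))))
     * complex_of_real (exp (- (fst z)\<^sup>2)) * complex_of_real (exp (- (snd z)\<^sup>2))"
  assumes int: "integrable (lborel \<Otimes>\<^sub>M lborel) G"
  shows "(LINT z|(lborel \<Otimes>\<^sub>M lborel). G z) =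
     of_real (pi / sqrt (1 - w\<^sup>2) * exp ((2 * w * x * y - w\<^sup>2 * (x\<^sup>2 + y\<^sup>2)) / (1 - w\<^sup>2)))"
proof -
  interpret pair_sigma_finite "lborel :: real measure" "lborel :: real measure" by (rule pair_sigma_finite_lborel)
  have w1: "1 - w\<^sup>2 > 0" using w by (simp add: power_less_one_iff)
  \<comment> \<open>The linear coefficient in \<open>u\<close> after \<open>v\<close> has been
    integrated out; the quadratic coefficient has meanwhile dropped from 1 to
    \<open>1 - w\<^sup>2\<close>.\<close>
  define c where "c = 2 * \<i> * of_real (w * y - w\<^sup>2 * x)"
  have inner: "(LBINT v. G (u, v)) =
      of_real (sqrt pi * exp (2 * w * x * y - w\<^sup>2 * x\<^sup>2)) * exp (c * of_real u - of_real ((1 - w\<^sup>2) * u\<^sup>2))" for u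
  proof -
    let ?z = "of_real x + \<i> * complex_of_real u"
    let ?C = "exp (2 * of_real (w * y) * ?z - of_real (u\<^sup>2))"
    have "G (u, v) = ?C * exp ((2 * \<i> * of_real w * ?z) * of_real v - of_real (1 * v\<^sup>2))" for v
      unfolding G_def exp_of_real[symmetric] exp_add[symmetric] fst_conv snd_conv
      by (simp add: algebra_simps)
    then have "(LBINT v. G (u, v)) =
        ?C * (of_real (sqrt (pi / 1)) * exp ((2 * \<i> * of_real w * ?z)\<^sup>2 / of_real (4 * 1)))"
      by (simp only: integral_mult_right_zero integral_complex_gaussian[OF zero_less_one])
    also have "\<dots> = of_real (sqrt pi) * exp (2 * of_real (w * y) * ?z - of_real (u\<^sup>2) + (2 * \<i> * of_real w * ?z)\<^sup>2 / 4)"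
      by (simp add: exp_add)
    also have "2 * of_real (w * y) * ?z - of_real (u\<^sup>2) + (2 * \<i> * of_real w * ?z)\<^sup>2 / 4
        = of_real (2 * w * x * y - w\<^sup>2 * x\<^sup>2) + (c * of_real u - of_real ((1 - w\<^sup>2) * u\<^sup>2))"
      unfolding c_def by (simp add: complex_eq_iff power2_eq_square) (simp add: algebra_simps)
    finally show ?thesis by (simp only: exp_add exp_of_real of_real_mult mult.assoc)
  qed
  have "(LINT z|(lborel \<Otimes>\<^sub>M lborel). G z) = (LBINT u. LBINT v. G (u, v))"
    by (rule lborel_pair.integral_fst'[OF int, symmetric])
  also have "\<dots> = of_real (sqrt pi * exp (2 * w * x * y - w\<^sup>2 * x\<^sup>2)) *
      (of_real (sqrt (pi / (1 - w\<^sup>2))) * exp (c\<^sup>2 / of_real (4 * (1 - w\<^sup>2))))"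
    unfolding inner by (simp only: integral_mult_right_zero integral_complex_gaussian[OF w1])
  also have "c\<^sup>2 / of_real (4 * (1 - w\<^sup>2)) = of_real (- (w * y - w\<^sup>2 * x)\<^sup>2 / (1 - w\<^sup>2))"
  proof -
    have "c\<^sup>2 = of_real (4 * (- (w * y - w\<^sup>2 * x)\<^sup>2))"
      unfolding c_def by (simp add: power_mult_distrib)
    then show ?thesis
      by (simp only: of_real_divide[symmetric]) (subst mult_divide_mult_cancel_left; simp)
  qed
  also have "of_real (sqrt pi * exp (2 * w * x * y - w\<^sup>2 * x\<^sup>2)) *
      (of_real (sqrt (pi / (1 - w\<^sup>2))) * exp (complex_of_real (- (w * y - w\<^sup>2 * x)\<^sup>2 / (1 - w\<^sup>2))))
    = of_real ((sqrt pi * sqrt pi) / sqrt (1 - w\<^sup>2) * exp (2 * w * x * y - w\<^sup>2 * x\<^sup>2 + (- (w * y - w\<^sup>2 * x)\<^sup>2 / (1 - w\<^sup>2))))"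
    by (simp only: exp_of_real of_real_mult[symmetric] exp_add real_sqrt_divide) (rule arg_cong[where f = of_real], simp)
  also have "2 * w * x * y - w\<^sup>2 * x\<^sup>2 + (- (w * y - w\<^sup>2 * x)\<^sup>2 / (1 - w\<^sup>2))
     = (2 * w * x * y - w\<^sup>2 * (x\<^sup>2 + y\<^sup>2)) / (1 - w\<^sup>2)"
  proof -
    define d where "d = 1 - w\<^sup>2"
    have d: "d \<noteq> 0" using w1 by (simp add: d_def)
    have "2 * w * x * y - w\<^sup>2 * x\<^sup>2 + - (w * y - w\<^sup>2 * x)\<^sup>2 / d
      = ((2 * w * x * y - w\<^sup>2 * x\<^sup>2) * d - (w * y - w\<^sup>2 * x)\<^sup>2) / d"
      using d by (simp add: diff_divide_distrib)
    also have "(2 * w * x * y - w\<^sup>2 * x\<^sup>2) * d - (w * y - w\<^sup>2 * x)\<^sup>2 = 2 * w * x * y - w\<^sup>2 * (x\<^sup>2 + y\<^sup>2)"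
      unfolding d_def by (simp add: power2_eq_square algebra_simps)
    finally show ?thesis unfolding d_def .
  qed
  finally show ?thesis by simp
qed

text \<open>Inserting \<open>hermite_poly_integral\<close> for both factors makes the k-th term an
  integral of the k-th term of an exponential series. Series and integral are exchanged, and
  \<open>mehler_kernel_integral\<close> evaluates the result.\<close>

lemma sums_hermite_poly_mehler:
  "(\<lambda>k. (w / 2) ^ k / fact k * (hermite_poly k x * hermite_poly k y)) sums
     (1 / sqrt (1 - w\<^sup>2) * exp ((2 * w * x * y - w\<^sup>2 * (x\<^sup>2 + y\<^sup>2)) / (1 - w\<^sup>2)))"
proof -
  let ?M = "lborel \<Otimes>\<^sub>M lborel :: (real \<times> real) measure"
  let ?h = "\<lambda>k x u. (of_real x + \<i> * of_real u) ^ k * complex_of_real (exp (- u\<^sup>2))"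
  \<comment> \<open>The weight is \<open>(2 * w) ^ k\<close> because each of the two integral
    representations contributes a factor \<open>2 ^ k\<close> that has to be divided out.\<close>
  define T where "T k z = of_real ((2 * w) ^ k / fact k) * (?h k x (fst z) * ?h k y (snd z))" for k z
  define G where "G z = exp (2 * of_real w * ((of_real x + \<i> * of_real (fst z)) * (of_real y + \<i> * of_real (snd z))))
     * complex_of_real (exp (- (fst z)\<^sup>2)) * complex_of_real (exp (- (snd z)\<^sup>2))" for z
  \<comment> \<open>With p and q the moduli of the two complex factors,
    \<open>2 * (p * q) \<le> p\<^sup>2 + q\<^sup>2\<close> bounds the exponential by this product.
    It remains integrable because \<open>w < 1\<close> leaves the coefficient
    \<open>1 - w\<close>.\<close>
  define B where "B z = exp (w * (x\<^sup>2 + y\<^sup>2)) * (exp (- (1 - w) * (fst z)\<^sup>2) * exp (- (1 - w) * (snd z)\<^sup>2))" for z :: "real \<times> real"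
  have Tint: "integrable ?M (T k)" for k
    unfolding T_def
    by (intro integrable_mult_right integrable_pair_mult pair_sigma_finite_lborel integrable_power_gaussian)
  have Tval: "(LINT z|?M. T k z) = of_real (pi * ((w / 2) ^ k / fact k * (hermite_poly k x * hermite_poly k y)))" for k
  proof -
    have h: "(LBINT u. ?h k a u) = of_real (sqrt pi) / 2 ^ k * of_real (hermite_poly k a)" for a
      unfolding hermite_poly_integral by simp
    have "(LINT z|?M. T k z) = of_real ((2 * w) ^ k / fact k) * ((LBINT u. ?h k x u) * (LBINT u. ?h k y u))"
      unfolding T_def integral_mult_right_zero
      by (subst integral_pair_mult) (intro refl pair_sigma_finite_lborel integrable_power_gaussian)+
    also have "\<dots> = of_real ((2 * w) ^ k / fact k * ((sqrt pi * sqrt pi) / (2 ^ k * 2 ^ k) * (hermite_poly k x * hermite_poly k y)))"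
      unfolding h by (simp del: real_sqrt_mult_self)
    also have "(2 * w) ^ k / fact k * ((sqrt pi * sqrt pi) / (2 ^ k * 2 ^ k) * (hermite_poly k x * hermite_poly k y)) =
       pi * ((w / 2) ^ k / fact k * (hermite_poly k x * hermite_poly k y))"
      by (simp add: power_mult_distrib power_divide mult_ac)
    finally show ?thesis .
  qed
  have Bint: "integrable ?M B"
    unfolding B_def using w
    by (intro integrable_mult_right integrable_pair_mult pair_sigma_finite_lborel integrable_gaussian) auto
  have Tsums: "(\<lambda>k. T k z) sums G z" for z
  proof -
    let ?a = "2 * of_real w * ((of_real x + \<i> * of_real (fst z)) * (of_real y + \<i> * of_real (snd z)))"
    have "(\<lambda>k. ?a ^ k /\<^sub>R fact k * (complex_of_real (exp (- (fst z)\<^sup>2)) * complex_of_real (exp (- (snd z)\<^sup>2)))) sums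
      (exp ?a * (complex_of_real (exp (- (fst z)\<^sup>2)) * complex_of_real (exp (- (snd z)\<^sup>2))))"
      by (intro sums_mult2 exp_converges)
    then show ?thesis
      by (simp add: T_def G_def power_mult_distrib scaleR_conv_of_real mult_ac divide_inverse)
  qed
  have Tnorm: "summable (\<lambda>k. norm (T k z)) \<and> (\<Sum>k. norm (T k z)) \<le> B z" for z
  proof -
    let ?p = "norm (of_real x + \<i> * complex_of_real (fst z))" and ?q = "norm (of_real y + \<i> * complex_of_real (snd z))"
    let ?a = "2 * w * (?p * ?q)"
    have s: "(\<lambda>k. ?a ^ k /\<^sub>R fact k * (exp (- (fst z)\<^sup>2) * exp (- (snd z)\<^sup>2))) sums
      (exp ?a * (exp (- (fst z)\<^sup>2) * exp (- (snd z)\<^sup>2)))"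
      by (intro sums_mult2 exp_converges)
    have e: "(\<lambda>k. ?a ^ k /\<^sub>R fact k * (exp (- (fst z)\<^sup>2) * exp (- (snd z)\<^sup>2))) = (\<lambda>k. norm (T k z))"
      using w by (simp add: fun_eq_iff T_def norm_mult norm_power norm_divide norm_inverse power_mult_distrib divide_inverse mult_ac)
    have pq: "?p\<^sup>2 = x\<^sup>2 + (fst z)\<^sup>2" "?q\<^sup>2 = y\<^sup>2 + (snd z)\<^sup>2" by (simp_all add: cmod_power2)
    have "2 * (?p * ?q) \<le> ?p\<^sup>2 + ?q\<^sup>2" using sum_squares_bound[of ?p ?q] by (simp add: mult_ac)
    then have "w * (2 * (?p * ?q)) \<le> w * (x\<^sup>2 + (fst z)\<^sup>2 + (y\<^sup>2 + (snd z)\<^sup>2))"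
      using w unfolding pq by (intro mult_left_mono) auto
    then have "exp (?a + - (fst z)\<^sup>2 + - (snd z)\<^sup>2) \<le> exp (w * (x\<^sup>2 + y\<^sup>2) + (- (1 - w) * (fst z)\<^sup>2 + - (1 - w) * (snd z)\<^sup>2))"
      by (simp add: algebra_simps)
    then have "exp ?a * (exp (- (fst z)\<^sup>2) * exp (- (snd z)\<^sup>2)) \<le> B z"
      unfolding B_def by (simp only: exp_add mult.assoc)
    with s show ?thesis unfolding e by (auto simp: sums_iff)
  qed
  have Gint: "integrable ?M G"
  proof (rule integrable_dominated[OF Bint])
    have "(\<lambda>z. \<Sum>k. T k z) \<in> borel_measurable ?M"
      using Tint by (intro borel_measurable_suminf) auto
    then show "G \<in> borel_measurable ?M" using Tsums by (simp add: sums_iff)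
    show "norm (G z) \<le> B z" for z
    proof -
      have "norm (G z) \<le> (\<Sum>k. norm (T k z))"
        using Tsums[of z] summable_norm[OF conjunct1[OF Tnorm[of z]]] by (simp add: sums_iff)
      also have "\<dots> \<le> B z" using Tnorm by auto
      finally show ?thesis .
    qed
  qed
  \<comment> \<open>The partial sums of these integrals stay below the integral of \<open>B\<close>;
    this is the condition for exchanging series and integral.\<close>
  have "summable (\<lambda>k. LINT z|?M. norm (T k z))"
  proof (rule summableI_nonneg_bounded[where x = "LINT z|?M. B z"])
    fix n
    have "(\<Sum>k<n. LINT z|?M. norm (T k z)) = (LINT z|?M. (\<Sum>k<n. norm (T k z)))"
      using Tint by simp
    also have "\<dots> \<le> (LINT z|?M. B z)"
    proof (rule integral_mono[OF _ Bint])
      show "integrable ?M (\<lambda>z. \<Sum>k<n. norm (T k z))" using Tint by simp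
      show "(\<Sum>k<n. norm (T k z)) \<le> B z" for z
        using sum_le_suminf[of "\<lambda>k. norm (T k z)" "{..<n}"] Tnorm[of z] by auto
    qed
    finally show "(\<Sum>k<n. LINT z|?M. norm (T k z)) \<le> (LINT z|?M. B z)" .
  qed simp
  then have "(\<lambda>k. LINT z|?M. T k z) sums (LINT z|?M. (\<Sum>k. T k z))"
    using Tnorm Tint by (intro sums_integral) auto
  also have "(\<lambda>z. \<Sum>k. T k z) = G" using Tsums by (auto simp: sums_iff)
  finally have "(\<lambda>k. complex_of_real (pi * ((w / 2) ^ k / fact k * (hermite_poly k x * hermite_poly k y)))) sums
     of_real (pi / sqrt (1 - w\<^sup>2) * exp ((2 * w * x * y - w\<^sup>2 * (x\<^sup>2 + y\<^sup>2)) / (1 - w\<^sup>2)))"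
    unfolding Tval using mehler_kernel_integral[of x y] Gint unfolding G_def by simp
  then have "(\<lambda>k. pi * ((w / 2) ^ k / fact k * (hermite_poly k x * hermite_poly k y))) sums
     (pi / sqrt (1 - w\<^sup>2) * exp ((2 * w * x * y - w\<^sup>2 * (x\<^sup>2 + y\<^sup>2)) / (1 - w\<^sup>2)))"
    by (simp only: sums_of_real_iff)
  from sums_mult[OF this, of "1 / pi"] show ?thesis by simp
qed

text \<open>The normalisation of the Hermite functions turns \<open>(w / 2) ^ k / fact k\<close>
  into \<open>w ^ k\<close>. The exponent is arranged in \<open>x - y\<close> and
  \<open>x + y\<close> because the coefficients \<open>(1 + w) / (1 - w)\<close> and its inverse
  become a coth and a tanh for \<open>w = exp (- 2 * s * l)\<close>.\<close>

lemma sums_mehler: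
  "(\<lambda>k. w ^ k * (hermite_fun1 k x * hermite_fun1 k y)) sums
     (1 / sqrt (pi * (1 - w\<^sup>2)) * exp (- ((1 + w) / (1 - w) * (x - y)\<^sup>2 + (1 - w) / (1 + w) * (x + y)\<^sup>2) / 4))"
proof -
  have w1: "1 - w\<^sup>2 > 0" using w by (simp add: power_less_one_iff)
  have w2: "(1 + w) / (1 - w) = (1 + w)\<^sup>2 / (1 - w\<^sup>2)" "(1 - w) / (1 + w) = (1 - w)\<^sup>2 / (1 - w\<^sup>2)"
  proof -
    have "1 - w\<^sup>2 = (1 - w) * (1 + w)" by (simp add: power2_eq_square algebra_simps)
    then show "(1 + w) / (1 - w) = (1 + w)\<^sup>2 / (1 - w\<^sup>2)" "(1 - w) / (1 + w) = (1 - w)\<^sup>2 / (1 - w\<^sup>2)"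
      using w by (simp_all add: power2_eq_square)
  qed
  have t: "(w / 2) ^ k / fact k * (hermite_poly k x * hermite_poly k y) * (exp (- (x\<^sup>2 + y\<^sup>2) / 2) / sqrt pi)
     = w ^ k * (hermite_fun1 k x * hermite_fun1 k y)" for k
  proof -
    have "sqrt (2 ^ k * fact k * sqrt pi) * sqrt (2 ^ k * fact k * sqrt pi) = 2 ^ k * fact k * sqrt pi" by simp
    then have "hermite_fun1 k x * hermite_fun1 k y =
      hermite_poly k x * hermite_poly k y * (exp (- x\<^sup>2 / 2) * exp (- y\<^sup>2 / 2)) / (2 ^ k * fact k * sqrt pi)"
      unfolding hermite_fun1_def times_divide_times_eq by (simp add: mult_ac)
    also have "exp (- x\<^sup>2 / 2) * exp (- y\<^sup>2 / 2) = exp (- (x\<^sup>2 + y\<^sup>2) / 2)"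
      by (simp add: exp_add[symmetric] add_divide_distrib)
    finally show ?thesis by (simp add: power_divide)
  qed
  have e: "(2 * w * x * y - w\<^sup>2 * (x\<^sup>2 + y\<^sup>2)) / (1 - w\<^sup>2) + - (x\<^sup>2 + y\<^sup>2) / 2
     = - ((1 + w) / (1 - w) * (x - y)\<^sup>2 + (1 - w) / (1 + w) * (x + y)\<^sup>2) / 4"
  proof -
    define d where "d = 1 - w\<^sup>2"
    have d: "d \<noteq> 0" using w1 by (simp add: d_def)
    have "(2 * w * x * y - w\<^sup>2 * (x\<^sup>2 + y\<^sup>2)) / d + - (x\<^sup>2 + y\<^sup>2) / 2
       = (2 * w * x * y - w\<^sup>2 * (x\<^sup>2 + y\<^sup>2) - (x\<^sup>2 + y\<^sup>2) / 2 * d) / d"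
      using d by (simp add: diff_divide_distrib add_divide_distrib)
    also have "2 * w * x * y - w\<^sup>2 * (x\<^sup>2 + y\<^sup>2) - (x\<^sup>2 + y\<^sup>2) / 2 * d
      = - ((1 + w)\<^sup>2 * (x - y)\<^sup>2 + (1 - w)\<^sup>2 * (x + y)\<^sup>2) / 4"
      unfolding d_def by (simp add: power2_eq_square field_simps)
    also have "- ((1 + w)\<^sup>2 * (x - y)\<^sup>2 + (1 - w)\<^sup>2 * (x + y)\<^sup>2) / 4 / d =
      - ((1 + w)\<^sup>2 / d * (x - y)\<^sup>2 + (1 - w)\<^sup>2 / d * (x + y)\<^sup>2) / 4"
      using d by (simp add: field_simps)
    finally show ?thesis unfolding w2 d_def .
  qed
  have "(\<lambda>k. w ^ k * (hermite_fun1 k x * hermite_fun1 k y)) sums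
     (1 / sqrt (1 - w\<^sup>2) * exp ((2 * w * x * y - w\<^sup>2 * (x\<^sup>2 + y\<^sup>2)) / (1 - w\<^sup>2)) * (exp (- (x\<^sup>2 + y\<^sup>2) / 2) / sqrt pi))"
    unfolding t[symmetric] by (intro sums_mult2 sums_hermite_poly_mehler)
  also have "1 / sqrt (1 - w\<^sup>2) * exp ((2 * w * x * y - w\<^sup>2 * (x\<^sup>2 + y\<^sup>2)) / (1 - w\<^sup>2)) * (exp (- (x\<^sup>2 + y\<^sup>2) / 2) / sqrt pi)
    = 1 / sqrt (pi * (1 - w\<^sup>2)) * exp ((2 * w * x * y - w\<^sup>2 * (x\<^sup>2 + y\<^sup>2)) / (1 - w\<^sup>2) + - (x\<^sup>2 + y\<^sup>2) / 2)"
    unfolding exp_add by (simp add: real_sqrt_mult)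
  finally show ?thesis unfolding e .
qed

text \<open>The arithmetic-geometric mean inequality reduces to the diagonal, where all terms are
  nonnegative and \<open>sums_mehler\<close> gives the sum with an exponential of at most 1.\<close>

lemma mehler_abs_bound:
  "summable (\<lambda>k. \<bar>w ^ k * (hermite_fun1 k x * hermite_fun1 k y)\<bar>)"
  "(\<Sum>k. \<bar>w ^ k * (hermite_fun1 k x * hermite_fun1 k y)\<bar>) \<le> 1 / sqrt (pi * (1 - w\<^sup>2))"
proof -
  let ?C = "1 / sqrt (pi * (1 - w\<^sup>2))"
  have w1: "1 - w\<^sup>2 > 0" using w by (simp add: power_less_one_iff)
  have diag: "summable (\<lambda>k. w ^ k * (hermite_fun1 k x * hermite_fun1 k x))"
    "(\<Sum>k. w ^ k * (hermite_fun1 k x * hermite_fun1 k x)) \<le> ?C" for x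
  proof -
    have "?C * exp (- ((1 + w) / (1 - w) * (x - x)\<^sup>2 + (1 - w) / (1 + w) * (x + x)\<^sup>2) / 4) \<le> ?C"
      using w w1 by (intro mult_left_le) auto
    then show "summable (\<lambda>k. w ^ k * (hermite_fun1 k x * hermite_fun1 k x))"
       "(\<Sum>k. w ^ k * (hermite_fun1 k x * hermite_fun1 k x)) \<le> ?C"
      using sums_mehler[of x x] by (auto simp: sums_iff)
  qed
  define D where "D k = (w ^ k * (hermite_fun1 k x * hermite_fun1 k x) + w ^ k * (hermite_fun1 k y * hermite_fun1 k y)) / 2" for k
  have Ds: "summable D" unfolding D_def by (intro summable_divide summable_add diag)
  have "suminf D \<le> ?C"
    unfolding D_def using suminf_divide[OF summable_add[OF diag(1)[of x] diag(1)[of y]], of 2]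
      suminf_add[OF diag(1)[of x] diag(1)[of y]] diag(2)[of x] diag(2)[of y] by simp
  moreover have le: "\<bar>w ^ k * (hermite_fun1 k x * hermite_fun1 k y)\<bar> \<le> D k" for k
  proof -
    have "2 * (\<bar>hermite_fun1 k x\<bar> * \<bar>hermite_fun1 k y\<bar>) \<le> hermite_fun1 k x * hermite_fun1 k x + hermite_fun1 k y * hermite_fun1 k y"
      using sum_squares_bound[of "\<bar>hermite_fun1 k x\<bar>" "\<bar>hermite_fun1 k y\<bar>"] by (simp add: power2_eq_square mult_ac)
    then have "w ^ k * (2 * (\<bar>hermite_fun1 k x\<bar> * \<bar>hermite_fun1 k y\<bar>)) \<le> w ^ k * (hermite_fun1 k x * hermite_fun1 k x + hermite_fun1 k y * hermite_fun1 k y)"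
      using w by (intro mult_left_mono) auto
    then show ?thesis using w by (simp add: D_def abs_mult algebra_simps)
  qed
  ultimately show "summable (\<lambda>k. \<bar>w ^ k * (hermite_fun1 k x * hermite_fun1 k y)\<bar>)"
      "(\<Sum>k. \<bar>w ^ k * (hermite_fun1 k x * hermite_fun1 k y)\<bar>) \<le> ?C"
    using Ds by (auto intro!: summable_comparison_test'[OF Ds, of 0] order_trans[OF suminf_le[OF le]])
qed

end

subsection \<open>The Hermite semigroup as an integral operator\<close>

definition cothl :: "real \<Rightarrow> real \<Rightarrow> real" where
  "cothl lam s = lam * cosh (lam * s) / sinh (lam * s)"

definition tanhl :: "real \<Rightarrow> real \<Rightarrow> real" where
  "tanhl lam s = lam * sinh (lam * s) / cosh (lam * s)"

text \<open>The prefactor of the Mehler kernel per coordinate. At \<open>lam = 0\<close> it is 0,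
  whereas its limit there is \<open>1 / sqrt (4 * pi * s)\<close>.\<close>

definition mehler_factor :: "real \<Rightarrow> real \<Rightarrow> real" where
  "mehler_factor lam s = sqrt (lam / (2 * pi * sinh (2 * lam * s)))"

definition mehler1 :: "real \<Rightarrow> real \<Rightarrow> real \<Rightarrow> real \<Rightarrow> real" where
  "mehler1 lam s x y = mehler_factor lam s * exp (- (cothl lam s * (x - y)\<^sup>2 + tanhl lam s * (x + y)\<^sup>2) / 4)"

definition mehler :: "real \<Rightarrow> real \<Rightarrow> real^'n::finite \<Rightarrow> real^'n \<Rightarrow> real" where
  "mehler lam s \<xi> \<xi>' = (\<Prod>i\<in>UNIV. mehler1 lam s (\<xi> $ i) (\<xi>' $ i))"

lemma abs_lam_simps:
  "cothl \<bar>lam\<bar> s = cothl lam s" "tanhl \<bar>lam\<bar> s = tanhl lam s" "mehler_factor \<bar>lam\<bar> s = mehler_factor lam s"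
  by (auto simp: cothl_def tanhl_def mehler_factor_def abs_if)

text \<open>One coordinate of the spectral sum for \<open>exp (- s H(lam))\<close>. The bound on the
  absolute sum does not depend on \<open>x\<close> and \<open>y\<close>, which makes it usable as a
  majorant when sum and integral are exchanged.\<close>

lemma
  fixes lam s x y :: real
  defines "f \<equiv> \<lambda>k. sqrt \<bar>lam\<bar> * exp (- s * \<bar>lam\<bar>) * exp (- 2 * s * \<bar>lam\<bar>) ^ k *
           (hermite_fun1 k (sqrt \<bar>lam\<bar> * x) * hermite_fun1 k (sqrt \<bar>lam\<bar> * y))"
  assumes "lam \<noteq> 0" "s > 0"
  shows sums_mehler1: "f sums mehler1 lam s x y"
    and summable_abs_mehler1: "summable (\<lambda>k. \<bar>f k\<bar>)"
    and suminf_abs_mehler1: "(\<Sum>k. \<bar>f k\<bar>) \<le> mehler_factor lam s"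
proof -
  define l where "l = \<bar>lam\<bar>"
  have l: "l > 0" using assms by (simp add: l_def)
  \<comment> \<open>Neighbouring eigenvalues differ by \<open>2 * l\<close>, so this is the ratio of
    successive spectral weights; the ground state weight \<open>exp (- s * l)\<close> goes into
    \<open>A\<close>.\<close>
  define w where "w = exp (- 2 * s * l)"
  have w: "0 < w" "w < 1" using l assms by (simp_all add: w_def)
  have w1: "1 - w\<^sup>2 > 0" using w by (simp add: power_less_one_iff)
  define A where "A = sqrt l * exp (- s * l)"
  have A: "A > 0" using l by (simp add: A_def)
  have w_eq: "w = exp (- (l * s)) * exp (- (l * s))" by (simp add: w_def exp_add[symmetric] algebra_simps)
  have one: "exp (l * s) * exp (- (l * s)) = 1" by (simp add: exp_add[symmetric])
  have sh: "sinh (l * s) > 0" using l assms by simp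
  have c: "(1 + w) / (1 - w) * l = cothl l s"
  proof -
    have "1 + w = 2 * exp (- (l * s)) * cosh (l * s)" "1 - w = 2 * exp (- (l * s)) * sinh (l * s)"
      unfolding w_eq cosh_field_def sinh_field_def using one by (simp_all add: field_simps)
    then show ?thesis by (simp add: cothl_def)
  qed
  have t: "(1 - w) / (1 + w) * l = tanhl l s"
  proof -
    have "1 + w = 2 * exp (- (l * s)) * cosh (l * s)" "1 - w = 2 * exp (- (l * s)) * sinh (l * s)"
      unfolding w_eq cosh_field_def sinh_field_def using one by (simp_all add: field_simps)
    then show ?thesis by (simp add: tanhl_def)
  qed
  have m: "A * (1 / sqrt (pi * (1 - w\<^sup>2))) = mehler_factor l s"
  proof -
    have e: "A = sqrt (l * w)"
      unfolding A_def w_eq by (simp add: real_sqrt_mult real_sqrt_mult_self mult.commute)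
    have w2: "w = exp (- (2 * l * s))" by (simp add: w_def mult_ac)
    have one: "exp (2 * l * s) * w = 1" unfolding w2 by (simp add: exp_add[symmetric])
    have "1 - w\<^sup>2 = w * (2 * sinh (2 * l * s))"
      unfolding sinh_field_def w2[symmetric] using one by (simp add: power2_eq_square algebra_simps)
    then have "A * (1 / sqrt (pi * (1 - w\<^sup>2))) = sqrt ((l * w) / (pi * (w * (2 * sinh (2 * l * s)))))"
      unfolding e by (simp only: real_sqrt_divide) simp
    also have "(l * w) / (pi * (w * (2 * sinh (2 * l * s)))) = l / (2 * pi * sinh (2 * l * s))"
      using w by (simp add: field_simps)
    finally show ?thesis unfolding mehler_factor_def .
  qed
  let ?h = "\<lambda>k. hermite_fun1 k (sqrt l * x) * hermite_fun1 k (sqrt l * y)"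
  have f: "f k = A * (w ^ k * ?h k)" for k
    by (simp add: f_def A_def w_def l_def mult.assoc)
  have q: "(sqrt l * x - sqrt l * y)\<^sup>2 = l * (x - y)\<^sup>2" "(sqrt l * x + sqrt l * y)\<^sup>2 = l * (x + y)\<^sup>2"
    using l by (simp_all add: right_diff_distrib[symmetric] distrib_left[symmetric] power_mult_distrib)
  have "(\<lambda>k. A * (w ^ k * ?h k)) sums (A * (1 / sqrt (pi * (1 - w\<^sup>2)) * exp (- ((1 + w) / (1 - w) * (sqrt l * x - sqrt l * y)\<^sup>2
      + (1 - w) / (1 + w) * (sqrt l * x + sqrt l * y)\<^sup>2) / 4)))"
    by (intro sums_mult sums_mehler w)
  also have "(A * (1 / sqrt (pi * (1 - w\<^sup>2)) * exp (- ((1 + w) / (1 - w) * (sqrt l * x - sqrt l * y)\<^sup>2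
      + (1 - w) / (1 + w) * (sqrt l * x + sqrt l * y)\<^sup>2) / 4))) = mehler1 l s x y"
    unfolding mehler1_def q mult.assoc[symmetric] c t m[unfolded mult.assoc[symmetric]] ..
  also have "mehler1 l s x y = mehler1 lam s x y" by (simp add: mehler1_def l_def abs_lam_simps)
  finally have "(\<lambda>k. A * (w ^ k * ?h k)) sums mehler1 lam s x y" .
  then show "f sums mehler1 lam s x y" by (simp only: f[symmetric])
  have fa: "\<bar>f k\<bar> = A * \<bar>w ^ k * ?h k\<bar>" for k
    unfolding f using A by (simp add: abs_mult)
  show "summable (\<lambda>k. \<bar>f k\<bar>)" unfolding fa by (intro summable_mult mehler_abs_bound w)
  have "(\<Sum>k. \<bar>f k\<bar>) = A * (\<Sum>k. \<bar>w ^ k * ?h k\<bar>)"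
    unfolding fa by (intro suminf_mult mehler_abs_bound w)
  also have "\<dots> \<le> A * (1 / sqrt (pi * (1 - w\<^sup>2)))"
    using A by (intro mult_left_mono mehler_abs_bound w) auto
  finally show "(\<Sum>k. \<bar>f k\<bar>) \<le> mehler_factor lam s" unfolding m by (simp add: l_def abs_lam_simps)
qed

text \<open>Counting measure on multi-indices is the product of the counting measures on
  \<open>nat\<close>, so the distributive law for infinite sums is an instance of Fubini for finite
  products.\<close>

lemma
  fixes f :: "'n::finite \<Rightarrow> nat \<Rightarrow> real"
  assumes s: "\<And>i. summable (\<lambda>k. \<bar>f i k\<bar>)"
  shows integrable_count_space_prod: "integrable (count_space UNIV) (\<lambda>\<alpha>. \<Prod>i\<in>UNIV. f i (\<alpha> i))"
    and integral_count_space_prod: "(LINT \<alpha>|(count_space UNIV). (\<Prod>i\<in>UNIV. f i (\<alpha> i))) = (\<Prod>i\<in>UNIV. (\<Sum>k. f i k))"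
proof -
  interpret product_sigma_finite "\<lambda>_::'n. count_space (UNIV :: nat set)"
    by (intro product_sigma_finite.intro sigma_finite_measure_count_space_countable) auto
  have P: "count_space (UNIV :: ('n \<Rightarrow> nat) set) = PiM UNIV (\<lambda>_::'n. count_space (UNIV :: nat set))"
    using count_space_PiM_finite[of "UNIV :: 'n set" "\<lambda>_. UNIV :: nat set"] by (simp add: PiE_UNIV_domain)
  have i: "integrable (count_space UNIV) (f i)" for i
    using s by (simp add: integrable_count_space_nat_iff)
  show "integrable (count_space UNIV) (\<lambda>\<alpha>. \<Prod>i\<in>UNIV. f i (\<alpha> i))"
    unfolding P using i by (intro product_integrable_prod) auto
  show "(LINT \<alpha>|(count_space UNIV). (\<Prod>i\<in>UNIV. f i (\<alpha> i))) = (\<Prod>i\<in>UNIV. (\<Sum>k. f i k))"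
    unfolding P using i by (subst product_integral_prod) (auto simp: integral_count_space_nat)
qed

lemma borel_measurable_hermite_fun1 [measurable]: "hermite_fun1 k \<in> borel_measurable borel"
proof -
  obtain h' where "\<And>x. (hermite_fun1 k has_real_derivative h' x) (at x)"
    using hermite_fun1_deriv[of k] by blast
  then have "continuous_on UNIV (hermite_fun1 k)" by (rule DERIV_continuous_on)
  then show ?thesis by (rule borel_measurable_continuous_onI)
qed

lemma borel_measurable_hermite_fun [measurable]: "hermite_fun lam \<alpha> \<in> borel_measurable borel"
  unfolding hermite_fun_def by measurable

text \<open>Mehler's formula in \<open>n\<close> variables: the weight of a multi-index factors over
  the coordinates. Exchanging the spectral sum with the integral is justified by the majorant
  \<open>mehler_factor lam r ^ CARD('n)\<close> times the norm of \<open>g\<close>.\<close>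

lemma hermite_semigroup_eq:
  fixes g :: "real^'n::finite \<Rightarrow> complex"
  assumes lam: "lam \<noteq> 0" and r: "r > 0" and g: "integrable lborel g"
  shows "hermite_semigroup lam r g \<xi> = (LBINT \<xi>'. of_real (mehler lam r \<xi> \<xi>') * g \<xi>')"
proof -
  define c where "c \<alpha> \<xi>' = exp (- r * hermite_eigenvalue lam \<alpha>) * (hermite_fun lam \<alpha> \<xi> * hermite_fun lam \<alpha> \<xi>')"
    for \<alpha> :: "'n \<Rightarrow> nat" and \<xi>'
  define t where "t \<xi>' i k = sqrt \<bar>lam\<bar> * exp (- r * \<bar>lam\<bar>) * exp (- 2 * r * \<bar>lam\<bar>) ^ k *
       (hermite_fun1 k (sqrt \<bar>lam\<bar> * \<xi> $ i) * hermite_fun1 k (sqrt \<bar>lam\<bar> * \<xi>' $ i))" for \<xi>' :: "real^'n" and i k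
  have c_eq: "c \<alpha> \<xi>' = (\<Prod>i\<in>UNIV. t \<xi>' i (\<alpha> i))" for \<alpha> \<xi>'
  proof -
    have "\<bar>lam\<bar> powr (real CARD('n) / 4) * \<bar>lam\<bar> powr (real CARD('n) / 4) = sqrt \<bar>lam\<bar> ^ CARD('n)"
      using lam by (simp add: powr_add[symmetric] powr_half_sqrt[symmetric] powr_realpow[symmetric] powr_powr)
    moreover have "exp (- r * hermite_eigenvalue lam \<alpha>) = exp (- r * \<bar>lam\<bar>) ^ CARD('n) * (\<Prod>i\<in>UNIV. exp (- 2 * r * \<bar>lam\<bar>) ^ \<alpha> i)"
    proof -
      have "- r * hermite_eigenvalue lam \<alpha> = real CARD('n) * (- r * \<bar>lam\<bar>) + (\<Sum>i\<in>UNIV. real (\<alpha> i) * (- 2 * r * \<bar>lam\<bar>))"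
        unfolding sum_distrib_right[symmetric] by (simp add: hermite_eigenvalue_def algebra_simps)
      then show ?thesis by (simp only: exp_add exp_sum[OF finite] exp_of_nat_mult)
    qed
    ultimately show ?thesis
      unfolding c_def hermite_fun_def t_def prod.distrib prod_constant
      by (simp add: mult_ac)
  qed
  have s: "summable (\<lambda>k. \<bar>t \<xi>' i k\<bar>)" for \<xi>' i
    unfolding t_def by (rule summable_abs_mehler1[OF lam r])
  have ci: "integrable (count_space UNIV) (\<lambda>\<alpha>. c \<alpha> \<xi>')" for \<xi>'
    unfolding c_eq by (rule integrable_count_space_prod[OF s])
  have cI: "(LINT \<alpha>|(count_space UNIV). c \<alpha> \<xi>') = mehler lam r \<xi> \<xi>'" for \<xi>'
    unfolding c_eq integral_count_space_prod[OF s] mehler_def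
    unfolding t_def sums_unique[OF sums_mehler1[OF lam r], symmetric] ..
  have cB: "(LINT \<alpha>|(count_space UNIV). \<bar>c \<alpha> \<xi>'\<bar>) \<le> mehler_factor lam r ^ CARD('n)" for \<xi>'
  proof -
    have "(LINT \<alpha>|(count_space UNIV). \<bar>c \<alpha> \<xi>'\<bar>) = (\<Prod>i\<in>UNIV. (\<Sum>k. \<bar>t \<xi>' i k\<bar>))"
      unfolding c_eq abs_prod by (rule integral_count_space_prod) (simp add: s)
    also have "\<dots> \<le> (\<Prod>i\<in>(UNIV::'n set). mehler_factor lam r)"
    proof (rule prod_mono, intro conjI)
      show "0 \<le> (\<Sum>k. \<bar>t \<xi>' i k\<bar>)" for i by (intro suminf_nonneg s) simp
      show "(\<Sum>k. \<bar>t \<xi>' i k\<bar>) \<le> mehler_factor lam r" for i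
        unfolding t_def by (rule suminf_abs_mehler1[OF lam r])
    qed
    finally show ?thesis by simp
  qed
  interpret N: sigma_finite_measure "count_space (UNIV :: ('n \<Rightarrow> nat) set)"
    by (rule sigma_finite_measure_count_space_countable) auto
  interpret P: pair_sigma_finite "lborel :: (real^'n) measure" "count_space (UNIV :: ('n \<Rightarrow> nat) set)" ..
  define f where "f \<xi>' \<alpha> = of_real (c \<alpha> \<xi>') * g \<xi>'" for \<xi>' \<alpha>
  have [measurable]: "g \<in> borel_measurable borel" using g by auto
  have [measurable]: "c \<alpha> \<in> borel_measurable borel" for \<alpha> unfolding c_def by measurable
  have fint: "integrable (lborel \<Otimes>\<^sub>M count_space UNIV) (case_prod f)"
  proof (rule P.Fubini_integrable)
    \<comment> \<open>There are only countably many multi-indices, so measurability for each fixed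
      one suffices.\<close>
    show m: "case_prod f \<in> borel_measurable (lborel \<Otimes>\<^sub>M count_space UNIV)"
      unfolding f_def unfolding case_prod_beta
      by (rule measurable_compose_countable'[where f = "\<lambda>\<alpha> z. of_real (c \<alpha> (fst z)) * g (fst z)" and g = snd and I = UNIV])
        auto
    show "AE x in lborel. integrable (count_space UNIV) (\<lambda>y. case (x, y) of (x, y) \<Rightarrow> f x y)"
      unfolding f_def using ci by simp
    show "integrable lborel (\<lambda>x. LINT y|(count_space UNIV). norm (case (x, y) of (x, y) \<Rightarrow> f x y))"
    proof (rule Bochner_Integration.integrable_bound)
      show "integrable lborel (\<lambda>x. mehler_factor lam r ^ CARD('n) * norm (g x))"
        using g by auto
      show "(\<lambda>x. LINT y|(count_space UNIV). norm (case (x, y) of (x, y) \<Rightarrow> f x y)) \<in> borel_measurable lborel"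
        using m by measurable
      have "norm (LINT y|(count_space UNIV). norm (f x y)) \<le> norm (mehler_factor lam r ^ CARD('n) * norm (g x))" for x
      proof -
        have "norm (LINT y|(count_space UNIV). norm (f x y)) = (LINT y|(count_space UNIV). \<bar>c y x\<bar>) * norm (g x)"
          by (simp add: f_def norm_mult abs_mult)
        also have "\<dots> \<le> mehler_factor lam r ^ CARD('n) * norm (g x)" by (intro mult_right_mono cB) auto
        finally show ?thesis by simp
      qed
      then show "AE x in lborel. norm (LINT y|(count_space UNIV). norm (case (x, y) of (x, y) \<Rightarrow> f x y)) \<le> norm (mehler_factor lam r ^ CARD('n) * norm (g x))"
        by simp
    qed
  qed
  have term_eq: "of_real (exp (- r * hermite_eigenvalue lam \<alpha>))
        * (LBINT \<xi>'. g \<xi>' * of_real (hermite_fun lam \<alpha> \<xi>')) * of_real (hermite_fun lam \<alpha> \<xi>)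
      = ((LBINT \<xi>'. f \<xi>' \<alpha>))" for \<alpha>
  proof -
    have "((LBINT \<xi>'. f \<xi>' \<alpha>)) = (LBINT \<xi>'. of_real (exp (- r * hermite_eigenvalue lam \<alpha>) * hermite_fun lam \<alpha> \<xi>)
        * (g \<xi>' * of_real (hermite_fun lam \<alpha> \<xi>')))"
      by (simp add: f_def c_def mult_ac)
    then show ?thesis unfolding integral_mult_right_zero by simp
  qed
  have "hermite_semigroup lam r g \<xi> = (\<Sum>\<^sub>\<infinity>\<alpha>\<in>UNIV. (LBINT \<xi>'. f \<xi>' \<alpha>))"
    unfolding hermite_semigroup_def term_eq ..
  \<comment> \<open>The unordered sum is read as an integral against counting measure, by absolute
    summability, so that Fubini applies to it.\<close>
  also have "\<dots> = (LINT \<alpha>|(count_space UNIV). (LBINT \<xi>'. f \<xi>' \<alpha>))"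
  proof (subst infsetsum_infsum[symmetric])
    show "Infinite_Set_Sum.abs_summable_on (\<lambda>\<alpha>. (LBINT \<xi>'. f \<xi>' \<alpha>)) UNIV"
      unfolding Infinite_Set_Sum.abs_summable_on_def by (rule P.integrable_snd[OF fint])
  qed (simp add: infsetsum_def)
  also have "\<dots> = (LBINT \<xi>'. (LINT \<alpha>|(count_space UNIV). f \<xi>' \<alpha>))"
    by (rule P.Fubini_integral[OF fint])
  also have "\<dots> = (LBINT \<xi>'. of_real (mehler lam r \<xi> \<xi>') * g \<xi>')"
    unfolding f_def by (simp add: cI)
  finally show ?thesis .
qed

subsection \<open>Bounds for the Mehler kernel\<close>

lemma borel_measurable_sinh [measurable]:
  "f \<in> borel_measurable M \<Longrightarrow> (\<lambda>x. sinh (f x :: real)) \<in> borel_measurable M"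
  by (rule borel_measurable_continuous_on[where f = sinh]) (intro continuous_intros)

lemma borel_measurable_cosh [measurable]:
  "f \<in> borel_measurable M \<Longrightarrow> (\<lambda>x. cosh (f x :: real)) \<in> borel_measurable M"
  by (rule borel_measurable_continuous_on[where f = cosh]) (intro continuous_intros)

lemma borel_measurable_cothl [measurable]:
  assumes [measurable]: "f \<in> borel_measurable M" "g \<in> borel_measurable M"
  shows "(\<lambda>x. cothl (f x) (g x)) \<in> borel_measurable M"
  unfolding cothl_def by measurable

lemma borel_measurable_tanhl [measurable]:
  assumes [measurable]: "f \<in> borel_measurable M" "g \<in> borel_measurable M"
  shows "(\<lambda>x. tanhl (f x) (g x)) \<in> borel_measurable M"
  unfolding tanhl_def by measurable

lemma borel_measurable_mehler_factor [measurable]: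
  assumes [measurable]: "f \<in> borel_measurable M" "g \<in> borel_measurable M"
  shows "(\<lambda>x. mehler_factor (f x) (g x)) \<in> borel_measurable M"
  unfolding mehler_factor_def by measurable

lemma borel_measurable_vec_component [measurable]:
  "f \<in> borel_measurable M \<Longrightarrow> (\<lambda>x. (f x :: real^'n::finite) $ i) \<in> borel_measurable M"
  by (rule borel_measurable_continuous_on[where f = "\<lambda>x. x $ i"]) (intro continuous_intros)

lemma borel_measurable_mehler [measurable]:
  assumes [measurable]: "f \<in> borel_measurable M" "g \<in> borel_measurable M"
    "h \<in> borel_measurable M" "k \<in> borel_measurable M"
  shows "(\<lambda>x. mehler (f x) (g x) (h x) (k x :: real^'n::finite)) \<in> borel_measurable M"
  unfolding mehler_def mehler1_def by measurable

lemma sinh_ge: "0 \<le> x \<Longrightarrow> (x::real) \<le> sinh x"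
  using DERIV_nonneg_imp_nondecreasing[of 0 x "\<lambda>x. sinh x - x"]
  by (force intro!: derivative_eq_intros simp: cosh_real_ge_1)

lemma sinh_le_mult_cosh: "0 \<le> x \<Longrightarrow> sinh x \<le> (x::real) * cosh x"
proof -
  assume "0 \<le> x"
  then have "0 * cosh 0 - sinh 0 \<le> x * cosh x - sinh x"
    by (rule DERIV_nonneg_imp_nondecreasing) (auto intro!: derivative_eq_intros exI mult_nonneg_nonneg)
  then show ?thesis by simp
qed

text \<open>With \<open>x = \<bar>lam\<bar> * s\<close> this is
  \<open>1 \<le> x * coth x \<le> 1 + x\<close>. The left part is
  \<open>sinh x \<le> x * cosh x\<close>; the right part is
  \<open>x * exp (- x) \<le> sinh x\<close> with \<open>exp (- x) = cosh x - sinh x\<close>.\<close>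

lemma cothl_bounds:
  assumes "lam \<noteq> 0" "s > 0"
  shows "1 / s \<le> cothl lam s" "cothl lam s \<le> 1 / s + \<bar>lam\<bar>"
proof -
  define x where "x = \<bar>lam\<bar> * s"
  have x: "x > 0" using assms by (simp add: x_def)
  have sh: "sinh x > 0" using x by simp
  have c: "cothl lam s = x * cosh x / sinh x / s"
  proof -
    have "cothl lam s = \<bar>lam\<bar> * cosh x / sinh x"
      by (auto simp: cothl_def x_def abs_if)
    also have "\<dots> = x * cosh x / sinh x / s" using assms by (simp add: x_def)
    finally show ?thesis .
  qed
  have "1 \<le> x * cosh x / sinh x"
    using sinh_le_mult_cosh[of x] x sh by (simp add: le_divide_eq)
  then show "1 / s \<le> cothl lam s" unfolding c using assms by (intro divide_right_mono) auto
  have "x * exp (- x) \<le> sinh x"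
    using x by (intro order_trans[OF mult_left_le sinh_ge]) auto
  then have "x * cosh x \<le> (1 + x) * sinh x"
    by (simp add: cosh_minus_sinh[symmetric] algebra_simps)
  then have "x * cosh x / sinh x \<le> 1 + x" using sh by (simp add: divide_le_eq)
  then have "cothl lam s \<le> (1 + x) / s" unfolding c using assms by (intro divide_right_mono) auto
  also have "(1 + x) / s = 1 / s + \<bar>lam\<bar>" using assms by (simp add: x_def add_divide_distrib)
  finally show "cothl lam s \<le> 1 / s + \<bar>lam\<bar>" .
qed

lemma tanhl_bounds:
  assumes "s \<ge> 0"
  shows "0 \<le> tanhl lam s" "tanhl lam s \<le> \<bar>lam\<bar>"
proof -
  define x where "x = \<bar>lam\<bar> * s"
  have x: "x \<ge> 0" using assms by (simp add: x_def)
  have t: "tanhl lam s = \<bar>lam\<bar> * (sinh x / cosh x)"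
    by (auto simp: tanhl_def x_def abs_if)
  have "0 \<le> sinh x / cosh x" "sinh x / cosh x \<le> 1"
    using x by (auto simp: sinh_le_cosh_real)
  then show "0 \<le> tanhl lam s" "tanhl lam s \<le> \<bar>lam\<bar>"
    unfolding t by (auto intro: mult_left_le mult_nonneg_nonneg simp del: times_divide_eq_right)
qed

text \<open>From \<open>1 + 2 * y \<le> exp (2 * y)\<close> follows
  \<open>y / sinh y \<le> 2 * (1 + y) * exp (- y)\<close>. A single term of the exponential series
  then gives \<open>v ^ Suc m * exp (- v) \<le> fact (Suc m)\<close> at \<open>v = 1 + y\<close>;
  passing from \<open>y\<close> to \<open>v\<close> costs \<open>exp 1\<close>.\<close>

lemma div_sinh_decay:
  fixes x :: real
  shows "(1 + \<bar>x\<bar>) ^ m * (x / sinh x) \<le> 2 * exp 1 * fact (Suc m)"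
proof -
  define y where "y = \<bar>x\<bar>"
  have e: "x / sinh x = y / sinh y" by (simp add: y_def abs_if)
  show ?thesis
  proof (cases "x = 0")
    case False
    then have y: "y > 0" by (simp add: y_def)
    then have sh: "sinh y > 0" by simp
    have "y * exp y \<le> (1 + 2 * y) * sinh y"
    proof -
      have one: "exp y * exp (- y) = 1" by (simp add: exp_add[symmetric])
      have "(1 + 2 * y) * exp (- y) \<le> exp (2 * y) * exp (- y)"
        using exp_ge_add_one_self[of "2 * y"] by (intro mult_right_mono) auto
      also have "\<dots> = exp y" by (simp add: exp_add[symmetric])
      finally have "(1 + 2 * y) * exp (- y) \<le> exp y" .
      then have "2 * y * exp y \<le> (1 + 2 * y) * (exp y - exp (- y))" by (simp add: algebra_simps)
      then show ?thesis by (simp add: sinh_field_def)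
    qed
    then have "y / sinh y \<le> (1 + 2 * y) * exp (- y)"
      using sh by (simp add: divide_le_eq exp_minus field_simps)
    also have "\<dots> \<le> 2 * (1 + y) * exp (- y)" by simp
    finally have "(1 + y) ^ m * (y / sinh y) \<le> (1 + y) ^ m * (2 * (1 + y) * exp (- y))"
      using y by (intro mult_left_mono) auto
    also have "\<dots> = 2 * exp 1 * ((1 + y) ^ Suc m * exp (- (1 + y)))"
    proof -
      have "exp 1 * exp (- (1 + y)) = exp (- y)" by (simp add: exp_add[symmetric])
      then show ?thesis by (simp only: power_Suc2 flip: mult.assoc) (simp add: mult_ac)
    qed
    also have "(1 + y) ^ Suc m * exp (- (1 + y)) \<le> fact (Suc m)"
    proof -
      have "(\<lambda>n. (1 + y) ^ n /\<^sub>R fact n) sums exp (1 + y)" by (rule exp_converges)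
      then have "(\<Sum>n\<in>{Suc m}. (1 + y) ^ n /\<^sub>R fact n) \<le> exp (1 + y)"
        using y by (intro sum_le_suminf[THEN order_trans]) (auto simp: sums_iff)
      then have "(1 + y) ^ Suc m \<le> fact (Suc m) * exp (1 + y)" by (simp add: field_simps del: fact_Suc power_Suc)
      then have "(1 + y) ^ Suc m * exp (- (1 + y)) \<le> fact (Suc m) * exp (1 + y) * exp (- (1 + y))"
        by (rule mult_right_mono) simp
      also have "\<dots> = fact (Suc m)" by (simp only: mult.assoc exp_add[symmetric]) simp
      finally show ?thesis .
    qed
    finally show ?thesis unfolding e y_def by simp
  qed simp
qed

lemma div_sinh_nonneg: "0 \<le> x / sinh (x * s :: real)" if "s \<ge> 0"
  using that by (cases "x \<ge> 0") (auto intro: divide_nonneg_nonneg divide_nonpos_nonpos simp: mult_nonneg_nonneg mult_nonpos_nonneg)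

lemma mehler_radicand_nonneg:
  assumes "s \<ge> 0"
  shows "0 \<le> lam / (2 * pi * sinh (2 * lam * s))"
proof -
  have "0 \<le> 1 / (2 * pi) * (lam / sinh (lam * (2 * s)))"
    using assms by (intro mult_nonneg_nonneg div_sinh_nonneg) auto
  also have "1 / (2 * pi) * (lam / sinh (lam * (2 * s))) = lam / (2 * pi * sinh (2 * lam * s))"
    by (simp add: mult_ac)
  finally show ?thesis .
qed

lemma mehler_factor_nonneg: "s \<ge> 0 \<Longrightarrow> 0 \<le> mehler_factor lam s"
  unfolding mehler_factor_def by (intro real_sqrt_ge_zero mehler_radicand_nonneg)

text \<open>The majorant in \<open>lam\<close> for the Fubini arguments, uniform over all times
  \<open>s \<ge> a\<close>. It comes from the exponential decay of \<open>x / sinh x\<close> at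
  \<open>x = 2 * lam * s\<close>, which is up to \<open>4 * pi * s\<close> the square of the Mehler
  factor.\<close>

lemma mehler_factor_decay:
  assumes "a > 0" "n > 0"
  shows "\<exists>C. \<forall>lam s. s \<ge> a \<longrightarrow> (1 + \<bar>lam\<bar>) * mehler_factor lam s ^ n \<le> C / (1 + lam\<^sup>2)"
proof -
  \<comment> \<open>Chosen so that \<open>1 + \<bar>lam\<bar> \<le> D * (1 + \<bar>x\<bar>)\<close>
    holds for every \<open>s \<ge> a\<close>.\<close>
  define D where "D = 1 + 1 / (2 * a)"
  \<comment> \<open>The exponent is twice 3: the estimate is made for the square of the Mehler
    factor, and three powers of \<open>1 + \<bar>lam\<bar>\<close> are wanted, one for the
    derivative and two for \<open>1 + lam\<^sup>2\<close>.\<close>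
  define K where "K = D ^ 6 * (2 * exp 1 * fact (Suc 6)) / (4 * pi * a)"
  have D: "D > 0" using assms by (simp add: D_def add_pos_pos)
  have "(1 + \<bar>lam\<bar>) * mehler_factor lam s ^ n \<le> sqrt K ^ n / (1 + lam\<^sup>2)" if s: "s \<ge> a" for lam s
  proof -
    have s0: "s > 0" using s assms by simp
    have mf0: "0 \<le> mehler_factor lam s" using s0 by (simp add: mehler_factor_nonneg)
    define x where "x = 2 * lam * s"
    have "lam / (2 * pi * sinh (2 * lam * s)) = (x / sinh x) / (4 * pi * s)"
      using s0 by (simp add: x_def)
    then have sq: "(mehler_factor lam s)\<^sup>2 = (x / sinh x) / (4 * pi * s)"
      unfolding mehler_factor_def using mehler_radicand_nonneg[of s lam] s0 by simp
    have "\<bar>lam\<bar> = \<bar>x\<bar> / (2 * s)" using s0 by (simp add: x_def abs_mult)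
    also have "\<dots> \<le> \<bar>x\<bar> / (2 * a)" using s assms by (intro divide_left_mono) auto
    finally have "1 + \<bar>lam\<bar> \<le> 1 + \<bar>x\<bar> / (2 * a) + (\<bar>x\<bar> + 1 / (2 * a))"
      using divide_nonneg_pos[of 1 "2 * a"] assms(1) by linarith
    also have "\<dots> = D * (1 + \<bar>x\<bar>)" by (simp add: D_def algebra_simps add_divide_distrib)
    finally have "(1 + \<bar>lam\<bar>) ^ 6 * (mehler_factor lam s)\<^sup>2 \<le> (D * (1 + \<bar>x\<bar>)) ^ 6 * (mehler_factor lam s)\<^sup>2"
      by (intro mult_right_mono power_mono) auto
    also have "\<dots> = D ^ 6 * ((1 + \<bar>x\<bar>) ^ 6 * (x / sinh x)) / (4 * pi * s)"
      unfolding sq power_mult_distrib by simp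
    also have "\<dots> \<le> D ^ 6 * (2 * exp 1 * fact (Suc 6)) / (4 * pi * s)"
      using D s0 by (intro divide_right_mono mult_left_mono div_sinh_decay) auto
    also have "\<dots> \<le> K"
      unfolding K_def using s D assms by (intro divide_left_mono) auto
    finally have "((1 + \<bar>lam\<bar>) ^ 3 * mehler_factor lam s)\<^sup>2 \<le> K"
      by (simp add: power_mult_distrib)
    then have le: "(1 + \<bar>lam\<bar>) ^ 3 * mehler_factor lam s \<le> sqrt K"
      by (rule real_le_rsqrt)
    have "(1 + \<bar>lam\<bar>) * (1 + lam\<^sup>2) * mehler_factor lam s ^ n \<le> (1 + \<bar>lam\<bar>) ^ 3 * mehler_factor lam s ^ n"
    proof (rule mult_right_mono)
      have "1 + lam\<^sup>2 \<le> (1 + \<bar>lam\<bar>)\<^sup>2" by (simp add: power2_eq_square algebra_simps)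
      then have "(1 + \<bar>lam\<bar>) * (1 + lam\<^sup>2) \<le> (1 + \<bar>lam\<bar>) * (1 + \<bar>lam\<bar>)\<^sup>2" by (intro mult_left_mono) auto
      then show "(1 + \<bar>lam\<bar>) * (1 + lam\<^sup>2) \<le> (1 + \<bar>lam\<bar>) ^ 3" by (simp add: numeral_eq_Suc)
    qed (use mf0 in simp)
    also have "\<dots> \<le> ((1 + \<bar>lam\<bar>) ^ 3) ^ n * mehler_factor lam s ^ n"
      using mf0 assms(2) by (intro mult_right_mono self_le_power) auto
    also have "\<dots> \<le> sqrt K ^ n"
      unfolding power_mult_distrib[symmetric] using mf0 by (intro power_mono le) auto
    finally show ?thesis by (simp add: le_divide_eq add_pos_nonneg mult_ac)
  qed
  then show ?thesis by blast
qed

lemma integrable_div_one_plus_square: "integrable lborel (\<lambda>x::real. C / (1 + x\<^sup>2))"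
  using integrable_mult_right[OF integrable_inverse_1_plus_square[unfolded set_integrable_def], of C]
  by (simp add: divide_inverse)

section \<open>The derivative of the Mehler kernel and its uniform bound\<close>

definition mehler_deriv :: "'n \<Rightarrow> real \<Rightarrow> real \<Rightarrow> real^'n::finite \<Rightarrow> real^'n \<Rightarrow> real" where
  "mehler_deriv j lam s \<xi> \<xi>' =
     - ((cothl lam s * (\<xi> $ j - \<xi>' $ j) + tanhl lam s * (\<xi> $ j + \<xi>' $ j)) / 2) * mehler lam s \<xi> \<xi>'"

lemma borel_measurable_mehler_deriv [measurable]:
  assumes [measurable]: "f \<in> borel_measurable M" "g \<in> borel_measurable M"
    "h \<in> borel_measurable M" "k \<in> borel_measurable M"
  shows "(\<lambda>x. mehler_deriv j (f x) (g x) (h x) (k x :: real^'n::finite)) \<in> borel_measurable M"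
  unfolding mehler_deriv_def by measurable

lemma mehler_has_derivative:
  fixes \<xi> \<xi>' :: "real^'n::finite"
  shows "((\<lambda>h. mehler lam s (\<xi> + h *\<^sub>R axis j 1) \<xi>') has_real_derivative
     mehler_deriv j lam s (\<xi> + h *\<^sub>R axis j 1) \<xi>') (at h)"
proof -
  define R where "R = (\<Prod>i\<in>UNIV - {j}. mehler1 lam s (\<xi> $ i) (\<xi>' $ i))"
  have e: "mehler lam s (\<xi> + h *\<^sub>R axis j 1) \<xi>' = mehler1 lam s (\<xi> $ j + h) (\<xi>' $ j) * R" for h
    unfolding mehler_def R_def by (subst prod.remove[of UNIV j]) (auto simp: axis_def)
  let ?q = "\<lambda>h. - (cothl lam s * (\<xi> $ j + h - \<xi>' $ j)\<^sup>2 + tanhl lam s * (\<xi> $ j + h + \<xi>' $ j)\<^sup>2) / 4"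
  let ?d = "- ((cothl lam s * (\<xi> $ j + h - \<xi>' $ j) + tanhl lam s * (\<xi> $ j + h + \<xi>' $ j)) / 2)"
  have "(?q has_real_derivative ?d) (at h)"
    by (auto intro!: derivative_eq_intros simp: field_simps)
  then have "((\<lambda>h. mehler_factor lam s * exp (?q h) * R) has_real_derivative mehler_factor lam s * (exp (?q h) * ?d) * R) (at h)"
    by (intro DERIV_cmult_right DERIV_cmult DERIV_fun_exp)
  then show ?thesis
    unfolding mehler_deriv_def e unfolding mehler1_def by (simp add: axis_def mult_ac)
qed

lemma mehler1_nonneg: "s \<ge> 0 \<Longrightarrow> 0 \<le> mehler1 lam s x y"
  by (simp add: mehler1_def mehler_factor_nonneg)

lemma mehler1_le: "lam \<noteq> 0 \<Longrightarrow> s > 0 \<Longrightarrow> mehler1 lam s x y \<le> mehler_factor lam s"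
proof -
  assume "lam \<noteq> 0" "s > 0"
  then have "0 \<le> cothl lam s * (x - y)\<^sup>2 + tanhl lam s * (x + y)\<^sup>2"
    using cothl_bounds[of lam s] tanhl_bounds[of s lam] order_trans[of 0 "1/s" "cothl lam s"]
    by (intro add_nonneg_nonneg mult_nonneg_nonneg) auto
  then show ?thesis
    unfolding mehler1_def using \<open>s > 0\<close> by (intro mult_left_le mehler_factor_nonneg) auto
qed

lemma mehler_nonneg: "s \<ge> 0 \<Longrightarrow> 0 \<le> mehler lam s \<xi> \<xi>'"
  unfolding mehler_def by (intro prod_nonneg mehler1_nonneg) auto

lemma mehler_le: "lam \<noteq> 0 \<Longrightarrow> s > 0 \<Longrightarrow> mehler lam s \<xi> (\<xi>' :: real^'n::finite) \<le> mehler_factor lam s ^ CARD('n)"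
  unfolding mehler_def
  by (rule order_trans[OF prod_mono[where g = "\<lambda>_. mehler_factor lam s"]])
    (auto intro: mehler1_nonneg mehler1_le)

text \<open>With \<open>y = sqrt c * \<bar>u\<bar>\<close> one has
  \<open>y * exp (- (y\<^sup>2 / 4)) \<le> 1\<close>, and the remaining \<open>sqrt c\<close> is at
  most \<open>1 + c\<close>.\<close>

lemma mult_gaussian_le:
  fixes c u :: real
  assumes "c \<ge> 0"
  shows "c * \<bar>u\<bar> * exp (- (c * u\<^sup>2) / 4) \<le> 1 + c"
proof -
  define y where "y = sqrt c * \<bar>u\<bar>"
  have y2: "y\<^sup>2 = c * u\<^sup>2" using assms by (simp add: y_def power_mult_distrib)
  have "y \<le> 1 + y\<^sup>2 / 4" using zero_le_power2[of "y / 2 - 1"] by (simp add: power2_eq_square algebra_simps)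
  also have "\<dots> \<le> exp (y\<^sup>2 / 4)" by simp
  finally have "y * exp (- (y\<^sup>2 / 4)) \<le> exp (y\<^sup>2 / 4) * exp (- (y\<^sup>2 / 4))" by (intro mult_right_mono) auto
  also have "\<dots> = 1" by (simp add: exp_add[symmetric])
  finally have "sqrt c * (y * exp (- (y\<^sup>2 / 4))) \<le> sqrt c * 1" using assms by (intro mult_left_mono) auto
  also have "sqrt c * (y * exp (- (y\<^sup>2 / 4))) = c * \<bar>u\<bar> * exp (- (c * u\<^sup>2) / 4)"
    using assms by (simp add: y2) (simp add: y_def)
  also have "sqrt c * 1 \<le> 1 + c"
  proof -
    have "sqrt c \<le> sqrt ((1 + c)\<^sup>2)" using assms by (intro real_sqrt_le_mono) (auto simp: power2_eq_square algebra_simps)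
    then show ?thesis using assms by simp
  qed
  finally show ?thesis .
qed

text \<open>The derivative brings down two linear factors. Each is absorbed by the Gaussian with the
  same coefficient, through \<open>mult_gaussian_le\<close>, while the other Gaussian is at most 1;
  so the bound is free of both space variables.\<close>

lemma mehler_deriv_bound:
  fixes \<xi> \<xi>' :: "real^'n::finite"
  assumes "lam \<noteq> 0" "s > 0"
  shows "\<bar>mehler_deriv j lam s \<xi> \<xi>'\<bar> \<le> (1 + 1 / s) * (1 + \<bar>lam\<bar>) * mehler_factor lam s ^ CARD('n)"
proof -
  let ?u = "\<xi> $ j - \<xi>' $ j" and ?v = "\<xi> $ j + \<xi>' $ j"
  let ?c = "cothl lam s" and ?t = "tanhl lam s" and ?m = "mehler_factor lam s"
  define R where "R = (\<Prod>i\<in>UNIV - {j}. mehler1 lam s (\<xi> $ i) (\<xi>' $ i))"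
  have c: "?c \<ge> 0" "?c \<le> 1 / s + \<bar>lam\<bar>" using cothl_bounds[OF assms] assms order_trans[of 0 "1/s" ?c] by auto
  have t: "?t \<ge> 0" "?t \<le> \<bar>lam\<bar>" using tanhl_bounds[of s lam] assms by auto
  have m: "?m \<ge> 0" using assms by (simp add: mehler_factor_nonneg)
  have R: "0 \<le> R" "R \<le> ?m ^ (CARD('n) - 1)"
  proof -
    show "0 \<le> R" unfolding R_def using assms by (intro prod_nonneg) (auto intro: mehler1_nonneg)
    have "R \<le> (\<Prod>i\<in>UNIV - {j}. ?m)" unfolding R_def
      using assms by (intro prod_mono) (auto intro: mehler1_nonneg mehler1_le)
    also have "\<dots> = ?m ^ (CARD('n) - 1)" by (simp add: card_Diff_singleton)
    finally show "R \<le> ?m ^ (CARD('n) - 1)" .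
  qed
  have e: "mehler lam s \<xi> \<xi>' = mehler1 lam s (\<xi> $ j) (\<xi>' $ j) * R"
    unfolding mehler_def R_def by (subst prod.remove[of UNIV j]) auto
  have "\<bar>?c * ?u + ?t * ?v\<bar> * mehler1 lam s (\<xi> $ j) (\<xi>' $ j)
     \<le> (?c * \<bar>?u\<bar> + ?t * \<bar>?v\<bar>) * mehler1 lam s (\<xi> $ j) (\<xi>' $ j)"
    using c t assms mehler1_nonneg[of s lam "\<xi> $ j" "\<xi>' $ j"]
    by (intro mult_right_mono order_trans[OF abs_triangle_ineq]) (auto simp: abs_mult)
  also have "\<dots> = ?m * ((?c * \<bar>?u\<bar> * exp (- (?c * ?u\<^sup>2) / 4)) * exp (- (?t * ?v\<^sup>2) / 4)
      + (?t * \<bar>?v\<bar> * exp (- (?t * ?v\<^sup>2) / 4)) * exp (- (?c * ?u\<^sup>2) / 4))"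
  proof -
    have "exp (- (?c * ?u\<^sup>2 + ?t * ?v\<^sup>2) / 4) = exp (- (?c * ?u\<^sup>2) / 4) * exp (- (?t * ?v\<^sup>2) / 4)"
      by (simp add: exp_add[symmetric] add_divide_distrib)
    then show ?thesis unfolding mehler1_def by (simp add: algebra_simps)
  qed
  also have "\<dots> \<le> ?m * ((1 + ?c) * 1 + (1 + ?t) * 1)"
    using m c t by (intro mult_left_mono add_mono mult_mono mult_gaussian_le) auto
  also have "\<dots> \<le> ?m * (2 * ((1 + 1 / s) * (1 + \<bar>lam\<bar>)))"
  proof (rule mult_left_mono[OF _ m])
    define q where "q = 1 / s"
    have "0 \<le> q * \<bar>lam\<bar>" "0 \<le> q" "?c \<le> q + \<bar>lam\<bar>" using assms c by (auto simp: q_def)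
    define z where "z = q * \<bar>lam\<bar>"
    have "?c + ?t \<le> q + \<bar>lam\<bar> + \<bar>lam\<bar> + (q + 2 * z)"
      using \<open>0 \<le> q * \<bar>lam\<bar>\<close> \<open>0 \<le> q\<close> \<open>?c \<le> q + \<bar>lam\<bar>\<close> t unfolding z_def[symmetric] by linarith
    then have "?c + ?t \<le> 2 * (q + \<bar>lam\<bar> + q * \<bar>lam\<bar>)" by (simp add: z_def algebra_simps)
    then show "(1 + ?c) * 1 + (1 + ?t) * 1 \<le> 2 * ((1 + 1 / s) * (1 + \<bar>lam\<bar>))"
      unfolding q_def[symmetric] by (simp add: algebra_simps)
  qed
  finally have main: "\<bar>?c * ?u + ?t * ?v\<bar> * mehler1 lam s (\<xi> $ j) (\<xi>' $ j) \<le> ?m * (2 * ((1 + 1 / s) * (1 + \<bar>lam\<bar>)))" .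
  have "\<bar>mehler_deriv j lam s \<xi> \<xi>'\<bar> = (\<bar>?c * ?u + ?t * ?v\<bar> * mehler1 lam s (\<xi> $ j) (\<xi>' $ j)) / 2 * R"
    unfolding mehler_deriv_def e using R assms mehler1_nonneg[of s lam "\<xi> $ j" "\<xi>' $ j"]
    by (simp add: abs_mult)
  also have "\<dots> \<le> (?m * (2 * ((1 + 1 / s) * (1 + \<bar>lam\<bar>)))) / 2 * ?m ^ (CARD('n) - 1)"
    using R m assms by (intro mult_mono divide_right_mono main) auto
  also have "\<dots> = (1 + 1 / s) * (1 + \<bar>lam\<bar>) * (?m * ?m ^ (CARD('n) - 1))" by simp
  also have "?m * ?m ^ (CARD('n) - 1) = ?m ^ CARD('n)"
    by (metis One_nat_def Suc_pred power_Suc zero_less_card_finite)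
  finally show ?thesis .
qed

subsection \<open>The Grushin side\<close>

lemma borel_measurable_fst [measurable]:
  fixes f :: "'a \<Rightarrow> 'b::second_countable_topology \<times> 'c::second_countable_topology"
  assumes "f \<in> borel_measurable M"
  shows "(\<lambda>x. fst (f x)) \<in> borel_measurable M"
  by (rule borel_measurable_continuous_on[OF _ assms]) (intro continuous_intros)

lemma borel_measurable_snd [measurable]:
  fixes f :: "'a \<Rightarrow> 'b::second_countable_topology \<times> 'c::second_countable_topology"
  assumes "f \<in> borel_measurable M"
  shows "(\<lambda>x. snd (f x)) \<in> borel_measurable M"
  by (rule borel_measurable_continuous_on[OF _ assms]) (intro continuous_intros)

text \<open>Lets an identity known only for \<open>lam \<noteq> 0\<close> be used under an integral
  over \<open>lam\<close>. Measurability of \<open>f\<close> is inherited from \<open>g\<close>,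
  since they differ at one point at most.\<close>

lemma integral_eq_except_point:
  fixes f g :: "'a::euclidean_space \<Rightarrow> 'b::{banach,second_countable_topology}"
  assumes "\<And>x. x \<noteq> c \<Longrightarrow> f x = g x" and [measurable]: "g \<in> borel_measurable borel"
  shows "(LBINT x. f x) = (LBINT x. g x)"
proof (rule integral_cong_AE)
  have "f = (\<lambda>x. if x = c then f c else g x)" using assms(1) by auto
  moreover have "(\<lambda>x. if x = c then f c else g x) \<in> borel_measurable lborel" by measurable
  ultimately show "f \<in> borel_measurable lborel" by simp
  show "AE x in lborel. f x = g x"
    using AE_lborel_singleton[of c] by eventually_elim (rule assms)
qed simp

definition annulus :: "real \<Rightarrow> real set" where
  "annulus \<epsilon> = {r. \<epsilon> < \<bar>r\<bar> \<and> \<bar>r\<bar> < 1 / \<epsilon>}"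

lemma annulus_borel [measurable]: "annulus \<epsilon> \<in> sets borel"
  unfolding annulus_def by measurable

lemma integrable_indicator_annulus: "integrable lborel (indicator (annulus \<epsilon>) :: real \<Rightarrow> real)"
proof (rule integrable_real_indicator)
  have "emeasure lborel (annulus \<epsilon>) \<le> emeasure lborel {- (1 / \<epsilon>)..1 / \<epsilon>}"
    by (rule emeasure_mono) (auto simp: annulus_def)
  also have "\<dots> < \<infinity>" by (rule emeasure_lborel_Icc_eq[THEN ord_eq_less_trans]) simp
  finally show "emeasure lborel (annulus \<epsilon>) < \<infinity>" .
qed simp

text \<open>With s = r^2 the measure \<open>s powr (-1/2)\<close> ds becomes 2 dr on the positive
  half of the annulus. Since \<open>\<phi> (r\<^sup>2)\<close> is even, half of this mass can be
  moved to negative \<open>r\<close>.\<close>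

lemma annulus_substitution_real:
  fixes \<phi> :: "real \<Rightarrow> real"
  assumes \<epsilon>: "0 < \<epsilon>" "\<epsilon> < 1"
    and \<phi>: "set_integrable lborel {\<epsilon>\<^sup>2..1 / \<epsilon>\<^sup>2} (\<lambda>s. \<phi> s * s powr (-1/2))"
  shows "has_bochner_integral lborel (\<lambda>r. indicator (annulus \<epsilon>) r * \<phi> (r\<^sup>2))
    (LINT s:{\<epsilon>\<^sup>2..1 / \<epsilon>\<^sup>2}|lborel. \<phi> s * s powr (-1/2))"
proof -
  let ?I = "{\<epsilon>..1 / \<epsilon>}"
  have le: "\<epsilon> \<le> 1 / \<epsilon>"
    using \<epsilon> mult_mono[of \<epsilon> 1 \<epsilon> 1] by (simp add: le_divide_eq)
  have pos: "0 < 1 / \<epsilon>" using \<epsilon> by simp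
  have sq: "(1 / \<epsilon>)\<^sup>2 = 1 / \<epsilon>\<^sup>2" by (simp add: power_divide)
  note S = integral_substitution[where g = "\<lambda>r. r\<^sup>2" and g' = "\<lambda>r. 2 * r" and a = \<epsilon> and b = "1 / \<epsilon>",
      OF \<phi>[folded sq] _ _ _ le]
  have d: "((\<lambda>r. r\<^sup>2) has_real_derivative 2 * x) (at x)" for x :: real by (auto intro!: derivative_eq_intros)
  have c: "continuous_on ?I (\<lambda>r. 2 * r)" by (intro continuous_intros)
  have p: "(r\<^sup>2) powr (-1/2) * (2 * r) = 2" if "r \<ge> \<epsilon>" for r
  proof -
    have "r > 0" using that \<epsilon> by simp
    then have "(r\<^sup>2) powr (-1/2) = (r powr 2) powr (-1/2)" by simp
    also have "\<dots> = r powr (-1)" by (simp only: powr_powr) simp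
    also have "\<dots> = 1 / r" using \<open>r > 0\<close> by (simp add: powr_minus_divide)
    finally show ?thesis using \<open>r > 0\<close> by simp
  qed
  \<comment> \<open>\<open>g\<close> lives on the positive half; the factor 2 in \<open>ge\<close>
    is spent on its mirror image \<open>g (- r)\<close>.\<close>
  define g where "g r = indicator ?I r * \<phi> (r\<^sup>2)" for r
  have ge: "indicator ?I r * (\<phi> (r\<^sup>2) * (r\<^sup>2) powr (-1/2) * (2 * r)) = 2 * g r" for r
    using p[of r] by (auto simp: g_def indicator_def mult.assoc)
  have "set_integrable lborel ?I (\<lambda>r. \<phi> (r\<^sup>2) * (r\<^sup>2) powr (-1/2) * (2 * r))"
    by (rule S(1)) (use d c \<epsilon> in auto)
  then have "integrable lborel (\<lambda>r. 2 * g r)"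
    unfolding set_integrable_def by (simp only: real_scaleR_def ge)
  then have gi: "integrable lborel g" by simp
  then have gm: "integrable lborel (\<lambda>r. g (- r))"
    using lborel_integrable_real_affine[OF gi, of "-1" 0] by simp
  have E: "indicator (annulus \<epsilon>) r * \<phi> (r\<^sup>2) = indicator (annulus \<epsilon>) r * (g r + g (- r))" for r
    using \<epsilon> by (auto simp: annulus_def indicator_def g_def abs_if split: if_splits)
  have i: "integrable lborel (\<lambda>r. indicator (annulus \<epsilon>) r * (g r + g (- r)))"
    by (rule Bochner_Integration.integrable_bound[OF Bochner_Integration.integrable_add[OF gi gm]])
      (use gi gm in \<open>auto simp: indicator_def\<close>)
  have "(LINT s:{\<epsilon>\<^sup>2..1 / \<epsilon>\<^sup>2}|lborel. \<phi> s * s powr (-1/2)) =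
      (LBINT s. \<phi> s * s powr (-1/2) * indicator {\<epsilon>\<^sup>2..(1 / \<epsilon>)\<^sup>2} s)"
    by (simp add: set_lebesgue_integral_def mult_ac sq)
  also have "\<dots> = (LBINT r. \<phi> (r\<^sup>2) * (r\<^sup>2) powr (-1/2) * (2 * r) * indicator ?I r)"
    by (rule S(2)) (use d c \<epsilon> in auto)
  also have "\<dots> = (LBINT r. 2 * g r)"
    unfolding ge[symmetric] by (simp only: mult_ac)
  also have "\<dots> = (LBINT r. g r) + (LBINT r. g (- r))"
    using lborel_integral_real_affine[of "-1" g 0] by simp
  also have "\<dots> = (LBINT r. g r + g (- r))" using gi gm by simp
  \<comment> \<open>The closed intervals and the open annulus differ only in the four
    endpoints.\<close>
  also have "\<dots> = (LBINT r. indicator (annulus \<epsilon>) r * (g r + g (- r)))"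
  proof (rule integral_cong_AE)
    show "AE r in lborel. g r + g (- r) = indicator (annulus \<epsilon>) r * (g r + g (- r))"
      using AE_lborel_singleton[of \<epsilon>] AE_lborel_singleton[of "-\<epsilon>"] AE_lborel_singleton[of "1/\<epsilon>"] AE_lborel_singleton[of "-1/\<epsilon>"]
      by eventually_elim (use \<epsilon> pos in \<open>auto simp: g_def annulus_def indicator_def abs_if\<close>)
  qed (use gi gm in measurable)
  finally show ?thesis unfolding has_bochner_integral_iff E using i by simp
qed

text \<open>Real and imaginary parts are treated separately for small \<open>\<epsilon>\<close>.
  When \<open>\<epsilon> \<ge> 1\<close> both sides vanish: the annulus is empty and the interval
  has measure 0.\<close>

lemma annulus_substitution:
  fixes \<phi> :: "real \<Rightarrow> complex"
  assumes \<epsilon>: "0 < \<epsilon>"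
    and \<phi>: "set_integrable lborel {\<epsilon>\<^sup>2..1 / \<epsilon>\<^sup>2} (\<lambda>s. \<phi> s * of_real (s powr (-1/2)))"
  shows "(LINT s:{\<epsilon>\<^sup>2..1 / \<epsilon>\<^sup>2}|lborel. \<phi> s * of_real (s powr (-1/2))) = (LINT r:annulus \<epsilon>|lborel. \<phi> (r\<^sup>2))"
proof (cases "\<epsilon> < 1")
  case True
  have re: "set_integrable lborel {\<epsilon>\<^sup>2..1 / \<epsilon>\<^sup>2} (\<lambda>s. Re (\<phi> s) * s powr (-1/2))"
    using integrable_Re[OF \<phi>[unfolded set_integrable_def]] by (simp add: set_integrable_def)
  have im: "set_integrable lborel {\<epsilon>\<^sup>2..1 / \<epsilon>\<^sup>2} (\<lambda>s. Im (\<phi> s) * s powr (-1/2))"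
    using integrable_Im[OF \<phi>[unfolded set_integrable_def]] by (simp add: set_integrable_def)
  have "(LINT s:{\<epsilon>\<^sup>2..1 / \<epsilon>\<^sup>2}|lborel. \<phi> s * of_real (s powr (-1/2))) =
      of_real (LINT s:{\<epsilon>\<^sup>2..1 / \<epsilon>\<^sup>2}|lborel. Re (\<phi> s) * s powr (-1/2))
      + \<i> * of_real (LINT s:{\<epsilon>\<^sup>2..1 / \<epsilon>\<^sup>2}|lborel. Im (\<phi> s) * s powr (-1/2))"
    using integral_Re[OF \<phi>[unfolded set_integrable_def]] integral_Im[OF \<phi>[unfolded set_integrable_def]]
    by (simp add: complex_eq_iff set_lebesgue_integral_def)
  moreover have "(\<lambda>r. complex_of_real (indicator (annulus \<epsilon>) r * Re (\<phi> (r\<^sup>2))) + \<i> * of_real (indicator (annulus \<epsilon>) r * Im (\<phi> (r\<^sup>2))))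
      = (\<lambda>r. indicator (annulus \<epsilon>) r *\<^sub>R \<phi> (r\<^sup>2))"
    by (auto simp: complex_eq_iff fun_eq_iff)
  ultimately show ?thesis
    using has_bochner_integral_integral_eq[OF has_bochner_integral_add[OF
        has_bochner_integral_of_real[OF annulus_substitution_real[OF \<epsilon> True re]]
        has_bochner_integral_mult_right[where c = \<i>, OF has_bochner_integral_of_real[OF annulus_substitution_real[OF \<epsilon> True im]]]]]
    by (simp only: set_lebesgue_integral_def)
next
  case False
  then have e1: "1 \<le> \<epsilon>" by simp
  have "annulus \<epsilon> = {}"
  proof -
    have "1 / \<epsilon> \<le> 1" using e1 by simp
    then have "1 / \<epsilon> \<le> \<epsilon>" using e1 by (rule order_trans)
    then show ?thesis unfolding annulus_def by force
  qed
  \<comment> \<open>At \<open>\<epsilon> = 1\<close> the interval is the single point 1, hence the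
    exceptional point.\<close>
  moreover have "(LINT s:{\<epsilon>\<^sup>2..1 / \<epsilon>\<^sup>2}|lborel. \<phi> s * of_real (s powr (-1/2))) = (LINT s|(lborel :: real measure). 0)"
    unfolding set_lebesgue_integral_def
  proof (rule integral_eq_except_point[where c = "1::real"])
    have "1 \<le> \<epsilon>\<^sup>2" using e1 by (simp add: one_le_power)
    moreover have "0 < \<epsilon>\<^sup>2" using \<epsilon> by simp
    ultimately have "1 / \<epsilon>\<^sup>2 \<le> 1" by (simp only: divide_le_eq_1_pos)
    with \<open>1 \<le> \<epsilon>\<^sup>2\<close> show "indicator {\<epsilon>\<^sup>2..1 / \<epsilon>\<^sup>2} x *\<^sub>R (\<phi> x * complex_of_real (x powr (- 1 / 2))) = 0" if "x \<noteq> 1" for x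
      using that by (auto simp: indicator_def)
  qed simp
  ultimately show ?thesis by (simp only: set_lebesgue_integral_def) simp
qed

section \<open>First-order operators acting on the Mehler kernel\<close>

definition ladder_op :: "real \<Rightarrow> real \<Rightarrow> 'n::finite \<Rightarrow> (real^'n \<Rightarrow> complex) \<Rightarrow> real^'n \<Rightarrow> complex" where
  "ladder_op sg lam j g \<xi> = - of_real sg * partial_at j g \<xi> + of_real (lam * \<xi> $ j) * g \<xi>"

definition mehler_ladder :: "real \<Rightarrow> 'n::finite \<Rightarrow> real \<Rightarrow> real \<Rightarrow> real^'n \<Rightarrow> real^'n \<Rightarrow> real" where
  "mehler_ladder sg j lam s \<xi> \<xi>' = - sg * mehler_deriv j lam s \<xi> \<xi>' + lam * \<xi> $ j * mehler lam s \<xi> \<xi>'"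

lemma borel_measurable_mehler_ladder [measurable]:
  assumes [measurable]: "f \<in> borel_measurable M" "g \<in> borel_measurable M"
    "h \<in> borel_measurable M" "k \<in> borel_measurable M"
  shows "(\<lambda>x. mehler_ladder sg j (f x) (g x) (h x) (k x :: real^'n::finite)) \<in> borel_measurable M"
  unfolding mehler_ladder_def by measurable

lemma mehler_0 [simp]: "mehler 0 s \<xi> (\<xi>' :: real^'n::finite) = 0"
  by (simp add: mehler_def mehler1_def mehler_factor_def)

lemma mehler_ladder_0 [simp]: "mehler_ladder sg j 0 s \<xi> \<xi>' = 0"
  by (simp add: mehler_ladder_def mehler_deriv_def)

lemma mehler_ladder_bound:
  fixes \<xi> \<xi>' :: "real^'n::finite"
  assumes s: "s > 0" and sg: "\<bar>sg\<bar> = 1"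
  shows "\<bar>mehler_ladder sg j lam s \<xi> \<xi>'\<bar> \<le> (1 + 1 / s + \<bar>\<xi> $ j\<bar>) * ((1 + \<bar>lam\<bar>) * mehler_factor lam s ^ CARD('n))"
proof (cases "lam = 0")
  case True
  then show ?thesis using s by (auto intro!: mult_nonneg_nonneg mehler_factor_nonneg intro: zero_le_power)
next
  case False
  let ?m = "mehler_factor lam s ^ CARD('n)"
  have m: "?m \<ge> 0" using s by (simp add: mehler_factor_nonneg)
  have "\<bar>mehler_ladder sg j lam s \<xi> \<xi>'\<bar> \<le> \<bar>mehler_deriv j lam s \<xi> \<xi>'\<bar> + \<bar>lam\<bar> * \<bar>\<xi> $ j\<bar> * mehler lam s \<xi> \<xi>'"
    unfolding mehler_ladder_def using sg mehler_nonneg[of s lam \<xi> \<xi>'] s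
    by (intro order_trans[OF abs_triangle_ineq]) (auto simp: abs_mult)
  also have "\<dots> \<le> (1 + 1 / s) * (1 + \<bar>lam\<bar>) * ?m + (1 + \<bar>lam\<bar>) * \<bar>\<xi> $ j\<bar> * ?m"
    using False s mehler_nonneg[of s lam \<xi> \<xi>'] by (intro add_mono mehler_deriv_bound mult_mono mehler_le) auto
  finally show ?thesis by (simp add: algebra_simps)
qed

text \<open>The kernel in which both sides of the theorem meet: up to \<open>1 / (2 * pi)\<close>,
  the inverse transform in \<open>lam\<close> of the ladder operator applied to the Mehler kernel,
  with \<open>\<delta>\<close> the difference of the central variables.\<close>

definition ladder_kernel :: "real \<Rightarrow> 'n::finite \<Rightarrow> real^'n \<Rightarrow> real \<Rightarrow> real^'n \<Rightarrow> real \<Rightarrow> complex" where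
  "ladder_kernel sg j \<xi> s \<xi>' \<delta> = (LBINT lam. cis (- (lam * \<delta>)) * of_real (mehler_ladder sg j lam s \<xi> \<xi>'))"

context
  fixes f :: "(real^'n::finite) \<times> real \<Rightarrow> complex" and \<epsilon> :: real
  assumes f: "integrable lborel f" and \<epsilon>: "\<epsilon> > 0"
begin

lemma f_measurable [measurable]: "f \<in> borel_measurable borel"
  using f by auto

text \<open>The variable \<open>q\<close> is the triple of radius, space point and central variable.
  Working on this product space puts the radial and spatial integrations under one integral sign,
  with this majorant.\<close>

lemma integrable_annulus_times:
  "integrable lborel (\<lambda>q::real \<times> ((real^'n) \<times> real). indicator (annulus \<epsilon>) (fst q) * (C * norm (f (snd q))))"
  unfolding lborel_prod[symmetric]
  by (intro integrable_pair_mult integrable_indicator_annulus integrable_mult_right integrable_norm)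
    (use f in \<open>auto simp: lborel_prod intro: pair_sigma_finite_lborel\<close>)

lemma annulus_sq: "r \<in> annulus \<epsilon> \<Longrightarrow> \<epsilon>\<^sup>2 \<le> r\<^sup>2"
  unfolding annulus_def using \<epsilon> by (auto simp: abs_le_square_iff[symmetric])

lemma integrable_annulus_kernel:
  assumes [measurable]: "(\<lambda>q. k (fst q) (fst (snd q))) \<in> borel_measurable (borel :: (real \<times> ((real^'n) \<times> real)) measure)"
    and k: "\<And>r x. r \<in> annulus \<epsilon> \<Longrightarrow> \<bar>k r x\<bar> \<le> C"
  shows "integrable lborel (\<lambda>q. of_real (indicator (annulus \<epsilon>) (fst q) * k (fst q) (fst (snd q)))
     * (f (snd q) * cis (lam * snd (snd q))))"
proof (rule integrable_dominated[OF integrable_annulus_times[of C]])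
  fix q :: "real \<times> ((real^'n) \<times> real)"
  have "fst q \<in> annulus \<epsilon> \<Longrightarrow> \<bar>k (fst q) (fst (snd q))\<bar> * norm (f (snd q)) \<le> C * norm (f (snd q))"
    by (intro mult_right_mono k) auto
  then show "norm (of_real (indicator (annulus \<epsilon>) (fst q) * k (fst q) (fst (snd q))) * (f (snd q) * cis (lam * snd (snd q))))
      \<le> indicator (annulus \<epsilon>) (fst q) * (C * norm (f (snd q)))"
    by (auto simp: norm_mult indicator_def)
qed measurable

lemma integrable_fourier_eta: "integrable lborel (fourier_eta lam f)"
proof -
  have "integrable (lborel \<Otimes>\<^sub>M lborel) (\<lambda>p. f p * cis (lam * snd p))"
    unfolding lborel_prod by (rule integrable_dominated[OF integrable_norm[OF f]]) (auto simp: norm_mult)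
  from lborel_pair.integrable_fst'[OF this]
  show ?thesis unfolding fourier_eta_def[abs_def] by simp
qed

text \<open>The constant may depend on \<open>lam\<close>; this is enough for differentiating in the
  base point at a fixed frequency.\<close>

lemma mehler_bounds:
  assumes lam: "lam \<noteq> 0"
  shows "\<exists>C. \<forall>s \<ge> \<epsilon>\<^sup>2. \<forall>\<xi> \<xi>' :: real^'n. \<bar>mehler lam s \<xi> \<xi>'\<bar> \<le> C \<and> \<bar>mehler_deriv j lam s \<xi> \<xi>'\<bar> \<le> C"
proof -
  obtain C where C: "\<And>s. s \<ge> \<epsilon>\<^sup>2 \<Longrightarrow> (1 + \<bar>lam\<bar>) * mehler_factor lam s ^ CARD('n) \<le> C / (1 + lam\<^sup>2)"
    using mehler_factor_decay[of "\<epsilon>\<^sup>2" "CARD('n)"] \<epsilon> by auto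
  let ?B = "(1 + 1 / \<epsilon>\<^sup>2) * (C / (1 + lam\<^sup>2))"
  have "\<bar>mehler lam s \<xi> \<xi>'\<bar> \<le> ?B \<and> \<bar>mehler_deriv j lam s \<xi> \<xi>'\<bar> \<le> ?B" if s: "s \<ge> \<epsilon>\<^sup>2" for s and \<xi> \<xi>' :: "real^'n"
  proof
    have s0: "s > 0" using \<epsilon> s by (auto intro: less_le_trans[of 0 "\<epsilon>\<^sup>2"])
    define M where "M = (1 + \<bar>lam\<bar>) * mehler_factor lam s ^ CARD('n)"
    have M: "0 \<le> M" "mehler_factor lam s ^ CARD('n) \<le> M" "M \<le> C / (1 + lam\<^sup>2)"
      using s0 C[OF s] by (auto simp: M_def mehler_factor_nonneg distrib_right)
    have "\<bar>mehler lam s \<xi> \<xi>'\<bar> \<le> 1 * M"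
      using mehler_le[OF lam s0, of \<xi> \<xi>'] mehler_nonneg[of s lam \<xi> \<xi>'] s0 M(2) by simp
    also have "\<dots> \<le> ?B" using M by (intro mult_mono) auto
    finally show "\<bar>mehler lam s \<xi> \<xi>'\<bar> \<le> ?B" .
    have "\<bar>mehler_deriv j lam s \<xi> \<xi>'\<bar> \<le> (1 + 1 / s) * M"
      using mehler_deriv_bound[OF lam s0] by (simp add: M_def mult.assoc)
    also have "\<dots> \<le> ?B" using M s s0 \<epsilon> by (intro mult_mono add_mono divide_left_mono) auto
    finally show "\<bar>mehler_deriv j lam s \<xi> \<xi>'\<bar> \<le> ?B" .
  qed
  then show ?thesis by blast
qed

lemma hermite_semigroup_fourier_eta:
  assumes lam: "lam \<noteq> 0" and s: "s \<ge> \<epsilon>\<^sup>2"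
  shows "hermite_semigroup lam s (fourier_eta lam f) \<xi> =
    (LBINT p. of_real (mehler lam s \<xi> (fst p)) * (f p * cis (lam * snd p)))"
proof -
  have s0: "s > 0" using \<epsilon> s by (auto intro: less_le_trans[of 0 "\<epsilon>\<^sup>2"])
  obtain C where C: "\<And>\<xi>' :: real^'n. \<bar>mehler lam s \<xi> \<xi>'\<bar> \<le> C"
    using mehler_bounds[OF lam] s by blast
  have i: "integrable (lborel \<Otimes>\<^sub>M lborel) (\<lambda>p. of_real (mehler lam s \<xi> (fst p)) * (f p * cis (lam * snd p)))"
    unfolding lborel_prod
    by (rule integrable_dominated[OF integrable_mult_right[OF integrable_norm[OF f], of C]])
      (measurable, simp add: norm_mult mult_right_mono C)
  have "hermite_semigroup lam s (fourier_eta lam f) \<xi> = (LBINT x. of_real (mehler lam s \<xi> x) * fourier_eta lam f x)"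
    by (rule hermite_semigroup_eq[OF lam s0 integrable_fourier_eta])
  also have "\<dots> = (LBINT x. LBINT y. of_real (mehler lam s \<xi> x) * (f (x, y) * cis (lam * y)))"
    unfolding fourier_eta_def by simp
  also have "\<dots> = (LBINT p. of_real (mehler lam s \<xi> (fst p)) * (f p * cis (lam * snd p)))"
    using lborel_pair.integral_fst'[OF i] by (simp add: lborel_prod)
  finally show ?thesis .
qed

text \<open>Collects semigroup, time integral and Fourier integral into a single integral over
  \<open>q\<close>. The base point now occurs only in the Mehler kernel, so that one differentiation
  under the integral is enough.\<close>

lemma hermite_truncated_integral_eq:
  assumes lam: "lam \<noteq> 0"
  shows "hermite_truncated_integral \<epsilon> lam (fourier_eta lam f) \<xi> =
    (LBINT q. of_real (indicator (annulus \<epsilon>) (fst q) * mehler lam ((fst q)\<^sup>2) \<xi> (fst (snd q)))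
       * (f (snd q) * cis (lam * snd (snd q))))"
proof -
  define S where "S s = (LBINT p. of_real (mehler lam s \<xi> (fst p)) * (f p * cis (lam * snd p)))" for s
  have [measurable]: "S \<in> borel_measurable borel" unfolding S_def by measurable
  obtain C where kb: "\<And>s x. s \<ge> \<epsilon>\<^sup>2 \<Longrightarrow> \<bar>mehler lam s \<xi> x\<bar> \<le> C"
    using mehler_bounds[OF lam] by blast
  have C0: "0 \<le> C" using kb[of "\<epsilon>\<^sup>2" 0] by simp
  have Sb: "norm (S s) \<le> C * (LBINT p. norm (f p))" if "s \<ge> \<epsilon>\<^sup>2" for s
  proof -
    have "norm (S s) \<le> (LBINT p. norm (of_real (mehler lam s \<xi> (fst p)) * (f p * cis (lam * snd p))))"
      unfolding S_def by (rule integral_norm_bound)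
    also have "\<dots> \<le> (LBINT p. C * norm (f p))"
      using f C0 kb[OF that] by (intro integral_mono') (auto simp: norm_mult intro!: mult_right_mono)
    finally have "norm (S s) \<le> (LBINT p. C * norm (f p))" .
    then show ?thesis by simp
  qed
  have "hermite_truncated_integral \<epsilon> lam (fourier_eta lam f) \<xi> =
      (LINT s:{\<epsilon>\<^sup>2..1 / \<epsilon>\<^sup>2}|lborel. S s * of_real (s powr (-1/2)))"
    unfolding hermite_truncated_integral_def
    by (rule set_lebesgue_integral_cong) (auto simp: S_def hermite_semigroup_fourier_eta[OF lam])
  also have "\<dots> = (LINT r:annulus \<epsilon>|lborel. S (r\<^sup>2))"
  proof (rule annulus_substitution[OF \<epsilon>])
    show "set_integrable lborel {\<epsilon>\<^sup>2..1 / \<epsilon>\<^sup>2} (\<lambda>s. S s * complex_of_real (s powr (- 1 / 2)))"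
      unfolding set_integrable_def
    proof (rule integrable_dominated)
      let ?K = "C * (LBINT p. norm (f p)) * (\<epsilon>\<^sup>2) powr (-1/2)"
      show "integrable lborel (\<lambda>s. indicator {\<epsilon>\<^sup>2..1 / \<epsilon>\<^sup>2} s * ?K)"
        by (intro integrable_mult_left integrable_real_indicator) (auto simp: emeasure_lborel_Icc_eq)
      have "norm (S s * complex_of_real (s powr (- 1 / 2))) \<le> ?K" if "s \<ge> \<epsilon>\<^sup>2" for s
        using Sb[OF that] that \<epsilon> C0 powr_mono2'[of "- (1/2)" "\<epsilon>\<^sup>2" s]
        by (auto simp: norm_mult intro!: mult_mono)
      then show "norm (indicator {\<epsilon>\<^sup>2..1 / \<epsilon>\<^sup>2} s *\<^sub>R (S s * complex_of_real (s powr (- 1 / 2)))) \<le> indicator {\<epsilon>\<^sup>2..1 / \<epsilon>\<^sup>2} s * ?K" for s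
        by (auto simp: indicator_def)
    qed measurable
  qed
  also have "\<dots> = (LBINT r. LBINT p. of_real (indicator (annulus \<epsilon>) r * mehler lam (r\<^sup>2) \<xi> (fst p)) * (f p * cis (lam * snd p)))"
    unfolding set_lebesgue_integral_def S_def by (simp add: scaleR_conv_of_real mult.assoc)
  also have "\<dots> = (LBINT q. of_real (indicator (annulus \<epsilon>) (fst q) * mehler lam ((fst q)\<^sup>2) \<xi> (fst (snd q)))
       * (f (snd q) * cis (lam * snd (snd q))))"
  proof -
    have "integrable (lborel \<Otimes>\<^sub>M lborel) (\<lambda>q::real \<times> ((real^'n) \<times> real).
       of_real (indicator (annulus \<epsilon>) (fst q) * mehler lam ((fst q)\<^sup>2) \<xi> (fst (snd q)))
       * (f (snd q) * cis (lam * snd (snd q))))"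
      unfolding lborel_prod by (rule integrable_annulus_kernel[where C = C]) (auto intro!: kb annulus_sq)
    from lborel_pair.integral_fst'[OF this]
    show ?thesis by (simp add: lborel_prod)
  qed
  finally show ?thesis .
qed

text \<open>\<open>K h\<close> is the Mehler kernel at the base point moved by \<open>h\<close>
  along axis \<open>j\<close>, and \<open>D h\<close> its derivative. Both are bounded by one
  constant for all \<open>h\<close>, so differentiation under the integral applies.\<close>

lemma ladder_op_truncated_integral:
  assumes lam: "lam \<noteq> 0"
  shows "ladder_op sg lam j (hermite_truncated_integral \<epsilon> lam (fourier_eta lam f)) \<xi> =
    (LBINT q. of_real (indicator (annulus \<epsilon>) (fst q) * mehler_ladder sg j lam ((fst q)\<^sup>2) \<xi> (fst (snd q)))
       * (f (snd q) * cis (lam * snd (snd q))))"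
proof -
  obtain C where C: "\<And>s \<xi> \<xi>'. s \<ge> \<epsilon>\<^sup>2 \<Longrightarrow> \<bar>mehler lam s \<xi> (\<xi>' :: real^'n)\<bar> \<le> C"
      "\<And>s \<xi> \<xi>'. s \<ge> \<epsilon>\<^sup>2 \<Longrightarrow> \<bar>mehler_deriv j lam s \<xi> (\<xi>' :: real^'n)\<bar> \<le> C"
    using mehler_bounds[OF lam, of j] by blast
  let ?T = "\<lambda>k q. complex_of_real (indicator (annulus \<epsilon>) (fst q) * k (fst q) (fst (snd q))) * (f (snd q) * cis (lam * snd (snd q)))"
  define K where "K h r x = mehler lam (r\<^sup>2) (\<xi> + h *\<^sub>R axis j 1) x" for h r x
  define D where "D h r x = mehler_deriv j lam (r\<^sup>2) (\<xi> + h *\<^sub>R axis j 1) x" for h r x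
  have Kb: "\<bar>K h r x\<bar> \<le> C" and Db: "\<bar>D h r x\<bar> \<le> C" if "r \<in> annulus \<epsilon>" for h r x
    unfolding K_def D_def by (intro C annulus_sq that)+
  have [measurable]: "(\<lambda>q. K h (fst q) (fst (snd q))) \<in> borel_measurable (borel :: (real \<times> ((real^'n) \<times> real)) measure)"
    "(\<lambda>q. D h (fst q) (fst (snd q))) \<in> borel_measurable (borel :: (real \<times> ((real^'n) \<times> real)) measure)" for h
    unfolding K_def D_def by measurable
  have "((\<lambda>h. LBINT q. ?T (K h) q) has_vector_derivative (LBINT q. ?T (D 0) q)) (at 0)"
  proof (rule has_vector_derivative_lebesgue_integral[where B = "\<lambda>q. indicator (annulus \<epsilon>) (fst q) * (C * norm (f (snd q)))"])
    show "integrable lborel (?T (K s))" for s by (rule integrable_annulus_kernel[OF _ Kb]) measurable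
    show "((\<lambda>s. ?T (K s) q) has_vector_derivative ?T (D s) q) (at s)" for s q
    proof -
      have "((\<lambda>x. indicator (annulus \<epsilon>) (fst q) * K x (fst q) (fst (snd q))) has_real_derivative
         indicator (annulus \<epsilon>) (fst q) * D s (fst q) (fst (snd q))) (at s)"
        unfolding K_def D_def
        by (intro DERIV_cmult mehler_has_derivative)
      then show ?thesis by (intro has_vector_derivative_mult_left has_vector_derivative_of_real)
    qed
    show "integrable lborel (\<lambda>q. indicator (annulus \<epsilon>) (fst q) * (C * norm (f (snd q))))"
      by (rule integrable_annulus_times)
    show "norm (?T (D s) q) \<le> indicator (annulus \<epsilon>) (fst q) * (C * norm (f (snd q)))" for s q
      by (auto simp: norm_mult indicator_def intro!: mult_right_mono Db)
  qed measurable
  then have part: "partial_at j (hermite_truncated_integral \<epsilon> lam (fourier_eta lam f)) \<xi> = (LBINT q. ?T (D 0) q)"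
    unfolding partial_at_def hermite_truncated_integral_eq[OF lam] K_def by (rule vector_derivative_at)
  have i: "integrable lborel (?T (K 0))" "integrable lborel (?T (D 0))"
    by (rule integrable_annulus_kernel[OF _ Kb] integrable_annulus_kernel[OF _ Db]; measurable)+
  have "ladder_op sg lam j (hermite_truncated_integral \<epsilon> lam (fourier_eta lam f)) \<xi> =
     - of_real sg * (LBINT q. ?T (D 0) q) + of_real (lam * \<xi> $ j) * (LBINT q. ?T (K 0) q)"
    unfolding ladder_op_def part hermite_truncated_integral_eq[OF lam] by (simp add: K_def)
  also have "\<dots> = (LBINT q. - of_real sg * ?T (D 0) q + of_real (lam * \<xi> $ j) * ?T (K 0) q)"
    using i by simp
  also have "(\<lambda>q. - of_real sg * ?T (D 0) q + of_real (lam * \<xi> $ j) * ?T (K 0) q) =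
    (\<lambda>q. of_real (indicator (annulus \<epsilon>) (fst q) * mehler_ladder sg j lam ((fst q)\<^sup>2) \<xi> (fst (snd q)))
       * (f (snd q) * cis (lam * snd (snd q))))"
    by (simp add: fun_eq_iff mehler_ladder_def K_def D_def algebra_simps)
  finally show ?thesis .
qed

text \<open>Fubini moves the \<open>lam\<close>-integral inside, where it becomes
  \<open>ladder_kernel\<close>. The majorant is a product: \<open>mehler_factor_decay\<close>
  handles \<open>lam\<close>, the truncation handles the radius and \<open>f\<close> the
  rest.\<close>

lemma riesz_eq_ladder_kernel:
  assumes sg: "\<bar>sg\<bar> = 1"
  shows "of_real (1 / (2 * pi)) * (LBINT lam. cis (- (lam * \<eta>)) * (of_real (1 / sqrt pi) *
      ladder_op sg lam j (hermite_truncated_integral \<epsilon> lam (fourier_eta lam f)) \<xi>)) =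
    of_real (1 / sqrt pi) * (LBINT r. of_real (indicator (annulus \<epsilon>) r) *
      (of_real (1 / (2 * pi)) * (LBINT p. f p * ladder_kernel sg j \<xi> (r\<^sup>2) (fst p) (\<eta> - snd p))))"
proof -
  let ?k = "\<lambda>lam (q :: real \<times> ((real^'n) \<times> real)). indicator (annulus \<epsilon>) (fst q) * mehler_ladder sg j lam ((fst q)\<^sup>2) \<xi> (fst (snd q))"
  define W where "W lam q = cis (- (lam * \<eta>)) * (of_real (?k lam q) * (f (snd q) * cis (lam * snd (snd q))))" for lam q
  have [measurable]: "case_prod W \<in> borel_measurable (borel \<Otimes>\<^sub>M borel)" unfolding W_def by measurable
  obtain C where C: "\<And>lam s. s \<ge> \<epsilon>\<^sup>2 \<Longrightarrow> (1 + \<bar>lam\<bar>) * mehler_factor lam s ^ CARD('n) \<le> C / (1 + lam\<^sup>2)"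
    using mehler_factor_decay[of "\<epsilon>\<^sup>2" "CARD('n)"] \<epsilon> by auto
  \<comment> \<open>Bounds the time-dependent prefactor in \<open>mehler_ladder_bound\<close>, where
    the time is at least \<open>\<epsilon>\<^sup>2\<close>.\<close>
  define D where "D = 1 + 1 / \<epsilon>\<^sup>2 + \<bar>\<xi> $ j\<bar>"
  have kb: "\<bar>?k lam q\<bar> \<le> C / (1 + lam\<^sup>2) * (indicator (annulus \<epsilon>) (fst q) * D)" for lam q
  proof (cases "fst q \<in> annulus \<epsilon>")
    case True
    then have r: "(fst q)\<^sup>2 \<ge> \<epsilon>\<^sup>2" "(fst q)\<^sup>2 > 0" using annulus_sq[OF True] \<epsilon> by (auto intro: less_le_trans[of 0 "\<epsilon>\<^sup>2"])
    have "\<bar>mehler_ladder sg j lam ((fst q)\<^sup>2) \<xi> (fst (snd q))\<bar> \<le>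
       (1 + 1 / (fst q)\<^sup>2 + \<bar>\<xi> $ j\<bar>) * ((1 + \<bar>lam\<bar>) * mehler_factor lam ((fst q)\<^sup>2) ^ CARD('n))"
      by (rule mehler_ladder_bound[OF r(2) sg])
    also have "\<dots> \<le> D * (C / (1 + lam\<^sup>2))"
      unfolding D_def using r \<epsilon>
      by (intro mult_mono C add_mono divide_left_mono) (auto intro!: mult_nonneg_nonneg mehler_factor_nonneg add_nonneg_nonneg intro: zero_le_power)
    finally show ?thesis using True by (simp add: mult.commute)
  qed simp
  have Wint: "integrable (lborel \<Otimes>\<^sub>M lborel) (case_prod W)"
  proof (rule integrable_pair_dominated[OF integrable_div_one_plus_square integrable_annulus_times])
    fix lam and q :: "real \<times> ((real^'n) \<times> real)"
    have "norm (W lam q) = \<bar>?k lam q\<bar> * norm (f (snd q))"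
      by (simp add: W_def norm_mult abs_mult)
    also have "\<dots> \<le> C / (1 + lam\<^sup>2) * (indicator (annulus \<epsilon>) (fst q) * D) * norm (f (snd q))"
      by (intro mult_right_mono kb) auto
    finally show "norm (W lam q) \<le> C / (1 + lam\<^sup>2) * (indicator (annulus \<epsilon>) (fst q) * (D * norm (f (snd q))))"
      by (simp only: mult.assoc)
  qed measurable
  have Weq: "(LBINT lam. W lam q) = of_real (indicator (annulus \<epsilon>) (fst q)) *
      (f (snd q) * ladder_kernel sg j \<xi> ((fst q)\<^sup>2) (fst (snd q)) (\<eta> - snd (snd q)))" for q
  proof -
    have "W lam q = of_real (indicator (annulus \<epsilon>) (fst q)) * (f (snd q) *
        (cis (- (lam * (\<eta> - snd (snd q)))) * of_real (mehler_ladder sg j lam ((fst q)\<^sup>2) \<xi> (fst (snd q)))))" for lam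
    proof -
      have "cis (- (lam * (\<eta> - snd (snd q)))) = cis (- (lam * \<eta>)) * cis (lam * snd (snd q))"
        by (simp add: cis_mult algebra_simps)
      then show ?thesis by (simp add: W_def mult_ac)
    qed
    then show ?thesis
      unfolding ladder_kernel_def by simp
  qed
  have "(LBINT lam. cis (- (lam * \<eta>)) * (of_real (1 / sqrt pi) *
      ladder_op sg lam j (hermite_truncated_integral \<epsilon> lam (fourier_eta lam f)) \<xi>)) =
     (LBINT lam. of_real (1 / sqrt pi) * (LBINT q. W lam q))"
  proof (rule integral_eq_except_point[where c = "0::real"])
    fix lam :: real assume "lam \<noteq> 0"
    then show "cis (- (lam * \<eta>)) * (of_real (1 / sqrt pi) *
      ladder_op sg lam j (hermite_truncated_integral \<epsilon> lam (fourier_eta lam f)) \<xi>) = of_real (1 / sqrt pi) * (LBINT q. W lam q)"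
      unfolding ladder_op_truncated_integral[OF \<open>lam \<noteq> 0\<close>] W_def integral_mult_right_zero by (simp only: mult.left_commute)
  qed measurable
  also have "\<dots> = of_real (1 / sqrt pi) * (LBINT q. LBINT lam. W lam q)"
    unfolding integral_mult_right_zero lborel_pair.Fubini_integral[OF Wint] ..
  also have "(LBINT q. LBINT lam. W lam q) = (LBINT q. of_real (indicator (annulus \<epsilon>) (fst q)) *
      (f (snd q) * ladder_kernel sg j \<xi> ((fst q)\<^sup>2) (fst (snd q)) (\<eta> - snd (snd q))))"
    by (simp only: Weq)
  also have "\<dots> = (LBINT r. LBINT p. of_real (indicator (annulus \<epsilon>) r) *
      (f p * ladder_kernel sg j \<xi> (r\<^sup>2) (fst p) (\<eta> - snd p)))"
  proof -
    have "integrable (lborel \<Otimes>\<^sub>M lborel) (\<lambda>q::real \<times> ((real^'n) \<times> real). of_real (indicator (annulus \<epsilon>) (fst q)) *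
      (f (snd q) * ladder_kernel sg j \<xi> ((fst q)\<^sup>2) (fst (snd q)) (\<eta> - snd (snd q))))"
      using lborel_pair.integrable_snd[OF Wint] unfolding Weq lborel_prod .
    from lborel_pair.integral_fst'[OF this]
    show ?thesis by (simp add: lborel_prod)
  qed
  finally show ?thesis by simp
qed

end

subsection \<open>The Heisenberg heat kernel\<close>

text \<open>\<open>g\<close> need not be bounded, so the line is split at distance 1 from
  \<open>t\<close>. Near \<open>t\<close> a rescaling to unit width uses boundedness of
  \<open>g\<close> on a compact interval; far away the weight tends to 0 uniformly and
  \<open>norm (g u)\<close> is the majorant.\<close>

lemma gaussian_approximate_identity:
  fixes g :: "real \<Rightarrow> complex"
  assumes g: "integrable lborel g" and cont: "continuous_on UNIV g"
  shows "(\<lambda>N. LBINT u. g u * of_real (real (Suc N) * exp (- (real (Suc N))\<^sup>2 * (u - t)\<^sup>2)))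
     \<longlonglongrightarrow> of_real (sqrt pi) * g t"
proof -
  let ?n = "\<lambda>N. real (Suc N)"
  have [measurable]: "g \<in> borel_measurable borel" using g by auto
  let ?w = "\<lambda>N u. complex_of_real (?n N * exp (- (?n N)\<^sup>2 * (u - t)\<^sup>2))"
  let ?near = "\<lambda>N u. indicator {t - 1..t + 1} u *\<^sub>R (g u * ?w N u)"
  let ?far = "\<lambda>N u. indicator (- {t - 1..t + 1}) u *\<^sub>R (g u * ?w N u)"
  \<comment> \<open>This makes the far weights at most 1, so that the norm of \<open>g\<close>
    itself dominates.\<close>
  have nb: "?n N * exp (- (?n N)\<^sup>2) \<le> 1" for N
  proof -
    have "?n N \<le> 1 + (?n N)\<^sup>2" using zero_le_power2[of "?n N - 1/2"] by (simp add: power2_eq_square algebra_simps)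
    also have "\<dots> \<le> exp ((?n N)\<^sup>2)" by (rule exp_ge_add_one_self)
    finally show ?thesis by (simp add: exp_minus field_simps)
  qed
  have w_le: "norm (?w N u) \<le> ?n N" for N u
    by (simp only: norm_of_real) (simp add: abs_mult mult_left_le)
  have gw: "integrable lborel (\<lambda>u. g u * ?w N u)" for N
    by (rule integrable_dominated[OF integrable_mult_left[OF integrable_norm[OF g], of "?n N"]])
      (use w_le in \<open>auto simp: norm_mult intro!: mult_left_mono simp del: of_nat_Suc\<close>)
  have i_near: "integrable lborel (?near N)" and i_far: "integrable lborel (?far N)" for N
    using gw[of N] by (intro integrable_mult_indicator; simp)+
  have far: "(\<lambda>N. LBINT u. ?far N u) \<longlonglongrightarrow> (LINT u|(lborel :: real measure). 0)"
  proof (rule integral_dominated_convergence[where w = "\<lambda>u. norm (g u)"])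
    have le: "norm (?far N u) \<le> norm (g u) * (?n N * exp (- (?n N)\<^sup>2))" for N u
    proof (cases "u \<in> {t - 1..t + 1}")
      case False
      then have "1 \<le> \<bar>u - t\<bar>" by auto
      then have "1 \<le> (u - t)\<^sup>2" using one_le_power[of "\<bar>u - t\<bar>" 2] by simp
      then have "(?n N)\<^sup>2 * 1 \<le> (?n N)\<^sup>2 * (u - t)\<^sup>2" by (intro mult_left_mono) auto
      then have "norm (?w N u) \<le> ?n N * exp (- (?n N)\<^sup>2)"
        by (simp only: norm_of_real) (simp add: abs_mult)
      then have "norm (g u) * norm (?w N u) \<le> norm (g u) * (?n N * exp (- (?n N)\<^sup>2))"
        by (rule mult_left_mono) simp
      moreover have "?far N u = g u * ?w N u" using False by simp
      ultimately show ?thesis by (simp only: norm_mult)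
    qed simp
    show "AE u in lborel. norm (?far N u) \<le> norm (g u)" for N
      by (intro AE_I2 order_trans[OF le mult_left_le[OF nb norm_ge_zero]])
    have lim: "(\<lambda>N. norm (g u) * (?n N * exp (- (?n N)\<^sup>2))) \<longlonglongrightarrow> 0" for u
      by (intro tendsto_mult_right_zero) real_asymp
    show "AE u in lborel. (\<lambda>N. ?far N u) \<longlonglongrightarrow> 0"
      by (intro AE_I2 Lim_null_comparison[OF always_eventually[OF allI[OF le]] lim])
  qed (use g in auto)
  have near_eq: "(LBINT u. ?near N u) = (LBINT v. indicator {- ?n N..?n N} v *\<^sub>R (g (t + v / ?n N) * of_real (exp (- v\<^sup>2))))" for N
  proof -
    have "(LBINT u. ?near N u) = \<bar>1 / ?n N\<bar> *\<^sub>R (LBINT v. ?near N (t + (1 / ?n N) * v))"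
      by (rule lborel_integral_real_affine) simp
    also have "\<dots> = (LBINT v. (1 / ?n N) *\<^sub>R ?near N (t + (1 / ?n N) * v))"
      unfolding integral_scaleR_right by simp
    also have "(\<lambda>v. (1 / ?n N) *\<^sub>R ?near N (t + (1 / ?n N) * v)) =
        (\<lambda>v. indicator {- ?n N..?n N} v *\<^sub>R (g (t + v / ?n N) * of_real (exp (- v\<^sup>2))))"
    proof
      fix v
      have "?n N > 0" by simp
      then have "t + (1 / ?n N) * v \<in> {t - 1..t + 1} \<longleftrightarrow> v \<in> {- ?n N..?n N}"
        and "(?n N)\<^sup>2 * (v / ?n N)\<^sup>2 = v\<^sup>2"
        by (auto simp: le_divide_eq divide_le_eq power_divide field_simps simp del: of_nat_Suc)
      then show "(1 / ?n N) *\<^sub>R ?near N (t + (1 / ?n N) * v) = indicator {- ?n N..?n N} v *\<^sub>R (g (t + v / ?n N) * of_real (exp (- v\<^sup>2)))"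
        by (simp add: indicator_def scaleR_conv_of_real del: of_nat_Suc)
    qed
    finally show ?thesis .
  qed
  obtain M where M: "\<And>u. u \<in> {t - 1..t + 1} \<Longrightarrow> norm (g u) \<le> M"
  proof -
    have "compact (g ` {t - 1..t + 1})"
      by (rule compact_continuous_image[OF continuous_on_subset[OF cont]]) auto
    then obtain M where "\<forall>x\<in>g ` {t - 1..t + 1}. norm x \<le> M"
      using compact_imp_bounded bounded_iff by metis
    then show ?thesis by (intro that[of M]) blast
  qed
  have near: "(\<lambda>N. LBINT u. ?near N u) \<longlonglongrightarrow> (LBINT v. g t * of_real (exp (- v\<^sup>2)))"
    unfolding near_eq
  proof (rule integral_dominated_convergence[where w = "\<lambda>v. M * exp (- 1 * v\<^sup>2)"])
    show "integrable lborel (\<lambda>v. M * exp (- 1 * v\<^sup>2))" by (intro integrable_mult_right integrable_gaussian) simp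
    show "AE v in lborel. norm (indicator {- ?n N..?n N} v *\<^sub>R (g (t + v / ?n N) * of_real (exp (- v\<^sup>2)))) \<le> M * exp (- 1 * v\<^sup>2)" for N
    proof (rule AE_I2)
      fix v
      have "v \<in> {- ?n N..?n N} \<Longrightarrow> norm (g (t + v / ?n N)) \<le> M"
        by (rule M) (auto simp: le_divide_eq divide_le_eq field_simps simp del: of_nat_Suc)
      moreover have "0 \<le> M" by (rule order_trans[OF norm_ge_zero M[of t]]) simp
      ultimately show "norm (indicator {- ?n N..?n N} v *\<^sub>R (g (t + v / ?n N) * of_real (exp (- v\<^sup>2)))) \<le> M * exp (- 1 * v\<^sup>2)"
        by (auto simp: norm_mult indicator_def intro!: mult_right_mono)
    qed
    show "AE v in lborel. (\<lambda>N. indicator {- ?n N..?n N} v *\<^sub>R (g (t + v / ?n N) * of_real (exp (- v\<^sup>2)))) \<longlonglongrightarrow> g t * of_real (exp (- v\<^sup>2))"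
    proof (rule AE_I2)
      fix v :: real
      have "(\<lambda>N. t + v / ?n N) \<longlonglongrightarrow> t" by real_asymp
      then have "(\<lambda>N. g (t + v / ?n N)) \<longlonglongrightarrow> g t"
        using cont by (intro continuous_on_tendsto_compose[where s = UNIV and f = g]) auto
      then have lim: "(\<lambda>N. g (t + v / ?n N) * of_real (exp (- v\<^sup>2))) \<longlonglongrightarrow> g t * of_real (exp (- v\<^sup>2))"
        by (intro tendsto_intros)
      obtain N0 :: nat where N0: "\<bar>v\<bar> \<le> real N0" using real_arch_simple by blast
      have "eventually (\<lambda>N. indicator {- ?n N..?n N} v *\<^sub>R (g (t + v / ?n N) * of_real (exp (- v\<^sup>2))) = g (t + v / ?n N) * of_real (exp (- v\<^sup>2))) sequentially"
        using eventually_ge_at_top[of N0] by eventually_elim (use N0 in \<open>auto simp: indicator_def abs_le_iff\<close>)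
      then show "(\<lambda>N. indicator {- ?n N..?n N} v *\<^sub>R (g (t + v / ?n N) * of_real (exp (- v\<^sup>2)))) \<longlonglongrightarrow> g t * of_real (exp (- v\<^sup>2))"
        using lim by (simp only: tendsto_cong)
    qed
  qed measurable
  have total: "(LBINT v. g t * of_real (exp (- v\<^sup>2))) = of_real (sqrt pi) * g t"
    using gaussian_fourier[of 1 0] by simp
  have split: "(LBINT u. g u * ?w N u) = (LBINT u. ?near N u) + (LBINT u. ?far N u)" for N
  proof -
    have "(LBINT u. g u * ?w N u) = (LBINT u. ?near N u + ?far N u)"
      by (intro Bochner_Integration.integral_cong refl) (auto simp: indicator_def)
    then show ?thesis using i_near i_far by simp
  qed
  show ?thesis
    using tendsto_add[OF near far] by (simp only: total split integral_zero add_0_right)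
qed

text \<open>A Gaussian weight in \<open>lam\<close> makes the double integral absolutely convergent.
  Removing the weight in the limit gives the inversion integral on one side and the approximate
  identity on the other. Since \<open>g\<close> is continuous, the identity holds at every
  \<open>t\<close>.\<close>

lemma fourier_inversion:
  fixes g Q :: "real \<Rightarrow> complex"
  assumes g: "integrable lborel g" and cont: "continuous_on UNIV g" and Q: "integrable lborel Q"
    and gQ: "\<And>lam. lam \<noteq> 0 \<Longrightarrow> (LBINT u. g u * cis (lam * u)) = Q lam"
  shows "g t = of_real (1 / (2 * pi)) * (LBINT lam. Q lam * cis (- (lam * t)))"
proof -
  let ?n = "\<lambda>N. real (Suc N)"
  have [measurable]: "g \<in> borel_measurable borel" "Q \<in> borel_measurable borel" using g Q by auto
  \<comment> \<open>With this width the transform of the weight is, up to the constant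
    \<open>2 * sqrt pi\<close>, the kernel of \<open>gaussian_approximate_identity\<close>.\<close>
  define a where "a N = 1 / (4 * (?n N)\<^sup>2)" for N
  have a: "a N > 0" for N by (simp add: a_def)
  have eq: "(LBINT lam. Q lam * cis (- (lam * t)) * of_real (exp (- a N * lam\<^sup>2)))
     = of_real (2 * sqrt pi) * (LBINT u. g u * of_real (?n N * exp (- (?n N)\<^sup>2 * (u - t)\<^sup>2)))" for N
  proof -
    define W where "W lam u = of_real (exp (- a N * lam\<^sup>2)) * (g u * cis (lam * (u - t)))" for lam u
    have Wint: "integrable (lborel \<Otimes>\<^sub>M lborel) (case_prod W)"
      by (rule integrable_pair_dominated[OF integrable_gaussian[OF a[of N]] integrable_norm[OF g]])
        (unfold W_def, measurable, simp add: norm_mult)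
    have "(LBINT lam. Q lam * cis (- (lam * t)) * of_real (exp (- a N * lam\<^sup>2))) = (LBINT lam. LBINT u. W lam u)"
    proof (rule integral_eq_except_point[where c = "0 :: real"])
      fix lam :: real assume "lam \<noteq> 0"
      have "W lam u = (of_real (exp (- a N * lam\<^sup>2)) * cis (- (lam * t))) * (g u * cis (lam * u))" for u
      proof -
        have "cis (lam * (u - t)) = cis (- (lam * t)) * cis (lam * u)" by (simp add: cis_mult algebra_simps)
        then show ?thesis by (simp add: W_def mult_ac)
      qed
      then have "(LBINT u. W lam u) = (of_real (exp (- a N * lam\<^sup>2)) * cis (- (lam * t))) * Q lam"
        by (simp only: integral_mult_right_zero gQ[OF \<open>lam \<noteq> 0\<close>])
      then show "Q lam * cis (- (lam * t)) * of_real (exp (- a N * lam\<^sup>2)) = (LBINT u. W lam u)" by (simp add: mult_ac)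
    qed (unfold W_def, measurable)
    also have "\<dots> = (LBINT u. LBINT lam. W lam u)"
      by (rule lborel_pair.Fubini_integral[OF Wint, symmetric])
    also have "\<dots> = (LBINT u. of_real (2 * sqrt pi) * (g u * of_real (?n N * exp (- (?n N)\<^sup>2 * (u - t)\<^sup>2))))"
    proof (rule Bochner_Integration.integral_cong[OF refl])
      fix u
      have "W lam u = g u * (cis ((u - t) * lam) * of_real (exp (- a N * lam\<^sup>2)))" for lam
        by (simp add: W_def mult_ac)
      then have "(LBINT lam. W lam u) = g u * of_real (sqrt (pi / a N) * exp (- (u - t)\<^sup>2 / (4 * a N)))"
        by (simp only: integral_mult_right_zero gaussian_fourier[OF a])
      also have "sqrt (pi / a N) = 2 * sqrt pi * ?n N"
        by (simp add: a_def real_sqrt_mult del: of_nat_Suc)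
      also have "- (u - t)\<^sup>2 / (4 * a N) = - (?n N)\<^sup>2 * (u - t)\<^sup>2"
        by (simp add: a_def del: of_nat_Suc)
      finally show "(LBINT lam. W lam u) = of_real (2 * sqrt pi) * (g u * of_real (?n N * exp (- (?n N)\<^sup>2 * (u - t)\<^sup>2)))"
        by (simp add: mult_ac)
    qed
    finally show ?thesis by simp
  qed
  have "(\<lambda>N. LBINT lam. Q lam * cis (- (lam * t)) * of_real (exp (- a N * lam\<^sup>2))) \<longlonglongrightarrow> (LBINT lam. Q lam * cis (- (lam * t)))"
  proof (rule integral_dominated_convergence[where w = "\<lambda>lam. norm (Q lam)"])
    show "AE lam in lborel. (\<lambda>N. Q lam * cis (- (lam * t)) * of_real (exp (- a N * lam\<^sup>2))) \<longlonglongrightarrow> Q lam * cis (- (lam * t))"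
    proof (rule AE_I2)
      fix lam :: real
      have "(\<lambda>N. exp (- a N * lam\<^sup>2)) \<longlonglongrightarrow> 1" unfolding a_def by real_asymp
      then have "(\<lambda>N. Q lam * cis (- (lam * t)) * of_real (exp (- a N * lam\<^sup>2))) \<longlonglongrightarrow> Q lam * cis (- (lam * t)) * of_real 1"
        by (intro tendsto_intros)
      then show "(\<lambda>N. Q lam * cis (- (lam * t)) * of_real (exp (- a N * lam\<^sup>2))) \<longlonglongrightarrow> Q lam * cis (- (lam * t))" by simp
    qed
    show "AE lam in lborel. norm (Q lam * cis (- (lam * t)) * of_real (exp (- a N * lam\<^sup>2))) \<le> norm (Q lam)" for N
      using a[of N] by (intro AE_I2) (auto simp: norm_mult intro!: mult_left_le)
    show "integrable lborel (\<lambda>lam. norm (Q lam))" using Q by simp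
  qed measurable
  moreover have "(\<lambda>N. LBINT lam. Q lam * cis (- (lam * t)) * of_real (exp (- a N * lam\<^sup>2))) \<longlonglongrightarrow> of_real (2 * sqrt pi) * (of_real (sqrt pi) * g t)"
    unfolding eq by (intro tendsto_mult_left gaussian_approximate_identity g cont)
  ultimately have "(LBINT lam. Q lam * cis (- (lam * t))) = of_real (2 * sqrt pi) * (of_real (sqrt pi) * g t)"
    by (rule LIMSEQ_unique)
  also have "\<dots> = of_real (2 * (sqrt pi * sqrt pi)) * g t" by (simp only: of_real_mult mult.assoc)
  finally show ?thesis by simp
qed

section \<open>The time-one heat kernel through its central Fourier transform\<close>

definition heat_factor :: "nat \<Rightarrow> real \<Rightarrow> real" where
  "heat_factor n lam = (lam / sinh lam) ^ n / (4 * pi) ^ n"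

text \<open>The argument \<open>\<rho>\<close> stands for the squared norm of z. As z enters in no
  other way, derivatives in z reduce to a chain rule in \<open>\<rho>\<close>.\<close>

definition heat_ft :: "nat \<Rightarrow> real \<Rightarrow> real \<Rightarrow> real" where
  "heat_ft n \<rho> lam = heat_factor n lam * exp (- (cothl lam 1 * \<rho>) / 4)"

lemma borel_measurable_heat_factor [measurable]:
  assumes [measurable]: "f \<in> borel_measurable M"
  shows "(\<lambda>x. heat_factor n (f x)) \<in> borel_measurable M"
  unfolding heat_factor_def by measurable

lemma borel_measurable_heat_ft [measurable]:
  assumes [measurable]: "f \<in> borel_measurable M" "g \<in> borel_measurable M"
  shows "(\<lambda>x. heat_ft n (g x) (f x)) \<in> borel_measurable M"
  unfolding heat_ft_def by measurable

lemma heat_factor_nonneg: "0 \<le> heat_factor n lam"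
  unfolding heat_factor_def using zero_le_power[OF div_sinh_nonneg[of 1 lam], of n] by simp

lemma heat_factor_0 [simp]: "n > 0 \<Longrightarrow> heat_factor n 0 = 0"
  by (simp add: heat_factor_def)

text \<open>At time 1/2 the squared Mehler factor is \<open>lam / sinh lam / (2 * pi)\<close>, so
  the heat factor is a multiple of its power \<open>2 * n\<close> and inherits the decay.\<close>

lemma heat_factor_decay:
  assumes "n > 0"
  shows "\<exists>C. \<forall>lam. (1 + \<bar>lam\<bar>) * heat_factor n lam \<le> C / (1 + lam\<^sup>2)"
proof -
  obtain C where C: "\<And>lam s. s \<ge> 1/2 \<Longrightarrow> (1 + \<bar>lam\<bar>) * mehler_factor lam s ^ (2 * n) \<le> C / (1 + lam\<^sup>2)"
    using mehler_factor_decay[of "1/2" "2 * n"] assms by auto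
  have e: "heat_factor n lam = (1/2) ^ n * mehler_factor lam (1/2) ^ (2 * n)" for lam
  proof -
    have "(mehler_factor lam (1/2))\<^sup>2 = lam / sinh lam / (2 * pi)"
    proof -
      have "lam / (2 * pi * sinh (2 * lam * (1/2))) = lam / sinh lam / (2 * pi)" by simp
      moreover have "0 \<le> lam / sinh lam / (2 * pi)"
        by (rule divide_nonneg_nonneg) (use div_sinh_nonneg[of 1 lam] in simp_all)
      ultimately show ?thesis unfolding mehler_factor_def by (simp only: real_sqrt_pow2)
    qed
    then show ?thesis
      by (simp add: heat_factor_def power_mult power_divide power_mult_distrib)
        (simp add: power_mult_distrib[symmetric])
  qed
  show ?thesis
  proof (rule exI, rule allI)
    fix lam
    show "(1 + \<bar>lam\<bar>) * heat_factor n lam \<le> ((1/2) ^ n * C) / (1 + lam\<^sup>2)"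
      using mult_left_mono[OF C[of "1/2" lam], of "(1/2) ^ n"] by (simp add: e mult_ac)
  qed
qed

lemma integrable_heat_factor:
  assumes "n > 0"
  shows "integrable lborel (\<lambda>lam. (1 + \<bar>lam\<bar>) * heat_factor n lam)"
proof -
  obtain C where "\<And>lam. (1 + \<bar>lam\<bar>) * heat_factor n lam \<le> C / (1 + lam\<^sup>2)"
    using heat_factor_decay[OF assms] by blast
  then show ?thesis
    by (intro integrable_dominated[OF integrable_div_one_plus_square[of C]]) (auto simp: abs_mult heat_factor_nonneg)
qed

text \<open>For \<open>lam \<noteq> 0\<close> one has \<open>cothl lam 1 \<ge> 1\<close>, which
  leaves a Gaussian in z that does not depend on \<open>lam\<close>.\<close>

lemma heat_ft_bound:
  assumes "\<rho> \<ge> 0"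
  shows "\<bar>heat_ft CARD('n::finite) \<rho> lam\<bar> \<le> heat_factor CARD('n) lam * exp (- \<rho> / 4)"
proof (cases "lam = 0")
  case False
  have "1 * \<rho> \<le> cothl lam 1 * \<rho>" using cothl_bounds(1)[OF False, of 1] assms by (intro mult_right_mono) auto
  then show ?thesis unfolding heat_ft_def
    by (simp add: abs_mult heat_factor_nonneg mult_left_mono)
qed (simp add: heat_ft_def)

lemma heat_ft_cothl_bound:
  assumes "\<rho> \<ge> 0"
  shows "\<bar>cothl lam 1 * heat_ft CARD('n::finite) \<rho> lam\<bar> \<le> (1 + \<bar>lam\<bar>) * heat_factor CARD('n) lam * exp (- \<rho> / 4)"
proof (cases "lam = 0")
  case False
  have "\<bar>cothl lam 1\<bar> \<le> 1 + \<bar>lam\<bar>" using cothl_bounds[OF False, of 1] by auto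
  then have "\<bar>cothl lam 1\<bar> * \<bar>heat_ft CARD('n) \<rho> lam\<bar> \<le> (1 + \<bar>lam\<bar>) * (heat_factor CARD('n) lam * exp (- \<rho> / 4))"
    by (intro mult_mono heat_ft_bound assms) auto
  then show ?thesis by (simp add: abs_mult mult.assoc)
qed (simp add: heat_ft_def)

lemma heat_ft_le:
  assumes "\<rho> \<ge> 0"
  shows "\<bar>heat_ft CARD('n::finite) \<rho> lam\<bar> \<le> heat_factor CARD('n) lam"
  using assms by (intro order_trans[OF heat_ft_bound] mult_left_le heat_factor_nonneg) auto

lemma mult_heat_ft_le:
  assumes "\<rho> \<ge> 0"
  shows "\<bar>lam * heat_ft CARD('n::finite) \<rho> lam\<bar> \<le> (1 + \<bar>lam\<bar>) * heat_factor CARD('n) lam"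
  unfolding abs_mult using heat_ft_le[OF assms] by (intro mult_mono) auto

lemma integrable_heat_ft:
  assumes "\<rho> \<ge> 0"
  shows "integrable lborel (heat_ft CARD('n::finite) \<rho>)"
proof (rule integrable_dominated[OF integrable_heat_factor[of "CARD('n)"]])
  show "norm (heat_ft CARD('n) \<rho> lam) \<le> (1 + \<bar>lam\<bar>) * heat_factor CARD('n) lam" for lam
    using heat_ft_le[OF assms, of lam, where ?'n = 'n] by (simp add: distrib_right heat_factor_nonneg add_increasing2)
qed simp_all

text \<open>On the right stand the two fields with the derivatives already evaluated:
  \<open>A\<close> comes from differentiating in x and y, and \<open>- \<i> * B\<close> from
  differentiating in t. Because \<open>S\<close> squares to 1, the four terms factor.\<close>

lemma sign_identity:
  fixes A B S X Y :: complex
  assumes "S * S = 1"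
  shows "- (1/2) * (\<i> * X + S * Y) * (A + S * B) =
    \<i> * (- (X / 2) * A - Y / 2 * (- \<i> * B)) + S * (- (Y / 2) * A + X / 2 * (- \<i> * B))"
proof -
  have "S * (S * c) = c" for c using assms by (simp flip: mult.assoc)
  then show ?thesis by (simp add: algebra_simps add_divide_distrib diff_divide_distrib)
qed

lemma smooth_continuous: "smooth F \<Longrightarrow> continuous_on UNIV F"
  by (cases rule: smooth.cases, assumption) (simp add: differentiable_imp_continuous_on differentiable_at_withinI differentiable_on_def)

text \<open>What the combination of the tilde fields \<open>\<i> * X + sg * Y\<close> makes of the
  transform of \<open>p 1\<close> at central frequency \<open>lam\<close>; see
  \<open>Z_tilde_heat_kernel\<close>.\<close>

definition heat_multiplier :: "real \<Rightarrow> 'n::finite \<Rightarrow> complex^'n \<Rightarrow> real \<Rightarrow> complex" where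
  "heat_multiplier sg j z lam = - (1/2) * of_real ((cothl lam 1 + sg * lam) * heat_ft CARD('n) ((norm z)\<^sup>2) lam)
     * (\<i> * of_real (Re (z $ j)) + of_real (sg * Im (z $ j)))"

lemma norm_axis_add:
  fixes z :: "complex^'n::finite"
  shows "(norm (z + axis j (of_real s)))\<^sup>2 = (norm z)\<^sup>2 + 2 * s * Re (z $ j) + s\<^sup>2"
    and "(norm (z + axis j (\<i> * of_real s)))\<^sup>2 = (norm z)\<^sup>2 + 2 * s * Im (z $ j) + s\<^sup>2"
  unfolding power2_norm_eq_inner inner_add_left inner_add_right inner_axis inner_axis'
  by (simp_all add: inner_axis inner_commute[of "axis j _"] inner_complex_def axis_def power2_eq_square algebra_simps)

context
  fixes p :: "real \<Rightarrow> 'n::finite heis \<Rightarrow> real"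
  assumes p: "heisenberg_heat_kernel p"
begin

text \<open>Smoothness of \<open>p 1\<close> gives the continuity that Fourier inversion needs, so
  the formula holds at every point and may be differentiated.\<close>

lemma heat_kernel_eq:
  "complex_of_real (p 1 (z, t)) = of_real (1 / (2 * pi)) *
     (LBINT lam. of_real (heat_ft CARD('n) ((norm z)\<^sup>2) lam) * cis (- (lam * t)))"
proof (rule fourier_inversion[where g = "\<lambda>t. complex_of_real (p 1 (z, t))"])
  have 1: "smooth (p 1)" "integrable lborel (\<lambda>t. p 1 (z, t))"
    and ft: "\<And>lam. lam \<noteq> 0 \<Longrightarrow> (LBINT t. of_real (p 1 (z, t)) * cis (lam * t)) =
        complex_of_real ((lam / sinh (lam * 1)) ^ CARD('n) / (4 * pi) ^ CARD('n)
          * exp (- (1/4) * lam * (cosh (1 * lam) / sinh (1 * lam)) * (norm z)\<^sup>2))"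
    using p unfolding heisenberg_heat_kernel_def by auto
  show "integrable lborel (\<lambda>t. complex_of_real (p 1 (z, t)))" using 1(2) by simp
  have "continuous_on UNIV (\<lambda>t. p 1 (z, t))"
    by (rule continuous_on_compose2[OF smooth_continuous[OF 1(1)]]) (auto intro!: continuous_intros)
  then show "continuous_on UNIV (\<lambda>t. complex_of_real (p 1 (z, t)))" by (intro continuous_intros)
  show "integrable lborel (\<lambda>lam. complex_of_real (heat_ft CARD('n) ((norm z)\<^sup>2) lam))"
    using integrable_heat_ft[of "(norm z)\<^sup>2", where ?'n = 'n] by simp
  show "(LBINT u. complex_of_real (p 1 (z, u)) * cis (lam * u)) = complex_of_real (heat_ft CARD('n) ((norm z)\<^sup>2) lam)"
    if "lam \<noteq> 0" for lam
    unfolding ft[OF that] by (simp add: heat_ft_def heat_factor_def cothl_def mult_ac)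
qed

text \<open>Covers the x- and the y-derivative at once: along either axis the squared norm is a
  quadratic of this form, with \<open>b\<close> the real or imaginary part of component
  \<open>j\<close>.\<close>

lemma heat_kernel_path_derivative:
  assumes path: "\<And>s. (norm (c s))\<^sup>2 = (norm z)\<^sup>2 + 2 * s * b + s\<^sup>2"
  shows "vector_derivative (\<lambda>s. complex_of_real (p 1 (c s, t))) (at 0) = of_real (1 / (2 * pi)) *
     (LBINT lam. of_real (- (b / 2) * (cothl lam 1 * heat_ft CARD('n) ((norm z)\<^sup>2) lam)) * cis (- (lam * t)))"
proof -
  define \<rho> where "\<rho> s = (norm z)\<^sup>2 + 2 * s * b + s\<^sup>2" for s
  have \<rho>: "\<rho> s \<ge> 0" for s unfolding \<rho>_def path[symmetric] by simp
  let ?F = "\<lambda>s lam. complex_of_real (heat_ft CARD('n) (\<rho> s) lam) * cis (- (lam * t))"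
  let ?F' = "\<lambda>s lam. complex_of_real (- ((b + s) / 2) * (cothl lam 1 * heat_ft CARD('n) (\<rho> s) lam)) * cis (- (lam * t))"
  have "((\<lambda>s. LBINT lam. ?F s lam) has_vector_derivative (LBINT lam. ?F' 0 lam)) (at 0)"
  proof (rule has_vector_derivative_lebesgue_integral[where B = "\<lambda>lam. (\<bar>b\<bar> + 1) / 2 * ((1 + \<bar>lam\<bar>) * heat_factor CARD('n) lam)"])
    show "integrable lborel (?F s)" for s
      by (rule integrable_dominated[OF integrable_norm[OF integrable_heat_ft[OF \<rho>[of s]]]]) (auto simp: norm_mult)
    show "((\<lambda>s. ?F s lam) has_vector_derivative ?F' s lam) (at s)" for s lam
    proof -
      have "((\<lambda>s. heat_ft CARD('n) (\<rho> s) lam) has_real_derivative - ((b + s) / 2) * (cothl lam 1 * heat_ft CARD('n) (\<rho> s) lam)) (at s)"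
        unfolding heat_ft_def \<rho>_def by (auto intro!: derivative_eq_intros simp: field_simps)
      then show ?thesis by (intro has_vector_derivative_mult_left has_vector_derivative_of_real)
    qed
    show "norm (?F' s lam) \<le> (\<bar>b\<bar> + 1) / 2 * ((1 + \<bar>lam\<bar>) * heat_factor CARD('n) lam)" if "\<bar>s\<bar> < 1" for s lam
    proof -
      have "norm (?F' s lam) = \<bar>(b + s) / 2\<bar> * \<bar>cothl lam 1 * heat_ft CARD('n) (\<rho> s) lam\<bar>"
        by (simp only: norm_mult norm_of_real norm_cis abs_mult abs_minus_cancel mult_1_right)
      also have "\<dots> \<le> (\<bar>b\<bar> + 1) / 2 * ((1 + \<bar>lam\<bar>) * heat_factor CARD('n) lam * exp (- \<rho> s / 4))"
        using that by (intro mult_mono heat_ft_cothl_bound \<rho>) auto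
      also have "\<dots> \<le> (\<bar>b\<bar> + 1) / 2 * ((1 + \<bar>lam\<bar>) * heat_factor CARD('n) lam)"
        using \<rho>[of s] by (intro mult_left_mono) (auto intro!: mult_left_le mult_nonneg_nonneg heat_factor_nonneg)
      finally show ?thesis .
    qed
    show "integrable lborel (\<lambda>lam. (\<bar>b\<bar> + 1) / 2 * ((1 + \<bar>lam\<bar>) * heat_factor CARD('n) lam))"
      by (intro integrable_mult_right integrable_heat_factor) simp
  qed measurable
  then have "((\<lambda>s. of_real (1 / (2 * pi)) * (LBINT lam. ?F s lam)) has_vector_derivative of_real (1 / (2 * pi)) * (LBINT lam. ?F' 0 lam)) (at 0)"
    by (rule has_vector_derivative_mult_right)
  then show ?thesis
    unfolding heat_kernel_eq path \<rho>_def by (subst vector_derivative_at) simp_all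
qed

lemma heat_kernel_dt:
  "vector_derivative (\<lambda>s. complex_of_real (p 1 (z, t + s))) (at 0) = of_real (1 / (2 * pi)) *
     (LBINT lam. (- \<i> * of_real (lam * heat_ft CARD('n) ((norm z)\<^sup>2) lam)) * cis (- (lam * t)))"
proof -
  define h where "h = heat_ft CARD('n) ((norm z)\<^sup>2)"
  have [measurable]: "h \<in> borel_measurable borel" unfolding h_def by measurable
  let ?F = "\<lambda>s lam. complex_of_real (h lam) * cis (- (lam * (t + s)))"
  let ?F' = "\<lambda>s lam. (- \<i> * complex_of_real (lam * h lam)) * cis (- (lam * (t + s)))"
  have "((\<lambda>s. LBINT lam. ?F s lam) has_vector_derivative (LBINT lam. ?F' 0 lam)) (at 0)"
  proof (rule has_vector_derivative_lebesgue_integral[where B = "\<lambda>lam. (1 + \<bar>lam\<bar>) * heat_factor CARD('n) lam"])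
    show "integrable lborel (?F s)" for s
      using integrable_heat_ft[of "(norm z)\<^sup>2", where ?'n = 'n, folded h_def]
      by (rule integrable_norm[THEN integrable_dominated]) (auto simp: norm_mult)
    show "((\<lambda>s. ?F s lam) has_vector_derivative ?F' s lam) (at s)" for s lam
      unfolding cis_conv_exp
      by (auto intro!: derivative_eq_intros has_vector_derivative_real_field simp: algebra_simps)
    show "norm (?F' s lam) \<le> (1 + \<bar>lam\<bar>) * heat_factor CARD('n) lam" for s lam
      using mult_heat_ft_le[of "(norm z)\<^sup>2" lam, where ?'n = 'n, folded h_def] by (simp add: norm_mult abs_mult)
    show "integrable lborel (\<lambda>lam. (1 + \<bar>lam\<bar>) * heat_factor CARD('n) lam)"
      by (rule integrable_heat_factor) simp
  qed measurable
  then have "((\<lambda>s. of_real (1 / (2 * pi)) * (LBINT lam. ?F s lam)) has_vector_derivative of_real (1 / (2 * pi)) * (LBINT lam. ?F' 0 lam)) (at 0)"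
    by (rule has_vector_derivative_mult_right)
  then show ?thesis
    unfolding heat_kernel_eq h_def by (subst vector_derivative_at) simp_all
qed

text \<open>The weight \<open>1 + \<bar>lam\<bar>\<close> in the decay estimate is what makes both
  \<open>A\<close> and \<open>B\<close> absolutely convergent; \<open>sign_identity\<close> then
  assembles the three partial derivatives.\<close>

lemma Z_tilde_heat_kernel:
  assumes sg: "sg * sg = 1"
  shows "\<i> * X_tilde j (\<lambda>v. complex_of_real (p 1 v)) (z, t) + of_real sg * Y_tilde j (\<lambda>v. complex_of_real (p 1 v)) (z, t)
    = of_real (1 / (2 * pi)) * (LBINT lam. heat_multiplier sg j z lam * cis (- (lam * t)))"
proof -
  let ?P = "\<lambda>v. complex_of_real (p 1 v)"
  let ?x = "Re (z $ j)" and ?y = "Im (z $ j)"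
  let ?h = "heat_ft CARD('n) ((norm z)\<^sup>2)"
  define A where "A = (LBINT lam. of_real (cothl lam 1 * ?h lam) * cis (- (lam * t)))"
  define B where "B = (LBINT lam. of_real (lam * ?h lam) * cis (- (lam * t)))"
  let ?c = "complex_of_real (1 / (2 * pi))"
  have iA: "integrable lborel (\<lambda>lam. of_real (cothl lam 1 * ?h lam) * cis (- (lam * t)))"
  proof (rule integrable_dominated[OF integrable_mult_left[OF integrable_heat_factor[of "CARD('n)"], of "exp (- (norm z)\<^sup>2 / 4)"]])
    show "norm (of_real (cothl lam 1 * ?h lam) * cis (- (lam * t))) \<le> (1 + \<bar>lam\<bar>) * heat_factor CARD('n) lam * exp (- (norm z)\<^sup>2 / 4)" for lam
      unfolding norm_mult[of _ "cis _"] norm_of_real norm_cis mult_1_right by (rule heat_ft_cothl_bound) simp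
  qed (simp_all, measurable)
  have iB: "integrable lborel (\<lambda>lam. of_real (lam * ?h lam) * cis (- (lam * t)))"
  proof (rule integrable_dominated[OF integrable_heat_factor[of "CARD('n)"]])
    show "norm (of_real (lam * ?h lam) * cis (- (lam * t))) \<le> (1 + \<bar>lam\<bar>) * heat_factor CARD('n) lam" for lam
      unfolding norm_mult[of _ "cis _"] norm_of_real norm_cis mult_1_right by (rule mult_heat_ft_le) simp
  qed (simp_all, measurable)
  have dx: "dx j ?P (z, t) = ?c * (of_real (- (?x / 2)) * A)"
    unfolding dx_def fst_conv snd_conv A_def
    by (subst heat_kernel_path_derivative[OF norm_axis_add(1)])
      (simp only: of_real_mult mult.assoc integral_mult_right_zero)
  have dy: "dy j ?P (z, t) = ?c * (of_real (- (?y / 2)) * A)"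
    unfolding dy_def fst_conv snd_conv A_def
    by (subst heat_kernel_path_derivative[OF norm_axis_add(2)])
      (simp only: of_real_mult mult.assoc integral_mult_right_zero)
  have dt: "dt ?P (z, t) = ?c * (- \<i> * B)"
    unfolding dt_def fst_conv snd_conv B_def heat_kernel_dt
    by (simp only: mult.assoc integral_mult_right_zero)
  have "(LBINT lam. heat_multiplier sg j z lam * cis (- (lam * t))) =
    (LBINT lam. - (1/2) * (\<i> * of_real ?x + of_real (sg * ?y)) *
      (of_real (cothl lam 1 * ?h lam) * cis (- (lam * t)) + of_real sg * (of_real (lam * ?h lam) * cis (- (lam * t)))))"
    by (intro Bochner_Integration.integral_cong refl) (simp add: heat_multiplier_def algebra_simps add_divide_distrib)
  also have "\<dots> = - (1/2) * (\<i> * of_real ?x + of_real (sg * ?y)) * (A + of_real sg * B)"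
    unfolding integral_mult_right_zero A_def B_def using iA iB by simp
  finally have R: "(LBINT lam. heat_multiplier sg j z lam * cis (- (lam * t))) =
    - (1/2) * (\<i> * of_real ?x + of_real (sg * ?y)) * (A + of_real sg * B)" .
  have "(complex_of_real sg) * of_real sg = 1" using sg by (simp flip: of_real_mult)
  then have "- (1/2) * (\<i> * of_real ?x + of_real (sg * ?y)) * (A + of_real sg * B) =
      \<i> * (of_real (- (?x / 2)) * A - of_real (?y / 2) * (- \<i> * B))
      + of_real sg * (of_real (- (?y / 2)) * A + of_real (?x / 2) * (- \<i> * B))"
    using sign_identity[of "of_real sg" "of_real ?x" "of_real ?y" A B] by simp
  then have "?c * (- (1/2) * (\<i> * of_real ?x + of_real (sg * ?y)) * (A + of_real sg * B)) =
      ?c * (\<i> * (of_real (- (?x / 2)) * A - of_real (?y / 2) * (- \<i> * B))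
      + of_real sg * (of_real (- (?y / 2)) * A + of_real (?x / 2) * (- \<i> * B)))"
    by (rule arg_cong)
  then show ?thesis
    unfolding R X_tilde_def Y_tilde_def fst_conv dx dy dt scaleR_conv_of_real
    by (simp only: distrib_left right_diff_distrib mult.left_commute)
qed

end

subsection \<open>Changes of variables\<close>

lemma Basis_vec_eq: "(Basis :: (real^'n::finite) set) = range (\<lambda>i. axis i 1)"
  by (auto simp: Basis_vec_def)

text \<open>Lebesgue measure on vectors is the image of the product of one-dimensional Lebesgue
  measures, as a comparison on boxes shows; Fubini for finite products then gives both
  claims.\<close>

lemma
  fixes f :: "'n::finite \<Rightarrow> real \<Rightarrow> 'c::{real_normed_field,banach,second_countable_topology}"
  assumes f: "\<And>i. integrable lborel (f i)"
  shows integrable_prod_vec: "integrable lborel (\<lambda>x::real^'n. \<Prod>i\<in>UNIV. f i (x $ i))"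
    and integral_prod_vec: "(LINT x::real^'n|lborel. (\<Prod>i\<in>UNIV. f i (x $ i))) = (\<Prod>i\<in>UNIV. LBINT x. f i x)"
proof -
  let ?\<Pi> = "\<Pi>\<^sub>M i\<in>(UNIV :: 'n set). (lborel :: real measure)"
  interpret finite_product_sigma_finite "\<lambda>_::'n. lborel :: real measure" UNIV by unfold_locales auto
  have [measurable]: "f i \<in> borel_measurable borel" for i using f[of i] by auto
  have [measurable]: "(\<lambda>g. \<chi> i. g i) \<in> ?\<Pi> \<rightarrow>\<^sub>M (borel :: (real^'n) measure)"
  proof -
    have "(\<lambda>g. \<Sum>i\<in>UNIV. g i *\<^sub>R axis i 1) \<in> ?\<Pi> \<rightarrow>\<^sub>M (borel :: (real^'n) measure)" by measurable
    also have "(\<lambda>g. \<Sum>i\<in>UNIV. g i *\<^sub>R axis i 1) = (\<lambda>g. (\<chi> i. g i) :: real^'n)"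
      by (simp add: fun_eq_iff vec_eq_iff axis_def if_distrib cong: if_cong)
    finally show ?thesis .
  qed
  have D: "(lborel :: (real^'n) measure) = distr ?\<Pi> borel (\<lambda>g. \<chi> i. g i)"
  proof (rule lborel_eqI)
    fix l u :: "real^'n"
    assume le: "\<And>b. b \<in> Basis \<Longrightarrow> l \<bullet> b \<le> u \<bullet> b"
    have le': "l $ i \<le> u $ i" for i
      using le[of "axis i 1"] by (simp add: Basis_vec_eq inner_axis)
    have "(\<lambda>g. \<chi> i. g i) -` box l u \<inter> space ?\<Pi> = (\<Pi>\<^sub>E i\<in>UNIV. {l $ i<..<u $ i})"
      by (auto simp: space_PiM mem_box Basis_vec_eq inner_axis PiE_def Pi_def)
    then have "emeasure (distr ?\<Pi> borel (\<lambda>g. \<chi> i. g i)) (box l u) = (\<Prod>i\<in>UNIV. emeasure lborel {l $ i<..<u $ i})"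
      by (simp add: emeasure_distr measure_times)
    also have "\<dots> = (\<Prod>i\<in>UNIV. u $ i - l $ i)"
      using le' by (simp add: prod_ennreal)
    also have "(\<Prod>i\<in>UNIV. u $ i - l $ i) = (\<Prod>b\<in>Basis. (u - l) \<bullet> b)"
      unfolding Basis_vec_eq by (subst prod.reindex) (auto simp: inj_on_def axis_eq_axis inner_axis)
    finally show "emeasure (distr ?\<Pi> borel (\<lambda>g. \<chi> i. g i)) (box l u) = (\<Prod>b\<in>Basis. (u - l) \<bullet> b)" .
  qed simp
  show "integrable lborel (\<lambda>x::real^'n. \<Prod>i\<in>UNIV. f i (x $ i))"
    unfolding D by (subst integrable_distr_eq) (auto intro!: product_integrable_prod f)
  show "(LINT x::real^'n|lborel. (\<Prod>i\<in>UNIV. f i (x $ i))) = (\<Prod>i\<in>UNIV. LBINT x. f i x)"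
    unfolding D by (subst integral_distr) (auto simp: product_integral_prod f)
qed

text \<open>Such a map only relabels coordinates, so the preimage of a box is a box with the same
  side lengths.\<close>

lemma lborel_distr_permute_Basis:
  fixes T :: "'a::euclidean_space \<Rightarrow> 'b::euclidean_space"
  assumes [measurable]: "T \<in> borel_measurable borel" and img: "T ` Basis = Basis"
    and inner: "\<And>x b. b \<in> Basis \<Longrightarrow> T x \<bullet> T b = x \<bullet> b"
  shows "distr lborel borel T = lborel"
proof (rule lborel_eqI[symmetric])
  fix l u :: 'b
  assume le: "\<And>b. b \<in> Basis \<Longrightarrow> l \<bullet> b \<le> u \<bullet> b"
  \<comment> \<open>Carries the corners of a box back by reading off the relabelled
    coordinates.\<close>
  define T' where "T' v = (\<Sum>b\<in>Basis. (v \<bullet> T b) *\<^sub>R b)" for v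
  have T': "T' v \<bullet> b = v \<bullet> T b" if "b \<in> Basis" for v b
    using that by (simp add: T'_def inner_sum_left inner_Basis if_distrib cong: if_cong)
  have inj: "inj_on T Basis"
    by (rule inj_onI) (metis inner inner_Basis zero_neq_one)
  have "T -` box l u \<inter> space lborel = box (T' l) (T' u)"
    by (auto simp: mem_box T' img[symmetric] inner)
  then have "emeasure (distr lborel borel T) (box l u) = emeasure lborel (box (T' l) (T' u))"
    by (simp add: emeasure_distr)
  also have "\<dots> = (\<Prod>b\<in>Basis. (T' u - T' l) \<bullet> b)"
  proof (rule emeasure_lborel_box)
    fix b :: 'a assume "b \<in> Basis"
    then show "T' l \<bullet> b \<le> T' u \<bullet> b" using le[of "T b"] img by (auto simp: T')
  qed
  also have "(\<Prod>b\<in>Basis. (T' u - T' l) \<bullet> b) = (\<Prod>b\<in>Basis. (u - l) \<bullet> T b)"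
    by (simp add: inner_diff_left T')
  also have "\<dots> = (\<Prod>b\<in>Basis. (u - l) \<bullet> b)"
    using prod.reindex[OF inj, of "\<lambda>b. (u - l) \<bullet> b"] by (simp add: img)
  finally show "emeasure (distr lborel borel T) (box l u) = (\<Prod>b\<in>Basis. (u - l) \<bullet> b)" .
qed simp

section \<open>Real coordinates on the Heisenberg group and the change of variables\<close>

definition complex_vec :: "real^'n::finite \<Rightarrow> real^'n \<Rightarrow> complex^'n" where
  "complex_vec x y = (\<chi> i. Complex (x $ i) (y $ i))"

lemma complex_vec_simps [simp]:
  "complex_vec x y $ i = Complex (x $ i) (y $ i)" "Re_vec (complex_vec x y) = x" "Im_vec (complex_vec x y) = y"
  by (simp_all add: complex_vec_def Re_vec_def Im_vec_def vec_eq_iff)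

lemma norm_complex_vec: "(norm (complex_vec x y))\<^sup>2 = (norm x)\<^sup>2 + (norm y)\<^sup>2"
  by (simp add: power2_norm_eq_inner inner_vec_def inner_complex_def sum.distrib)

text \<open>The nesting keeps x as a separate first factor: the shear acts on the pair of y and t
  for fixed x, and x is integrated afterwards.\<close>

definition heis_coords :: "(real^'n::finite) \<times> ((real^'n) \<times> real) \<Rightarrow> 'n heis" where
  "heis_coords q = (complex_vec (fst q) (fst (snd q)), snd (snd q))"

lemma borel_measurable_complex_vec [measurable]:
  fixes f g :: "'a \<Rightarrow> real^'n::finite"
  assumes "f \<in> borel_measurable M" "g \<in> borel_measurable M"
  shows "(\<lambda>x. complex_vec (f x) (g x)) \<in> borel_measurable M"
proof -
  have "continuous_on UNIV (\<lambda>q. complex_vec (fst q) (snd q) :: complex^'n)"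
    unfolding complex_vec_def Complex_eq by (intro continuous_intros)
  then have "(\<lambda>x. (\<lambda>q. complex_vec (fst q) (snd q)) (f x, g x)) \<in> borel_measurable M"
    by (rule borel_measurable_continuous_on) (use assms in measurable)
  then show ?thesis by simp
qed

lemma borel_measurable_heis_coords [measurable]: "heis_coords \<in> borel_measurable borel"
  unfolding heis_coords_def by measurable

lemma distr_heis_coords: "distr lborel borel heis_coords = (lborel :: 'n::finite heis measure)"
proof (rule lborel_distr_permute_Basis)
  show "heis_coords ` Basis = (Basis :: 'n heis set)"
  proof -
    have e: "complex_vec (axis i 1) 0 = axis i 1" "complex_vec 0 (axis i 1) = axis i \<i>" "complex_vec 0 0 = 0" for i :: 'n
      by (simp_all add: vec_eq_iff axis_def complex_eq_iff)
    show ?thesis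
      unfolding Basis_prod_def Basis_vec_def Basis_complex_def
      by (simp add: image_Un image_image heis_coords_def e image_UN UN_Un_distrib) 
        (auto simp: image_iff e)
  qed
  show "heis_coords x \<bullet> heis_coords b = x \<bullet> b" for x b :: "(real^'n) \<times> ((real^'n) \<times> real)"
    by (simp add: heis_coords_def inner_prod_def inner_vec_def inner_complex_def sum.distrib)
qed measurable

text \<open>The first variable is substituted affinely, then the second one for each fixed value of
  the first. The shift \<open>a\<close> is constant in the inner integral, so it may be any
  measurable function.\<close>

lemma nn_integral_affine_shear:
  fixes h :: "'a::euclidean_space \<times> real \<Rightarrow> ennreal"
  assumes [measurable]: "h \<in> borel_measurable borel" "a \<in> borel_measurable borel" and r: "r \<noteq> 0" and d: "d \<noteq> 0"
  shows "(\<integral>\<^sup>+p. h p \<partial>lborel) = ennreal (\<bar>r\<bar> ^ DIM('a) * \<bar>d\<bar>) * (\<integral>\<^sup>+p. h (b + r *\<^sub>R fst p, a (fst p) + d * snd p) \<partial>lborel)"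
proof -
  have [measurable]: "h \<in> borel_measurable (lborel \<Otimes>\<^sub>M lborel)"
    unfolding lborel_prod by simp
  have "(\<integral>\<^sup>+p. h p \<partial>lborel) = (\<integral>\<^sup>+y. \<integral>\<^sup>+t. h (y, t) \<partial>lborel \<partial>lborel)"
    unfolding lborel_prod[symmetric] by (rule lborel.nn_integral_fst[symmetric]) measurable
  also have "\<dots> = (\<integral>\<^sup>+y. (\<integral>\<^sup>+t. h (y, t) \<partial>lborel) \<partial>density (distr lborel borel (\<lambda>y. b + r *\<^sub>R y)) (\<lambda>_. \<bar>r\<bar> ^ DIM('a)))"
    using lborel_affine[OF r, of b] by (simp only:)
  also have "\<dots> = ennreal (\<bar>r\<bar> ^ DIM('a)) * (\<integral>\<^sup>+y. \<integral>\<^sup>+t. h (b + r *\<^sub>R y, t) \<partial>lborel \<partial>lborel)"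
    by (simp add: nn_integral_density nn_integral_distr nn_integral_cmult)
  also have "(\<integral>\<^sup>+y. \<integral>\<^sup>+t. h (b + r *\<^sub>R y, t) \<partial>lborel \<partial>lborel) =
      (\<integral>\<^sup>+y. ennreal \<bar>d\<bar> * (\<integral>\<^sup>+t. h (b + r *\<^sub>R y, a y + d * t) \<partial>lborel) \<partial>lborel)"
    by (intro nn_integral_cong nn_integral_real_affine d) measurable
  also have "\<dots> = ennreal \<bar>d\<bar> * (\<integral>\<^sup>+y. \<integral>\<^sup>+t. h (b + r *\<^sub>R y, a y + d * t) \<partial>lborel \<partial>lborel)"
    by (rule nn_integral_cmult) measurable
  also have "(\<integral>\<^sup>+y. \<integral>\<^sup>+t. h (b + r *\<^sub>R y, a y + d * t) \<partial>lborel \<partial>lborel) =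
      (\<integral>\<^sup>+p. h (b + r *\<^sub>R fst p, a (fst p) + d * snd p) \<partial>lborel)"
    unfolding lborel_prod[symmetric] by (subst lborel.nn_integral_fst[symmetric]) simp_all
  finally show ?thesis by (simp add: ennreal_mult mult.assoc)
qed

text \<open>The nonnegative case, applied to indicators, says that Lebesgue measure is a constant
  multiple of its image under the shear; vector-valued integrals follow from this.\<close>

lemma
  fixes g :: "'a::euclidean_space \<times> real \<Rightarrow> 'b::{banach,second_countable_topology}"
  assumes g: "integrable lborel g" and [measurable]: "a \<in> borel_measurable borel" and r: "r \<noteq> 0" and d: "d \<noteq> 0"
  shows integrable_affine_shear: "integrable lborel (\<lambda>p. g (b + r *\<^sub>R fst p, a (fst p) + d * snd p))"
    and integral_affine_shear: "(LBINT p. g p) = (\<bar>r\<bar> ^ DIM('a) * \<bar>d\<bar>) *\<^sub>R (LBINT p. g (b + r *\<^sub>R fst p, a (fst p) + d * snd p))"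
proof -
  let ?T = "\<lambda>p. (b + r *\<^sub>R fst p, a (fst p) + d * snd p)" and ?c = "\<bar>r\<bar> ^ DIM('a) * \<bar>d\<bar>"
  have [measurable]: "g \<in> borel_measurable borel" using g by auto
  have c: "?c > 0" using r d by simp
  have [measurable]: "?T \<in> borel_measurable borel" by measurable
  have D: "lborel = density (distr lborel borel ?T) (\<lambda>_. ennreal ?c)"
  proof (rule measure_eqI)
    fix A :: "('a \<times> real) set" assume A [measurable]: "A \<in> sets lborel"
    have "emeasure lborel A = (\<integral>\<^sup>+p. indicator A p \<partial>lborel)" using A by (rule nn_integral_indicator[symmetric])
    also have "\<dots> = ennreal ?c * (\<integral>\<^sup>+p. indicator A (?T p) \<partial>lborel)"
      using A by (intro nn_integral_affine_shear r d) auto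
    also have "(\<integral>\<^sup>+p. indicator A (?T p) \<partial>lborel) = (\<integral>\<^sup>+p. indicator A p \<partial>distr lborel borel ?T)"
      using A by (intro nn_integral_distr[symmetric]) auto
    also have "\<dots> = emeasure (distr lborel borel ?T) A" using A by simp
    also have "ennreal ?c * emeasure (distr lborel borel ?T) A = emeasure (density (distr lborel borel ?T) (\<lambda>_. ennreal ?c)) A"
      using A by (simp add: emeasure_density nn_integral_cmult)
    finally show "emeasure lborel A = emeasure (density (distr lborel borel ?T) (\<lambda>_. ennreal ?c)) A" .
  qed simp
  have "integrable (density (distr lborel borel ?T) (\<lambda>_. ennreal ?c)) g" using g D by simp
  then have "integrable lborel (\<lambda>p. ?c *\<^sub>R g (?T p))"
    using c by (subst (asm) integrable_density) (auto simp: integrable_distr_eq)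
  from integrable_scaleR_right[OF this, of "1 / ?c"]
  show "integrable lborel (\<lambda>p. g (?T p))" using r d by (simp only: scaleR_scaleR) simp
  have "(LBINT p. g p) = (LINT p|density (distr lborel borel ?T) (\<lambda>_. ennreal ?c). g p)" using D by simp
  also have "\<dots> = ?c *\<^sub>R (LBINT p. g (?T p))"
    using c by (subst integral_density) (auto simp: integral_distr)
  finally show "(LBINT p. g p) = ?c *\<^sub>R (LBINT p. g (?T p))" .
qed

section \<open>Gaussian Fourier integrals in several variables\<close>

lemma exp_norm_vec_prod: "exp (- a * (norm x)\<^sup>2) = (\<Prod>i\<in>UNIV. exp (- a * ((x :: real^'n::finite) $ i)\<^sup>2))"
  unfolding power2_norm_eq_inner
  by (simp add: inner_vec_def power2_eq_square sum_distrib_left exp_sum[symmetric] sum_negf)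

lemma cis_inner_prod: "cis (k \<bullet> x) = (\<Prod>i\<in>UNIV. cis (k $ i * (x :: real^'n::finite) $ i))"
  by (simp add: inner_vec_def cis_conv_exp exp_sum[symmetric] sum_distrib_left)

text \<open>The integrand is a sum of two products over the coordinates, and only coordinate
  \<open>j\<close> carries a first moment. Its factor \<open>\<i>\<close> meets the
  \<open>\<i>\<close> in front, which makes the result real and produces the minus sign.\<close>

lemma gaussian_fourier_vec_moment:
  fixes k :: "real^'n::finite" and a b :: real
  assumes a: "0 < a"
  shows "(LBINT x. cis (k \<bullet> x) * of_real (exp (- a * (norm x)\<^sup>2)) * (\<i> * of_real (x $ j) + of_real b))
    = of_real ((b - k $ j / (2 * a)) * (\<Prod>i\<in>UNIV. sqrt (pi / a) * exp (- (k $ i)\<^sup>2 / (4 * a))))"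
proof -
  let ?g = "\<lambda>i x. cis (k $ i * x) * complex_of_real (exp (- a * x\<^sup>2))"
  let ?G = "\<lambda>i. sqrt (pi / a) * exp (- (k $ i)\<^sup>2 / (4 * a))"
  have g: "integrable lborel (?g i)" for i
    by (rule integrable_dominated[OF integrable_gaussian[OF a]]) (auto simp: norm_mult)
  have g1: "integrable lborel (\<lambda>x. of_real x * ?g i x)" for i
    by (rule integrable_dominated[OF integrable_abs_power_gaussian[OF a, of 1]]) (auto simp: norm_mult abs_mult)
  define F where "F i x = (if i = j then of_real x * ?g i x else ?g i x)" for i x
  have F: "integrable lborel (F i)" for i unfolding F_def using g[of i] g1[of i] by (cases "i = j") simp_all
  have P: "cis (k \<bullet> x) * of_real (exp (- a * (norm x)\<^sup>2)) = (\<Prod>i\<in>UNIV. ?g i (x $ i))" for x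
    unfolding cis_inner_prod exp_norm_vec_prod by (simp add: prod.distrib)
  have FP: "(\<Prod>i\<in>UNIV. F i (x $ i)) = of_real (x $ j) * (\<Prod>i\<in>UNIV. ?g i (x $ i))" for x
  proof -
    have "(\<Prod>i\<in>UNIV - {j}. F i (x $ i)) = (\<Prod>i\<in>UNIV - {j}. ?g i (x $ i))" by (rule prod.cong) (auto simp: F_def)
    then show ?thesis by (simp add: prod.remove[of UNIV j] F_def mult.assoc)
  qed
  have IF: "(\<Prod>i\<in>UNIV. LBINT x. F i x) = \<i> * of_real (k $ j / (2 * a) * (\<Prod>i\<in>UNIV. ?G i))"
  proof -
    have "(\<Prod>i\<in>UNIV - {j}. LBINT x. F i x) = (\<Prod>i\<in>UNIV - {j}. of_real (?G i))"
    proof (rule prod.cong[OF refl])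
      fix i assume "i \<in> UNIV - {j}"
      then have "i \<noteq> j" by simp
      then show "(LBINT x. F i x) = of_real (?G i)"
        unfolding F_def by (simp only: if_False gaussian_fourier[OF a])
    qed
    moreover have "(LBINT x. F j x) = \<i> * of_real (k $ j / (2 * a) * ?G j)"
      unfolding F_def by (simp only: if_True refl gaussian_fourier_first_moment[OF a] mult.assoc)
    ultimately show ?thesis by (simp add: prod.remove[of UNIV j])
  qed
  have "(LBINT x. cis (k \<bullet> x) * of_real (exp (- a * (norm x)\<^sup>2)) * (\<i> * of_real (x $ j) + of_real b)) =
     (LBINT x. \<i> * (\<Prod>i\<in>UNIV. F i (x $ i)) + of_real b * (\<Prod>i\<in>UNIV. ?g i (x $ i)))"
    unfolding P FP by (simp add: algebra_simps)
  also have "\<dots> = \<i> * (\<Prod>i\<in>UNIV. LBINT x. F i x) + of_real b * (\<Prod>i\<in>UNIV. LBINT x. ?g i x)"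
    by (subst Bochner_Integration.integral_add)
      (intro integrable_mult_right integrable_prod_vec F g, intro integrable_mult_right integrable_prod_vec F g,
        simp only: integral_mult_right_zero integral_prod_vec[OF F] integral_prod_vec[OF g])
  also have "\<dots> = of_real ((b - k $ j / (2 * a)) * (\<Prod>i\<in>UNIV. ?G i))"
    unfolding IF gaussian_fourier[OF a] by (simp add: algebra_simps)
  finally show ?thesis .
qed

text \<open>One coordinate of the passage from the heat kernel at time 1 and frequency
  \<open>\<mu>\<close> to the Mehler kernel at time \<open>r\<^sup>2\<close> and frequency
  \<open>lam\<close>. The difference term matches by
  \<open>cothl \<mu> 1 = r\<^sup>2 * cothl lam (r\<^sup>2)\<close>, the sum term arises from the
  x-integral, where 1/coth is tanh.\<close>

lemma mehler1_eq_gaussian: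
  assumes lam: "lam \<noteq> 0" and r: "r \<noteq> 0"
  defines "\<mu> \<equiv> lam * r\<^sup>2"
  shows "\<mu> / (4 * pi * sinh \<mu>) * (exp (- (cothl \<mu> 1 * y\<^sup>2) / 4) * (sqrt (4 * pi / cothl \<mu> 1)
      * exp (- (lam * r * (x + r * y / 2))\<^sup>2 / cothl \<mu> 1))) = \<bar>r\<bar> * mehler1 lam (r\<^sup>2) x (x + r * y)"
proof -
  have \<mu>: "\<mu> \<noteq> 0" using lam r by (simp add: \<mu>_def)
  define S where "S = sinh \<mu>" define C where "C = cosh \<mu>"
  have S: "S \<noteq> 0" using \<mu> by (simp add: S_def)
  have C: "C > 0" by (simp add: C_def)
  have \<mu>S: "\<mu> / S > 0"
    using \<mu> div_sinh_nonneg[of 1 \<mu>] S by (simp add: S_def less_le)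
  have c: "cothl \<mu> 1 = \<mu> / S * C" by (simp add: cothl_def S_def C_def)
  have cp: "cothl \<mu> 1 > 0" unfolding c using \<mu>S C by (rule mult_pos_pos)
  have e1: "cothl lam (r\<^sup>2) * (x - (x + r * y))\<^sup>2 = cothl \<mu> 1 * y\<^sup>2"
    by (simp add: cothl_def \<mu>_def power_mult_distrib)
  have e2: "tanhl lam (r\<^sup>2) * (x + (x + r * y))\<^sup>2 / 4 = (lam * r * (x + r * y / 2))\<^sup>2 / cothl \<mu> 1"
  proof -
    have "(lam * r * (x + r * y / 2))\<^sup>2 = lam * \<mu> * (x + (x + r * y))\<^sup>2 / 4"
      unfolding \<mu>_def by (simp add: power2_eq_square field_simps)
    moreover have "lam * \<mu> / cothl \<mu> 1 = tanhl lam (r\<^sup>2)"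
      using \<mu> S C unfolding c tanhl_def \<mu>_def[symmetric] S_def[symmetric] C_def[symmetric] by simp
    moreover have "lam * \<mu> * (x + (x + r * y))\<^sup>2 / 4 / cothl \<mu> 1 = lam * \<mu> / cothl \<mu> 1 * (x + (x + r * y))\<^sup>2 / 4"
      by simp
    ultimately show ?thesis by (simp only:)
  qed
  \<comment> \<open>Both sides are nonnegative, so their squares are compared; there the doubling
    formula for \<open>sinh\<close> makes the prefactors agree.\<close>
  have m: "\<mu> / (4 * pi * S) * sqrt (4 * pi / cothl \<mu> 1) = \<bar>r\<bar> * mehler_factor lam (r\<^sup>2)"
  proof (rule power2_eq_imp_eq)
    have "lam / (2 * pi * sinh (2 * lam * r\<^sup>2)) \<ge> 0"
      by (rule mehler_radicand_nonneg) simp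
    moreover have sd: "sinh (2 * lam * r\<^sup>2) = 2 * S * C"
      using sinh_double[of \<mu>] by (simp add: \<mu>_def S_def C_def mult.assoc)
    ultimately have "(\<bar>r\<bar> * mehler_factor lam (r\<^sup>2))\<^sup>2 = r\<^sup>2 * (lam / (2 * pi * (2 * S * C)))"
      by (simp add: mehler_factor_def power_mult_distrib)
    also have "\<dots> = \<mu> / (4 * pi * S * C)" by (simp add: \<mu>_def mult_ac)
    also have "\<dots> = (\<mu> / (4 * pi * S))\<^sup>2 * (4 * pi / cothl \<mu> 1)"
      unfolding c using \<mu> S C by (simp add: power2_eq_square)
    also have "\<dots> = (\<mu> / (4 * pi * S) * sqrt (4 * pi / cothl \<mu> 1))\<^sup>2"
      unfolding power_mult_distrib using cp by (subst real_sqrt_pow2) auto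
    finally show "(\<mu> / (4 * pi * S) * sqrt (4 * pi / cothl \<mu> 1))\<^sup>2 = (\<bar>r\<bar> * mehler_factor lam (r\<^sup>2))\<^sup>2" by simp
    show "0 \<le> \<bar>r\<bar> * mehler_factor lam (r\<^sup>2)" by (simp add: mehler_factor_nonneg)
    have "0 \<le> (\<mu> / S) / (4 * pi) * sqrt (4 * pi / cothl \<mu> 1)"
      by (rule mult_nonneg_nonneg[OF divide_nonneg_nonneg[OF less_imp_le[OF \<mu>S]] real_sqrt_ge_zero]) (use cp in auto)
    moreover have "(\<mu> / S) / (4 * pi) = \<mu> / (4 * pi * S)" by simp
    ultimately show "0 \<le> \<mu> / (4 * pi * S) * sqrt (4 * pi / cothl \<mu> 1)" by (simp only:)
  qed
  have E: "exp (- (cothl \<mu> 1 * y\<^sup>2) / 4) * exp (- (lam * r * (x + r * y / 2))\<^sup>2 / cothl \<mu> 1)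
     = exp (- (cothl lam (r\<^sup>2) * (x - (x + r * y))\<^sup>2 + tanhl lam (r\<^sup>2) * (x + (x + r * y))\<^sup>2) / 4)"
    unfolding e1 exp_add[symmetric] using e2 by (simp add: add_divide_distrib)
  have regroup: "m * (e * (q * e')) = (m * q) * (e * e')" for m e q e' :: real by (simp only: mult_ac)
  show ?thesis
    unfolding mehler1_def S_def[symmetric] regroup m E by (simp only: mult.assoc)
qed

subsection \<open>Comparison of the kernels\<close>

lemma borel_measurable_complex_vec_component [measurable]:
  "f \<in> borel_measurable M \<Longrightarrow> (\<lambda>x. (f x :: complex^'n::finite) $ i) \<in> borel_measurable M"
  by (rule borel_measurable_continuous_on[where f = "\<lambda>x. x $ i"]) (intro continuous_intros)

lemma borel_measurable_heat_multiplier [measurable]: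
  assumes [measurable]: "f \<in> borel_measurable M" "g \<in> borel_measurable M"
  shows "(\<lambda>x. heat_multiplier sg j (f x :: complex^'n::finite) (g x)) \<in> borel_measurable M"
  unfolding heat_multiplier_def by measurable

text \<open>The polynomial factors on the two sides: on the left multiplier times Gaussian moment,
  on the right the ladder operator acting on the exponent. Here \<open>c\<close> and
  \<open>\<tau>\<close> are the \<open>cothl\<close> and \<open>tanhl\<close> values, whose product
  is \<open>lam\<^sup>2\<close>.\<close>

lemma ladder_scalar_identity:
  fixes c r y x lam sg \<tau> :: real
  assumes c: "c \<noteq> 0" and r: "r \<noteq> 0" and \<tau>: "c * \<tau> = lam\<^sup>2" and sg: "sg * sg = 1"
  shows "- (1/2) * (r\<^sup>2 * c + sg * (lam * r\<^sup>2)) * (sg * y - lam * r * (x + r * y / 2) / (r\<^sup>2 * c / 2))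
     = r * (- sg * - ((c * (x - (x + r * y)) + \<tau> * (x + (x + r * y))) / 2) + lam * x)"
proof -
  \<comment> \<open>In the application this is the plain hyperbolic tangent; the relations
    \<open>cq\<close> and \<open>lq\<close> replace all hyperbolic functions by algebra.\<close>
  define q where "q = lam / c"
  have cq: "c * q = lam" using c by (simp add: q_def)
  have lq: "lam * q = \<tau>" using \<tau> c by (simp add: q_def power2_eq_square field_simps)
  have a: "lam * r * (x + r * y / 2) / (r\<^sup>2 * c / 2) = q * (2 * x + r * y) / r"
    using c r by (simp add: q_def power2_eq_square field_simps)
  have "(r\<^sup>2 * c + sg * (lam * r\<^sup>2)) * (sg * y - q * (2 * x + r * y) / r)
     = r * ((c + sg * lam) * (sg * (r * y) - q * (2 * x + r * y)))"
    using r by (simp add: power2_eq_square field_simps)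
  also have "(c + sg * lam) * (sg * (r * y) - q * (2 * x + r * y))
     = sg * c * (r * y) - (c * q) * (2 * x + r * y) + (sg * sg) * lam * (r * y) - sg * (lam * q) * (2 * x + r * y)"
    by (simp add: algebra_simps)
  also have "\<dots> = sg * c * (r * y) - lam * (2 * x) - sg * \<tau> * (2 * x + r * y)"
    unfolding cq lq sg by (simp add: algebra_simps)
  finally have "(r\<^sup>2 * c + sg * (lam * r\<^sup>2)) * (sg * y - q * (2 * x + r * y) / r)
     = r * (sg * c * (r * y) - lam * (2 * x) - sg * \<tau> * (2 * x + r * y))" .
  then have "- (1/2) * (r\<^sup>2 * c + sg * (lam * r\<^sup>2)) * (sg * y - q * (2 * x + r * y) / r)
     = - (1/2) * (r * (sg * c * (r * y) - lam * (2 * x) - sg * \<tau> * (2 * x + r * y)))"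
    by (simp only: mult.assoc)
  also have "\<dots> = r * (- sg * - ((c * (x - (x + r * y)) + \<tau> * (x + (x + r * y))) / 2) + lam * x)"
    by (simp add: field_simps)
  finally show ?thesis unfolding a .
qed

text \<open>The Gaussian integral in x at frequency \<open>lam * r\<^sup>2\<close>. The factor
  \<open>\<bar>r\<bar> ^ CARD('n)\<close> collects one \<open>\<bar>r\<bar>\<close> per coordinate,
  and the odd factor \<open>r\<close> comes from \<open>ladder_scalar_identity\<close>.\<close>

lemma heat_multiplier_integral:
  fixes \<xi> y :: "real^'n::finite"
  assumes sg: "sg * sg = 1" and lam: "lam \<noteq> 0" and r: "r \<noteq> 0"
  shows "(LBINT x. cis (((lam * r) *\<^sub>R (\<xi> + (r / 2) *\<^sub>R y)) \<bullet> x) * heat_multiplier sg j (complex_vec x y) (lam * r\<^sup>2))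
    = of_real (r * \<bar>r\<bar> ^ CARD('n) * mehler_ladder sg j lam (r\<^sup>2) \<xi> (\<xi> + r *\<^sub>R y))"
proof -
  define \<mu> where "\<mu> = lam * r\<^sup>2"
  have \<mu>: "\<mu> \<noteq> 0" using lam r by (simp add: \<mu>_def)
  define a where "a = cothl \<mu> 1"
  have a: "a > 0" using cothl_bounds(1)[OF \<mu>, of 1] by (simp add: a_def)
  \<comment> \<open>The coefficient of x in the phase, contributed by the shift of the central
    variable in \<open>T_op\<close>.\<close>
  define k where "k = (lam * r) *\<^sub>R (\<xi> + (r / 2) *\<^sub>R y)"
  have k: "k $ i = lam * r * (\<xi> $ i + r * y $ i / 2)" for i by (simp add: k_def)
  define H where "H = heat_factor CARD('n) \<mu> * exp (- a * (norm y)\<^sup>2 / 4)"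
  let ?A = "- (1/2) * (a + sg * \<mu>)"
  have hm: "cis (k \<bullet> x) * heat_multiplier sg j (complex_vec x y) \<mu> =
      of_real (?A * H) * (cis (k \<bullet> x) * of_real (exp (- (a / 4) * (norm x)\<^sup>2)) * (\<i> * of_real (x $ j) + of_real (sg * y $ j)))" for x
  proof -
    have "exp (- (a * ((norm x)\<^sup>2 + (norm y)\<^sup>2)) / 4) = exp (- a * (norm y)\<^sup>2 / 4) * exp (- (a / 4) * (norm x)\<^sup>2)"
      by (simp add: exp_add[symmetric] algebra_simps add_divide_distrib diff_divide_distrib)
    then have "heat_ft CARD('n) ((norm x)\<^sup>2 + (norm y)\<^sup>2) \<mu> = H * exp (- (a / 4) * (norm x)\<^sup>2)"
      by (simp add: heat_ft_def H_def a_def)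
    then show ?thesis
      by (simp add: heat_multiplier_def norm_complex_vec a_def mult_ac)
  qed
  have P: "H * (\<Prod>i\<in>UNIV. sqrt (pi / (a / 4)) * exp (- (k $ i)\<^sup>2 / (4 * (a / 4)))) = \<bar>r\<bar> ^ CARD('n) * mehler lam (r\<^sup>2) \<xi> (\<xi> + r *\<^sub>R y)"
  proof -
    have "heat_factor CARD('n) \<mu> = (\<Prod>i\<in>(UNIV::'n set). \<mu> / (4 * pi * sinh \<mu>))"
      by (simp add: heat_factor_def power_divide power_mult_distrib)
    moreover have "exp (- a * (norm y)\<^sup>2 / 4) = (\<Prod>i\<in>UNIV. exp (- (a * (y $ i)\<^sup>2) / 4))"
      using exp_norm_vec_prod[of "a / 4" y] by simp
    ultimately have "H * (\<Prod>i\<in>UNIV. sqrt (pi / (a / 4)) * exp (- (k $ i)\<^sup>2 / (4 * (a / 4)))) =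
       (\<Prod>i\<in>UNIV. \<mu> / (4 * pi * sinh \<mu>) * (exp (- (a * (y $ i)\<^sup>2) / 4) * (sqrt (4 * pi / a) * exp (- (k $ i)\<^sup>2 / a))))"
      unfolding H_def by (simp only: prod.distrib mult.assoc) (simp add: mult.commute)
    also have "\<dots> = (\<Prod>i\<in>UNIV. \<bar>r\<bar> * mehler1 lam (r\<^sup>2) (\<xi> $ i) (\<xi> $ i + r * y $ i))"
      unfolding a_def \<mu>_def k mehler1_eq_gaussian[OF lam r] ..
    finally show ?thesis by (simp add: prod.distrib mehler_def)
  qed
  have a_eq: "a = r\<^sup>2 * cothl lam (r\<^sup>2)" by (simp add: a_def cothl_def \<mu>_def)
  have c0: "cothl lam (r\<^sup>2) \<noteq> 0" using a r unfolding a_eq by auto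
  have ct: "cothl lam (r\<^sup>2) * tanhl lam (r\<^sup>2) = lam\<^sup>2"
    using lam r by (simp add: cothl_def tanhl_def power2_eq_square)
  have S: "?A * (sg * y $ j - k $ j / (2 * (a / 4))) * mehler lam (r\<^sup>2) \<xi> (\<xi> + r *\<^sub>R y) = r * mehler_ladder sg j lam (r\<^sup>2) \<xi> (\<xi> + r *\<^sub>R y)"
  proof -
    have "2 * (a / 4) = r\<^sup>2 * cothl lam (r\<^sup>2) / 2" by (simp add: a_eq)
    then have "?A * (sg * y $ j - k $ j / (2 * (a / 4))) =
      r * (- sg * - ((cothl lam (r\<^sup>2) * (\<xi> $ j - (\<xi> $ j + r * y $ j)) + tanhl lam (r\<^sup>2) * (\<xi> $ j + (\<xi> $ j + r * y $ j))) / 2) + lam * \<xi> $ j)"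
      using ladder_scalar_identity[OF c0 r ct sg, of "y $ j" "\<xi> $ j"]
      unfolding k a_eq[symmetric] \<mu>_def by (simp only: a_eq)
    moreover have "mehler_ladder sg j lam (r\<^sup>2) \<xi> (\<xi> + r *\<^sub>R y) =
       (- sg * - ((cothl lam (r\<^sup>2) * (\<xi> $ j - (\<xi> $ j + r * y $ j)) + tanhl lam (r\<^sup>2) * (\<xi> $ j + (\<xi> $ j + r * y $ j))) / 2) + lam * \<xi> $ j)
        * mehler lam (r\<^sup>2) \<xi> (\<xi> + r *\<^sub>R y)"
      unfolding mehler_ladder_def mehler_deriv_def vector_add_component vector_scaleR_component
      by (simp only: distrib_right mult.assoc real_scaleR_def)
    ultimately show ?thesis by (simp only: mult.assoc)
  qed
  have "(LBINT x. cis (k \<bullet> x) * heat_multiplier sg j (complex_vec x y) \<mu>) =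
      of_real (?A * H) * of_real ((sg * y $ j - k $ j / (2 * (a / 4))) * (\<Prod>i\<in>UNIV. sqrt (pi / (a / 4)) * exp (- (k $ i)\<^sup>2 / (4 * (a / 4)))))"
    unfolding hm integral_mult_right_zero using a by (subst gaussian_fourier_vec_moment) simp_all
  also have "\<dots> = of_real (?A * (sg * y $ j - k $ j / (2 * (a / 4))) * (H * (\<Prod>i\<in>UNIV. sqrt (pi / (a / 4)) * exp (- (k $ i)\<^sup>2 / (4 * (a / 4))))))"
    by (simp only: of_real_mult[symmetric] mult_ac)
  also have "\<dots> = of_real (\<bar>r\<bar> ^ CARD('n) * (?A * (sg * y $ j - k $ j / (2 * (a / 4))) * mehler lam (r\<^sup>2) \<xi> (\<xi> + r *\<^sub>R y)))"
    unfolding P by (simp only: mult_ac)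
  also have "\<dots> = of_real (r * \<bar>r\<bar> ^ CARD('n) * mehler_ladder sg j lam (r\<^sup>2) \<xi> (\<xi> + r *\<^sub>R y))"
    unfolding S by (simp only: mult_ac)
  finally show ?thesis unfolding k_def \<mu>_def .
qed

text \<open>Deliberately without decay in y, which \<open>f\<close> supplies after the change of
  variables. The summand 2 pays for the component \<open>j\<close> of y times its Gaussian, via
  \<open>mult_gaussian_le\<close> with \<open>c = 1\<close>.\<close>

definition gaussian_majorant :: "'n::finite \<Rightarrow> real^'n \<Rightarrow> real" where
  "gaussian_majorant j x = (\<bar>x $ j\<bar> + 2) * exp (- (1/4) * (norm x)\<^sup>2)"

lemma gaussian_majorant_nonneg: "0 \<le> gaussian_majorant j x"
  by (simp add: gaussian_majorant_def)

lemma integrable_gaussian_majorant: "integrable lborel (gaussian_majorant j)"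
proof -
  define F where "F i x = (if i = j then \<bar>x\<bar> ^ 1 * exp (- (1/4) * x\<^sup>2) + 2 * exp (- (1/4) * x\<^sup>2) else exp (- (1/4) * x\<^sup>2))" for i and x :: real
  have 1: "integrable lborel (\<lambda>x::real. \<bar>x\<bar> ^ 1 * exp (- (1/4) * x\<^sup>2))"
    by (rule integrable_abs_power_gaussian) simp
  have 0: "integrable lborel (\<lambda>x::real. exp (- (1/4) * x\<^sup>2))"
    by (rule integrable_gaussian) simp
  have "integrable lborel (F i)" for i
  proof (cases "i = j")
    case True
    then have "F i = (\<lambda>x. \<bar>x\<bar> ^ 1 * exp (- (1/4) * x\<^sup>2) + 2 * exp (- (1/4) * x\<^sup>2))"
      by (simp add: F_def fun_eq_iff)
    then show ?thesis by (simp only:) (intro Bochner_Integration.integrable_add integrable_mult_right 0 1)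
  next
    case False
    then have "F i = (\<lambda>x. exp (- (1/4) * x\<^sup>2))" by (simp add: F_def fun_eq_iff)
    then show ?thesis by (simp only: 0)
  qed
  then have "integrable lborel (\<lambda>x. \<Prod>i\<in>UNIV. F i (x $ i))" by (rule integrable_prod_vec)
  also have "(\<lambda>x. \<Prod>i\<in>UNIV. F i (x $ i)) = gaussian_majorant j"
  proof
    fix x :: "real^'a"
    have "(\<Prod>i\<in>UNIV - {j}. F i (x $ i)) = (\<Prod>i\<in>UNIV - {j}. exp (- (1/4) * (x $ i)\<^sup>2))"
      by (rule prod.cong) (auto simp: F_def)
    then show "(\<Prod>i\<in>UNIV. F i (x $ i)) = gaussian_majorant j x"
      unfolding gaussian_majorant_def exp_norm_vec_prod by (simp add: prod.remove[of UNIV j] F_def algebra_simps)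
  qed
  finally show ?thesis .
qed

lemma heat_multiplier_bound:
  fixes x y :: "real^'n::finite"
  assumes sg: "\<bar>sg\<bar> = 1"
  shows "norm (heat_multiplier sg j (complex_vec x y) lam) \<le> gaussian_majorant j x * ((1 + \<bar>lam\<bar>) * heat_factor CARD('n) lam)"
proof -
  let ?\<rho> = "(norm x)\<^sup>2 + (norm y)\<^sup>2"
  let ?h = "heat_ft CARD('n) ?\<rho> lam" and ?H = "heat_factor CARD('n) lam"
  have H: "0 \<le> ?H" by (rule heat_factor_nonneg)
  have "\<bar>(cothl lam 1 + sg * lam) * ?h\<bar> \<le> \<bar>cothl lam 1 * ?h\<bar> + \<bar>lam\<bar> * \<bar>?h\<bar>"
    using sg abs_triangle_ineq[of "cothl lam 1 * ?h" "sg * lam * ?h"] by (simp add: abs_mult distrib_right)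
  also have "\<dots> \<le> (1 + \<bar>lam\<bar>) * ?H * exp (- ?\<rho> / 4) + (1 + \<bar>lam\<bar>) * (?H * exp (- ?\<rho> / 4))"
    by (intro add_mono heat_ft_cothl_bound mult_mono heat_ft_bound) auto
  finally have 1: "\<bar>(cothl lam 1 + sg * lam) * ?h\<bar> \<le> 2 * ((1 + \<bar>lam\<bar>) * ?H * exp (- ?\<rho> / 4))" by simp
  have "norm (\<i> * of_real (x $ j) + complex_of_real (sg * y $ j)) \<le> \<bar>x $ j\<bar> + \<bar>y $ j\<bar>"
    by (rule order_trans[OF norm_triangle_ineq]) (use sg in \<open>simp add: norm_mult abs_mult\<close>)
  moreover have "norm (heat_multiplier sg j (complex_vec x y) lam) = (1/2) * \<bar>(cothl lam 1 + sg * lam) * ?h\<bar> * norm (\<i> * of_real (x $ j) + complex_of_real (sg * y $ j))"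
    unfolding heat_multiplier_def norm_mult[of "_ * _" "_ + _"] norm_mult[of "- (1/2)"] norm_of_real norm_complex_vec by simp
  ultimately have "norm (heat_multiplier sg j (complex_vec x y) lam) \<le> (1/2) * (2 * ((1 + \<bar>lam\<bar>) * ?H * exp (- ?\<rho> / 4))) * (\<bar>x $ j\<bar> + \<bar>y $ j\<bar>)"
    using H by (simp only:) (intro mult_mono mult_left_mono 1, auto)
  also have "\<dots> = ((1 + \<bar>lam\<bar>) * ?H) * (((\<bar>x $ j\<bar> + \<bar>y $ j\<bar>) * exp (- (norm y)\<^sup>2 / 4)) * exp (- (1/4) * (norm x)\<^sup>2))"
  proof -
    have "exp (- ?\<rho> / 4) = exp (- (norm y)\<^sup>2 / 4) * exp (- (1/4) * (norm x)\<^sup>2)"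
      by (simp add: exp_add[symmetric] add_divide_distrib)
    then show ?thesis by (simp only:) simp
  qed
  also have "\<dots> \<le> ((1 + \<bar>lam\<bar>) * ?H) * ((\<bar>x $ j\<bar> + 2) * exp (- (1/4) * (norm x)\<^sup>2))"
  proof (intro mult_left_mono mult_right_mono)
    have "(y $ j)\<^sup>2 \<le> (norm y)\<^sup>2" using component_le_norm_cart[of y j] by (simp add: abs_le_square_iff[symmetric])
    then have "\<bar>y $ j\<bar> * exp (- (norm y)\<^sup>2 / 4) \<le> 1 * \<bar>y $ j\<bar> * exp (- (1 * (y $ j)\<^sup>2) / 4)"
      by (simp add: mult_left_mono)
    also have "\<dots> \<le> 1 + 1" by (rule mult_gaussian_le) simp
    finally have "\<bar>y $ j\<bar> * exp (- (norm y)\<^sup>2 / 4) \<le> 2" by simp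
    moreover have "\<bar>x $ j\<bar> * exp (- (norm y)\<^sup>2 / 4) \<le> \<bar>x $ j\<bar>" by (intro mult_left_le) auto
    ultimately show "(\<bar>x $ j\<bar> + \<bar>y $ j\<bar>) * exp (- (norm y)\<^sup>2 / 4) \<le> \<bar>x $ j\<bar> + 2" by (simp add: distrib_right)
  qed (use H in auto)
  finally show ?thesis by (simp add: gaussian_majorant_def mult_ac)
qed

text \<open>By \<open>Z_tilde_heat_kernel\<close> this is the combination of the tilde fields
  applied to \<open>p 1\<close>, in real coordinates.\<close>

definition Z_kernel :: "real \<Rightarrow> 'n::finite \<Rightarrow> real^'n \<Rightarrow> real^'n \<Rightarrow> real \<Rightarrow> complex" where
  "Z_kernel sg j x y t = of_real (1 / (2 * pi)) * (LBINT lam. heat_multiplier sg j (complex_vec x y) lam * cis (- (lam * t)))"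

lemma borel_measurable_Z_kernel [measurable]:
  assumes [measurable]: "f \<in> borel_measurable M" "g \<in> borel_measurable M" "h \<in> borel_measurable M"
  shows "(\<lambda>x. Z_kernel sg j (f x :: real^'n::finite) (g x) (h x)) \<in> borel_measurable M"
  unfolding Z_kernel_def by measurable

lemma Z_kernel_bound:
  assumes sg: "\<bar>sg\<bar> = 1"
  obtains C where "C \<ge> 0" "\<And>x y t. norm (Z_kernel sg j (x :: real^'n::finite) y t) \<le> C * gaussian_majorant j x"
proof -
  let ?h = "\<lambda>lam. (1 + \<bar>lam\<bar>) * heat_factor CARD('n) lam"
  define C where "C = 1 / (2 * pi) * (LBINT lam. ?h lam)"
  have h0: "0 \<le> ?h lam" for lam by (simp add: heat_factor_nonneg)
  have hi: "integrable lborel ?h" by (rule integrable_heat_factor) simp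
  have main: "norm (Z_kernel sg j x y t) \<le> C * gaussian_majorant j x" for x y :: "real^'n" and t
  proof -
    have "norm (LBINT lam. heat_multiplier sg j (complex_vec x y) lam * cis (- (lam * t))) \<le>
        (LBINT lam. norm (heat_multiplier sg j (complex_vec x y) lam * cis (- (lam * t))))"
      by (rule integral_norm_bound)
    also have "\<dots> \<le> (LBINT lam. gaussian_majorant j x * ?h lam)"
      using hi h0 heat_multiplier_bound[OF sg, of j x y]
      by (intro integral_mono') (auto simp: norm_mult gaussian_majorant_nonneg intro!: mult_nonneg_nonneg)
    finally have "norm (LBINT lam. heat_multiplier sg j (complex_vec x y) lam * cis (- (lam * t))) \<le> gaussian_majorant j x * (LBINT lam. ?h lam)"
      by (simp only: integral_mult_right_zero)
    then have "1 / (2 * pi) * norm (LBINT lam. heat_multiplier sg j (complex_vec x y) lam * cis (- (lam * t))) \<le> 1 / (2 * pi) * (gaussian_majorant j x * (LBINT lam. ?h lam))"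
      by (rule mult_left_mono) simp
    moreover have "norm (complex_of_real (1 / (2 * pi))) = 1 / (2 * pi)" by (simp only: norm_of_real) simp
    ultimately show ?thesis unfolding Z_kernel_def C_def norm_mult by (simp only: mult_ac)
  qed
  show ?thesis
    by (rule that[OF _ main]) (use h0 in \<open>auto simp: C_def intro!: mult_nonneg_nonneg divide_nonneg_nonneg Bochner_Integration.integral_nonneg\<close>)
qed

text \<open>The third argument is the t for which the curve shifts the central variable by exactly
  \<open>\<delta>\<close>. Rescaling \<open>lam\<close> by \<open>r\<^sup>2\<close> separates the
  phase into \<open>cis (- (lam * \<delta>))\<close> and a character of x, so that
  \<open>heat_multiplier_integral\<close> applies.\<close>

lemma Z_kernel_integral:
  fixes \<xi> y :: "real^'n::finite"
  assumes sg: "\<bar>sg\<bar> = 1" and r: "r \<noteq> 0"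
  shows "(LBINT x. Z_kernel sg j x y ((\<delta> - r * (x \<bullet> \<xi>)) / r\<^sup>2 - (x \<bullet> y) / 2)) =
    of_real (1 / (2 * pi) * r\<^sup>2 * (r * \<bar>r\<bar> ^ CARD('n))) * ladder_kernel sg j \<xi> (r\<^sup>2) (\<xi> + r *\<^sub>R y) \<delta>"
proof -
  define t where "t x = (\<delta> - r * (x \<bullet> \<xi>)) / r\<^sup>2 - (x \<bullet> y) / 2" for x :: "real^'n"
  have sg2: "sg * sg = 1" using sg by (auto simp: abs_if split: if_splits)
  have [measurable]: "t \<in> borel_measurable borel" unfolding t_def by measurable
  let ?h = "\<lambda>lam. (1 + \<bar>lam\<bar>) * heat_factor CARD('n) lam"
  define W where "W x lam = heat_multiplier sg j (complex_vec x y) (lam * r\<^sup>2) * cis (- (lam * r\<^sup>2 * t x))" for x lam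
  have Z: "Z_kernel sg j x y (t x) = of_real (1 / (2 * pi) * r\<^sup>2) * (LBINT lam. W x lam)" for x
  proof -
    have "(LBINT lam. heat_multiplier sg j (complex_vec x y) lam * cis (- (lam * t x))) =
       \<bar>r\<^sup>2\<bar> *\<^sub>R (LBINT lam. heat_multiplier sg j (complex_vec x y) (0 + r\<^sup>2 * lam) * cis (- ((0 + r\<^sup>2 * lam) * t x)))"
      using r by (intro lborel_integral_real_affine) simp
    then show ?thesis
      by (simp add: Z_kernel_def W_def scaleR_conv_of_real mult.commute[of "r\<^sup>2"])
  qed
  have Wint: "integrable (lborel \<Otimes>\<^sub>M lborel) (case_prod W)"
  proof (rule integrable_pair_dominated[OF integrable_gaussian_majorant])
    have "integrable lborel (\<lambda>lam. ?h (0 + r\<^sup>2 * lam))"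
      using r by (intro lborel_integrable_real_affine integrable_heat_factor) auto
    then show "integrable lborel (\<lambda>lam. ?h (lam * r\<^sup>2))" by (simp add: mult.commute)
    show "case_prod W \<in> borel_measurable (lborel \<Otimes>\<^sub>M lborel)" unfolding W_def by measurable
    show "norm (W x lam) \<le> gaussian_majorant j x * ?h (lam * r\<^sup>2)" for x lam
      unfolding W_def norm_mult norm_cis mult_1_right by (rule heat_multiplier_bound[OF sg])
  qed
  have phase: "W x lam = cis (- (lam * \<delta>)) * (cis (((lam * r) *\<^sub>R (\<xi> + (r / 2) *\<^sub>R y)) \<bullet> x) * heat_multiplier sg j (complex_vec x y) (lam * r\<^sup>2))" for x lam
  proof -
    have "r\<^sup>2 * t x = \<delta> - r * (x \<bullet> \<xi>) - r\<^sup>2 * (x \<bullet> y) / 2"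
    proof -
      have "r\<^sup>2 * ((\<delta> - u) / r\<^sup>2 - v / 2) = \<delta> - u - r\<^sup>2 * v / 2" for u v
        using r by (simp add: field_simps)
      then show ?thesis unfolding t_def .
    qed
    then have "lam * r\<^sup>2 * t x = lam * (\<delta> - r * (x \<bullet> \<xi>) - r\<^sup>2 * (x \<bullet> y) / 2)" by (simp add: mult.assoc)
    also have "- \<dots> = - (lam * \<delta>) + ((lam * r) *\<^sub>R (\<xi> + (r / 2) *\<^sub>R y)) \<bullet> x"
      by (simp add: inner_add_left inner_commute[of x] algebra_simps power2_eq_square)
    finally have "cis (- (lam * r\<^sup>2 * t x)) = cis (- (lam * \<delta>)) * cis (((lam * r) *\<^sub>R (\<xi> + (r / 2) *\<^sub>R y)) \<bullet> x)"
      by (simp only: cis_mult)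
    then show ?thesis by (simp add: W_def)
  qed
  have "(LBINT x. Z_kernel sg j x y (t x)) = of_real (1 / (2 * pi) * r\<^sup>2) * (LBINT x. LBINT lam. W x lam)"
    unfolding Z integral_mult_right_zero ..
  also have "(LBINT x. LBINT lam. W x lam) = (LBINT lam. LBINT x. W x lam)"
    by (rule lborel_pair.Fubini_integral[OF Wint, symmetric])
  also have "\<dots> = (LBINT lam. of_real (r * \<bar>r\<bar> ^ CARD('n)) * (cis (- (lam * \<delta>)) * of_real (mehler_ladder sg j lam (r\<^sup>2) \<xi> (\<xi> + r *\<^sub>R y))))"
  proof (rule integral_eq_except_point[where c = "0::real"])
    fix lam :: real assume lam: "lam \<noteq> 0"
    show "(LBINT x. W x lam) = of_real (r * \<bar>r\<bar> ^ CARD('n)) * (cis (- (lam * \<delta>)) * of_real (mehler_ladder sg j lam (r\<^sup>2) \<xi> (\<xi> + r *\<^sub>R y)))"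
      unfolding phase integral_mult_right_zero heat_multiplier_integral[OF sg2 lam r] of_real_mult[of "r * \<bar>r\<bar> ^ CARD('n)"]
      by (simp only: mult.left_commute)
  qed measurable
  also have "\<dots> = of_real (r * \<bar>r\<bar> ^ CARD('n)) * ladder_kernel sg j \<xi> (r\<^sup>2) (\<xi> + r *\<^sub>R y) \<delta>"
    unfolding integral_mult_right_zero ladder_kernel_def ..
  finally show ?thesis unfolding t_def by (simp only: of_real_mult mult.assoc)
qed

subsection \<open>The Heisenberg side\<close>

lemma borel_measurable_Re_vec [measurable]:
  fixes f :: "'a \<Rightarrow> complex^'n::finite"
  assumes "f \<in> borel_measurable M"
  shows "(\<lambda>x. Re_vec (f x)) \<in> borel_measurable M"
  by (rule borel_measurable_continuous_on[OF _ assms]) (unfold Re_vec_def, intro continuous_intros)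

lemma borel_measurable_Im_vec [measurable]:
  fixes f :: "'a \<Rightarrow> complex^'n::finite"
  assumes "f \<in> borel_measurable M"
  shows "(\<lambda>x. Im_vec (f x)) \<in> borel_measurable M"
  by (rule borel_measurable_continuous_on[OF _ assms]) (unfold Im_vec_def, intro continuous_intros)

lemma complex_vec_Re_Im: "complex_vec (Re_vec z) (Im_vec z) = z"
  by (simp add: vec_eq_iff Re_vec_def Im_vec_def)

context
  fixes f :: "(real^'n::finite) \<times> real \<Rightarrow> complex" and \<epsilon> sg \<eta> :: real and \<xi> :: "real^'n" and j :: 'n
  assumes f: "integrable lborel f" and \<epsilon>: "\<epsilon> > 0" and sg: "\<bar>sg\<bar> = 1"
begin

lemma f_borel [measurable]: "f \<in> borel_measurable borel"
  using f by auto

text \<open>The integrand for fixed radius and x, as a function of the pair of y and t; the weight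
  1/r is left out.\<close>

definition curve_integrand :: "real \<Rightarrow> real^'n \<Rightarrow> (real^'n) \<times> real \<Rightarrow> complex" where
  "curve_integrand r x p = f (\<xi> + r *\<^sub>R fst p, \<eta> - (r * (x \<bullet> \<xi>) + r\<^sup>2 * (snd p + (x \<bullet> fst p) / 2))) * Z_kernel sg j x (fst p) (snd p)"

text \<open>The same integrand in new variables, where \<open>f\<close> is evaluated at
  \<open>p\<close> itself and y and t are solved for.\<close>

definition straight_integrand :: "real \<Rightarrow> real^'n \<Rightarrow> (real^'n) \<times> real \<Rightarrow> complex" where
  "straight_integrand r x p = f p * Z_kernel sg j x ((1 / r) *\<^sub>R (fst p - \<xi>))
     (((\<eta> - snd p) - r * (x \<bullet> \<xi>)) / r\<^sup>2 - (x \<bullet> ((1 / r) *\<^sub>R (fst p - \<xi>))) / 2)"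

lemma borel_measurable_curve_integrand [measurable]:
  assumes [measurable]: "a \<in> borel_measurable M" "b \<in> borel_measurable M" "c \<in> borel_measurable M"
  shows "(\<lambda>x. curve_integrand (a x) (b x) (c x)) \<in> borel_measurable M"
  unfolding curve_integrand_def by measurable

lemma borel_measurable_straight_integrand [measurable]:
  assumes [measurable]: "b \<in> borel_measurable M" "c \<in> borel_measurable M"
  shows "(\<lambda>x. straight_integrand r (b x) (c x)) \<in> borel_measurable M"
  unfolding straight_integrand_def by measurable

text \<open>The substitution is an affine shear with scale \<open>r\<close> in y and
  \<open>- r\<^sup>2\<close> in t, hence with Jacobian
  \<open>\<bar>r\<bar> ^ CARD('n) * r\<^sup>2\<close>.\<close>

lemma curve_eq_straight:
  assumes r: "r \<noteq> 0"
  shows "curve_integrand r x p = straight_integrand r x (\<xi> + r *\<^sub>R fst p, (\<eta> - r * (x \<bullet> \<xi>) - r\<^sup>2 * (x \<bullet> fst p) / 2) + (- r\<^sup>2) * snd p)"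
proof -
  have e1: "(1 / r) *\<^sub>R (\<xi> + r *\<^sub>R fst p - \<xi>) = fst p" using r by simp
  have e2: "((\<eta> - (\<eta> - (u + r\<^sup>2 * (w + v / 2)))) - u) / r\<^sup>2 - v / 2 = w" for u v w
    using r by (simp add: field_simps)
  have e3: "(\<eta> - u - r\<^sup>2 * v / 2) + (- r\<^sup>2) * w = \<eta> - (u + r\<^sup>2 * (w + v / 2))" for u v w
    by (simp add: algebra_simps)
  show ?thesis
    unfolding curve_integrand_def straight_integrand_def fst_conv snd_conv e1 e3 e2 ..
qed

text \<open>The constant is independent of \<open>r\<close>: in these variables the radius enters
  through the arguments of the kernel only, and \<open>Z_kernel_bound\<close> is uniform in
  them.\<close>

lemma straight_integrand_bound:
  obtains C where "C \<ge> 0" "\<And>r x p. norm (straight_integrand r x p) \<le> C * gaussian_majorant j x * norm (f p)"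
proof -
  obtain C where C: "C \<ge> 0" "\<And>x y t. norm (Z_kernel sg j (x :: real^'n) y t) \<le> C * gaussian_majorant j x"
    using Z_kernel_bound[OF sg, of j] by metis
  show ?thesis
  proof (rule that[OF C(1)])
    show "norm (straight_integrand r x p) \<le> C * gaussian_majorant j x * norm (f p)" for r x p
      unfolding straight_integrand_def norm_mult
      by (subst mult.commute) (intro mult_right_mono C, simp)
  qed
qed

lemma integrable_straight_integrand: "integrable lborel (straight_integrand r x)"
proof -
  obtain C where C: "\<And>r x p. norm (straight_integrand r x p) \<le> C * gaussian_majorant j x * norm (f p)"
    using straight_integrand_bound by metis
  show ?thesis
    by (rule integrable_dominated[OF integrable_mult_right[OF integrable_norm[OF f]] _ C]) measurable
qed

lemma
  assumes r: "r \<noteq> 0"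
  shows integrable_curve_integrand: "integrable lborel (curve_integrand r x)"
    and integral_curve_integrand: "(LBINT p. curve_integrand r x p) = (1 / (\<bar>r\<bar> ^ CARD('n) * r\<^sup>2)) *\<^sub>R (LBINT p. straight_integrand r x p)"
    and integral_norm_curve_integrand: "(LBINT p. norm (curve_integrand r x p)) = (1 / (\<bar>r\<bar> ^ CARD('n) * r\<^sup>2)) * (LBINT p. norm (straight_integrand r x p))"
proof -
  let ?a = "\<lambda>y. \<eta> - r * (x \<bullet> \<xi>) - r\<^sup>2 * (x \<bullet> y) / 2"
  have a: "?a \<in> borel_measurable borel" by measurable
  have d: "- r\<^sup>2 \<noteq> 0" using r by simp
  have c: "\<bar>r\<bar> ^ CARD('n) * r\<^sup>2 \<noteq> 0" using r by simp
  have ce: "curve_integrand r x = (\<lambda>p. straight_integrand r x (\<xi> + r *\<^sub>R fst p, ?a (fst p) + (- r\<^sup>2) * snd p))"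
    by (rule ext) (rule curve_eq_straight[OF r])
  show "integrable lborel (curve_integrand r x)"
    unfolding ce by (rule integrable_affine_shear[OF integrable_straight_integrand a r d])
  have "(LBINT p. straight_integrand r x p) = (\<bar>r\<bar> ^ CARD('n) * r\<^sup>2) *\<^sub>R (LBINT p. curve_integrand r x p)"
    unfolding ce using integral_affine_shear[OF integrable_straight_integrand a r d, of r x \<xi>] by simp
  then show "(LBINT p. curve_integrand r x p) = (1 / (\<bar>r\<bar> ^ CARD('n) * r\<^sup>2)) *\<^sub>R (LBINT p. straight_integrand r x p)"
    using c by (simp only: scaleR_scaleR) simp
  have "(LBINT p. norm (straight_integrand r x p)) = (\<bar>r\<bar> ^ CARD('n) * r\<^sup>2) *\<^sub>R (LBINT p. norm (curve_integrand r x p))"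
    unfolding ce using integral_affine_shear[OF integrable_norm[OF integrable_straight_integrand] a r d, of r x \<xi>] by simp
  then show "(LBINT p. norm (curve_integrand r x p)) = (1 / (\<bar>r\<bar> ^ CARD('n) * r\<^sup>2)) * (LBINT p. norm (straight_integrand r x p))"
    using c by simp
qed

lemma integral_straight_integrand:
  assumes r: "r \<noteq> 0"
  shows "(LBINT x. LBINT p. straight_integrand r x p) =
    of_real (1 / (2 * pi) * r\<^sup>2 * (r * \<bar>r\<bar> ^ CARD('n))) * (LBINT p. f p * ladder_kernel sg j \<xi> (r\<^sup>2) (fst p) (\<eta> - snd p))"
proof -
  obtain C where C: "C \<ge> 0" "\<And>r x p. norm (straight_integrand r x p) \<le> C * gaussian_majorant j x * norm (f p)"
    using straight_integrand_bound by metis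
  have i: "integrable (lborel \<Otimes>\<^sub>M lborel) (case_prod (straight_integrand r))"
    by (rule integrable_pair_dominated[OF integrable_mult_right[OF integrable_gaussian_majorant] integrable_norm[OF f] _ C(2)]) measurable
  have e: "(LBINT x. straight_integrand r x p) = of_real (1 / (2 * pi) * r\<^sup>2 * (r * \<bar>r\<bar> ^ CARD('n))) *
      (f p * ladder_kernel sg j \<xi> (r\<^sup>2) (fst p) (\<eta> - snd p))" for p
  proof -
    have "\<xi> + r *\<^sub>R ((1 / r) *\<^sub>R (fst p - \<xi>)) = fst p" using r by simp
    then show ?thesis
      unfolding straight_integrand_def integral_mult_right_zero Z_kernel_integral[OF sg r] by (simp only: mult.left_commute)
  qed
  have "(LBINT x. LBINT p. straight_integrand r x p) = (LBINT p. LBINT x. straight_integrand r x p)"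
    by (rule lborel_pair.Fubini_integral[OF i, symmetric])
  then show ?thesis unfolding e integral_mult_right_zero .
qed

lemma T_op_times_Z_kernel:
  "T_op \<epsilon> (heis_coords q) f \<xi> \<eta> * Z_kernel sg j (fst q) (fst (snd q)) (snd (snd q)) =
     (LBINT r. of_real (indicator (annulus \<epsilon>) r / r) * curve_integrand r (fst q) (snd q))"
proof -
  let ?Z = "Z_kernel sg j (fst q) (fst (snd q)) (snd (snd q))"
  let ?f = "\<lambda>r. indicator (annulus \<epsilon>) r *\<^sub>R
        (f (\<xi> + r *\<^sub>R fst (snd q), \<eta> - (r * (fst q \<bullet> \<xi>) + r\<^sup>2 * (snd (snd q) + (fst q \<bullet> fst (snd q)) / 2))) / of_real r)"
  have "T_op \<epsilon> (heis_coords q) f \<xi> \<eta> = (LBINT r. ?f r)"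
    by (simp add: T_op_def heis_coords_def Let_def annulus_def set_lebesgue_integral_def)
  then have "T_op \<epsilon> (heis_coords q) f \<xi> \<eta> * ?Z = (LBINT r. ?f r * ?Z)"
    by (simp only: integral_mult_left_zero)
  also have "\<dots> = (LBINT r. of_real (indicator (annulus \<epsilon>) r / r) * curve_integrand r (fst q) (snd q))"
    by (intro Bochner_Integration.integral_cong refl) (simp add: curve_integrand_def scaleR_conv_of_real)
  finally show ?thesis .
qed

text \<open>Integrability over radius and group together. For fixed radius the shear leaves a
  product of \<open>gaussian_majorant\<close> and \<open>f\<close>; the Jacobian and the weight 1/r
  are bounded on the annulus, which has finite measure.\<close>

lemma integrable_weighted_curve_integrand:
  "integrable (lborel \<Otimes>\<^sub>M lborel) (\<lambda>(r, q). of_real (indicator (annulus \<epsilon>) r / r) * curve_integrand r (fst q) (snd q))"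
  (is "integrable _ (\<lambda>(r, q). ?G r q)")
  and integrable_curve_integrand_space: "r \<in> annulus \<epsilon> \<Longrightarrow> integrable (lborel \<Otimes>\<^sub>M lborel) (\<lambda>q. curve_integrand r (fst q) (snd q))"
proof -
  obtain C where C: "C \<ge> 0" "\<And>r x p. norm (straight_integrand r x p) \<le> C * gaussian_majorant j x * norm (f p)"
    using straight_integrand_bound by metis
  define D where "D = C * (LBINT p. norm (f p))"
  \<comment> \<open>The largest value of the inverse Jacobian, approached at the inner radius of the
    annulus.\<close>
  define E where "E = 1 / (\<epsilon> ^ CARD('n) * \<epsilon>\<^sup>2)"
  have D0: "D \<ge> 0" using C by (simp add: D_def)
  have E0: "E \<ge> 0" using \<epsilon> by (simp add: E_def)
  have r0: "r \<noteq> 0" and re: "\<epsilon> \<le> \<bar>r\<bar>" if "r \<in> annulus \<epsilon>" for r using that \<epsilon> by (auto simp: annulus_def)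
  have s: "(LBINT p. norm (straight_integrand r x p)) \<le> D * gaussian_majorant j x" for r x
  proof -
    have "(LBINT p. norm (straight_integrand r x p)) \<le> (LBINT p. (C * gaussian_majorant j x) * norm (f p))"
      using f C integrable_straight_integrand[of r x] by (intro integral_mono) auto
    then show ?thesis by (simp add: D_def mult_ac)
  qed
  have c: "(LBINT p. norm (curve_integrand r x p)) \<le> E * (D * gaussian_majorant j x)" if "r \<in> annulus \<epsilon>" for r x
  proof -
    have "\<epsilon>\<^sup>2 \<le> r\<^sup>2" using re[OF that] \<epsilon> by (auto simp: abs_le_square_iff[symmetric])
    then have "\<epsilon> ^ CARD('n) * \<epsilon>\<^sup>2 \<le> \<bar>r\<bar> ^ CARD('n) * r\<^sup>2"
      using \<epsilon> by (intro mult_mono[OF power_mono[OF re[OF that]]]) auto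
    then have "1 / (\<bar>r\<bar> ^ CARD('n) * r\<^sup>2) \<le> E"
      unfolding E_def using \<epsilon> r0[OF that] by (intro divide_left_mono) auto
    then show ?thesis
      unfolding integral_norm_curve_integrand[OF r0[OF that]] using E0
      by (intro mult_mono s) auto
  qed
  show space: "integrable (lborel \<Otimes>\<^sub>M lborel) (\<lambda>q. curve_integrand r (fst q) (snd q))" if r: "r \<in> annulus \<epsilon>" for r
  proof (rule lborel_pair.Fubini_integrable)
    show "AE x in lborel. integrable lborel (\<lambda>p. curve_integrand r (fst (x, p)) (snd (x, p)))"
      using integrable_curve_integrand[OF r0[OF r]] by simp
    show "integrable lborel (\<lambda>x. LBINT p. norm (curve_integrand r (fst (x, p)) (snd (x, p))))"
    proof (rule integrable_dominated)
      show "integrable lborel (\<lambda>x. E * (D * gaussian_majorant j x))"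
        by (intro integrable_mult_right integrable_gaussian_majorant)
    qed (use c[OF r] in simp_all)
  qed measurable
  have norm_space: "(LBINT q. norm (curve_integrand r (fst q) (snd q))) \<le> E * (D * (LBINT x. gaussian_majorant j x))"
    if r: "r \<in> annulus \<epsilon>" for r
  proof -
    have "(LBINT q. norm (curve_integrand r (fst q) (snd q))) = (LBINT x. LBINT p. norm (curve_integrand r x p))"
      using lborel_pair.integral_fst'[OF integrable_norm[OF space[OF r]]] by (simp add: lborel_prod)
    also have "\<dots> \<le> (LBINT x. E * (D * gaussian_majorant j x))"
      by (rule integral_mono')
        (auto intro!: c[OF r] integrable_mult_right integrable_gaussian_majorant mult_nonneg_nonneg E0 D0 gaussian_majorant_nonneg)
    finally show ?thesis by simp
  qed
  show "integrable (lborel \<Otimes>\<^sub>M lborel) (\<lambda>(r, q). ?G r q)"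
  proof (rule lborel_pair.Fubini_integrable)
    show "AE r in lborel. integrable lborel (\<lambda>q. case (r, q) of (r, q) \<Rightarrow> ?G r q)"
    proof (rule AE_I2)
      fix r
      show "integrable lborel (\<lambda>q. case (r, q) of (r, q) \<Rightarrow> ?G r q)"
        using space[of r] by (cases "r \<in> annulus \<epsilon>") (simp_all add: lborel_prod)
    qed
    show "integrable lborel (\<lambda>r. LBINT q. norm (case (r, q) of (r, q) \<Rightarrow> ?G r q))"
    proof (rule integrable_dominated)
      let ?K = "1 / \<epsilon> * (E * (D * (LBINT x. gaussian_majorant j x)))"
      show "integrable lborel (\<lambda>r. ?K * indicator (annulus \<epsilon>) r)"
        by (intro integrable_mult_right integrable_indicator_annulus)
      fix r
      show "norm (LBINT q. norm (case (r, q) of (r, q) \<Rightarrow> ?G r q)) \<le> ?K * indicator (annulus \<epsilon>) r"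
      proof (cases "r \<in> annulus \<epsilon>")
        case True
        have "norm (LBINT q. norm (case (r, q) of (r, q) \<Rightarrow> ?G r q)) = 1 / \<bar>r\<bar> * (LBINT q. norm (curve_integrand r (fst q) (snd q)))"
          using True by (simp add: norm_mult norm_divide)
        also have "\<dots> \<le> ?K"
          using re[OF True] \<epsilon> by (intro mult_mono norm_space[OF True] divide_left_mono) auto
        finally show ?thesis using True by simp
      qed simp
    qed measurable
  qed measurable
qed

text \<open>For a single group element the curve integral of an integrable \<open>f\<close> may
  diverge, so convergence is not argued pointwise: the product is integrated over radius and group
  jointly, and Fubini brings the radius outside.\<close>

lemma T_op_integral:
  assumes p: "heisenberg_heat_kernel p"
  shows "(LBINT w. T_op \<epsilon> w f \<xi> \<eta> * (\<i> * X_tilde j (\<lambda>v. complex_of_real (p 1 v)) w + of_real sg * Y_tilde j (\<lambda>v. complex_of_real (p 1 v)) w)) =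
    (LBINT r. of_real (indicator (annulus \<epsilon>) r) *
      (of_real (1 / (2 * pi)) * (LBINT p. f p * ladder_kernel sg j \<xi> (r\<^sup>2) (fst p) (\<eta> - snd p))))"
proof -
  let ?Z = "\<lambda>w. Z_kernel sg j (Re_vec (fst w)) (Im_vec (fst w)) (snd w)"
  have sg2: "sg * sg = 1" using sg by (auto simp: abs_if split: if_splits)
  have Z: "\<i> * X_tilde j (\<lambda>v. complex_of_real (p 1 v)) w + of_real sg * Y_tilde j (\<lambda>v. complex_of_real (p 1 v)) w = ?Z w" for w
    using Z_tilde_heat_kernel[OF p sg2, of j "fst w" "snd w"] by (simp add: Z_kernel_def complex_vec_Re_Im)
  have [measurable]: "(\<lambda>w. T_op \<epsilon> w f \<xi> \<eta>) \<in> borel_measurable borel"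
  proof -
    have "(\<lambda>w. LBINT r. indicator (annulus \<epsilon>) r *\<^sub>R (f (\<xi> + r *\<^sub>R Im_vec (fst w), \<eta> - (r * (Re_vec (fst w) \<bullet> \<xi>) + r\<^sup>2 * (snd w + (Re_vec (fst w) \<bullet> Im_vec (fst w)) / 2))) / of_real r))
      \<in> borel_measurable (borel :: 'n heis measure)"
      by measurable
    then show ?thesis by (simp add: T_op_def[abs_def] Let_def annulus_def set_lebesgue_integral_def)
  qed
  have "(LBINT w. T_op \<epsilon> w f \<xi> \<eta> * ?Z w) = (LINT w|distr lborel borel heis_coords. T_op \<epsilon> w f \<xi> \<eta> * ?Z w)"
    by (simp only: distr_heis_coords)
  also have "\<dots> = (LBINT q. T_op \<epsilon> (heis_coords q) f \<xi> \<eta> * ?Z (heis_coords q))"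
    by (rule integral_distr) measurable
  also have "\<dots> = (LBINT q. LBINT r. of_real (indicator (annulus \<epsilon>) r / r) * curve_integrand r (fst q) (snd q))"
    unfolding T_op_times_Z_kernel[symmetric] by (simp add: heis_coords_def)
  also have "\<dots> = (LBINT r. LBINT q. of_real (indicator (annulus \<epsilon>) r / r) * curve_integrand r (fst q) (snd q))"
    by (rule lborel_pair.Fubini_integral[OF integrable_weighted_curve_integrand])
  also have "\<dots> = (LBINT r. of_real (indicator (annulus \<epsilon>) r) *
      (of_real (1 / (2 * pi)) * (LBINT p. f p * ladder_kernel sg j \<xi> (r\<^sup>2) (fst p) (\<eta> - snd p))))"
  proof (rule Bochner_Integration.integral_cong[OF refl])
    fix r
    let ?L = "LBINT p. f p * ladder_kernel sg j \<xi> (r\<^sup>2) (fst p) (\<eta> - snd p)"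
    show "(LBINT q. of_real (indicator (annulus \<epsilon>) r / r) * curve_integrand r (fst q) (snd q)) =
       of_real (indicator (annulus \<epsilon>) r) * (of_real (1 / (2 * pi)) * ?L)"
    proof (cases "r \<in> annulus \<epsilon>")
      case True
      then have r: "r \<noteq> 0" using \<epsilon> by (auto simp: annulus_def)
      have "(LBINT q. curve_integrand r (fst q) (snd q)) = (LBINT x. LBINT p. curve_integrand r x p)"
        using lborel_pair.integral_fst'[OF integrable_curve_integrand_space[OF True]] by (simp add: lborel_prod)
      also have "\<dots> = (1 / (\<bar>r\<bar> ^ CARD('n) * r\<^sup>2)) *\<^sub>R (of_real (1 / (2 * pi) * r\<^sup>2 * (r * \<bar>r\<bar> ^ CARD('n))) * ?L)"
        unfolding integral_curve_integrand[OF r] integral_scaleR_right integral_straight_integrand[OF r] ..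
      also have "\<dots> = of_real ((1 / (\<bar>r\<bar> ^ CARD('n) * r\<^sup>2)) * (1 / (2 * pi) * r\<^sup>2 * (r * \<bar>r\<bar> ^ CARD('n)))) * ?L"
        by (simp only: scaleR_conv_of_real of_real_mult mult.assoc)
      \<comment> \<open>The Jacobian cancels everything except one odd factor \<open>r\<close>,
        which is then cancelled by the weight 1/r; what remains is even in \<open>r\<close>, as on
        the Grushin side.\<close>
      also have "(1 / (\<bar>r\<bar> ^ CARD('n) * r\<^sup>2)) * (1 / (2 * pi) * r\<^sup>2 * (r * \<bar>r\<bar> ^ CARD('n))) = r * (1 / (2 * pi))"
        using r by simp
      finally show ?thesis
        using True r unfolding integral_mult_right_zero by simp
    qed simp
  qed
  finally show ?thesis unfolding Z .
qed

end

theorem proposition3p1: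
  fixes f :: "(real^'n::finite) \<times> real \<Rightarrow> complex"
    and p :: "real \<Rightarrow> (complex^'n) \<times> real \<Rightarrow> real"
    and j :: 'n and \<epsilon> :: real and \<xi> :: "real^'n" and \<eta> :: real
  assumes "heisenberg_heat_kernel p"
    and "\<epsilon> > 0"
    and "integrable lborel f"
  shows "grushin_riesz \<epsilon> j f \<xi> \<eta> =
           of_real (1 / sqrt pi) *
           (LBINT w. T_op \<epsilon> w f \<xi> \<eta> * Z_tilde j (\<lambda>v. complex_of_real (p 1 v)) w)
       \<and> grushin_riesz_star \<epsilon> j f \<xi> \<eta> =
           of_real (1 / sqrt pi) *
           (LBINT w. T_op \<epsilon> w f \<xi> \<eta> * Z_tilde_star j (\<lambda>v. complex_of_real (p 1 v)) w)"
proof -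
  \<comment> \<open>Both sides equal the same annulus integral of \<open>f\<close> against
    \<open>ladder_kernel\<close>; \<open>sg = 1\<close> yields the first formula and
    \<open>sg = -1\<close> the starred one.\<close>
  have main: "of_real (1 / (2 * pi)) * (LBINT lam. cis (- (lam * \<eta>)) * (of_real (1 / sqrt pi) *
      ladder_op sg lam j (hermite_truncated_integral \<epsilon> lam (fourier_eta lam f)) \<xi>)) =
    of_real (1 / sqrt pi) * (LBINT w. T_op \<epsilon> w f \<xi> \<eta> *
      (\<i> * X_tilde j (\<lambda>v. complex_of_real (p 1 v)) w + of_real sg * Y_tilde j (\<lambda>v. complex_of_real (p 1 v)) w))"
    if "\<bar>sg\<bar> = 1" for sg
    unfolding riesz_eq_ladder_kernel[OF assms(3,2) that] T_op_integral[OF assms(3,2) that assms(1)] ..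
  have "ladder_op 1 lam j = A_op lam j" "ladder_op (-1) lam j = A_star_op lam j" for lam
    by (simp_all add: fun_eq_iff ladder_op_def A_op_def A_star_op_def)
  then show ?thesis
    using main[of 1] main[of "-1"]
    by (simp add: grushin_riesz_def grushin_riesz_star_def hermite_riesz_def hermite_riesz_star_def
        Z_tilde_def Z_tilde_star_def)
qed

end
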